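(* Let $R$ be a commutative Noetherian ring. Assume that $\mathcal{C}$ is a triangulated category such that $\mathcal{C}^{op}$ is an $R$-saturated category, $t$ is an essentially bounded below $t$-structure on $\mathcal{C}$, and there are enough projectives in $\underline{Ht}$. 1. If $t$ is also essentially bounded then for any projective object $P$ of $\underline{Ht}$ there exists $P'\in P_t$ such that $H_0^t(P')\cong P$. 2. Assume that for any projective object $P$ of $\underline{Ht}$ there exists $P'\in P_t$ along with an $\underline{Ht}$-epimorphism $H_0^t(P')\to P$. Then there exists an essentially bounded below weight structure $w$ on $\mathcal{C}$ (left) adjacent to $t$.
   Context: Conventions: $X\perp Y$ means $\mathcal{C}(X,Y)=0$, for classes $D\perp E$ means $X\perp Y$ for all $X\in D$, $Y\in E$; ${}^{\perp}D=\{Y:\ Y\perp X\ \forall X\in D\}$. For a cohomological functor $H$ put $H^i(M)=H(M[-i])$; $H$ is locally bounded if for every object $M$ we have $H^i(M)=0$ for $|i|\gg 0$. An $R$-linear triangulated category $\mathcal{E}$ is $R$-saturated if the representable functors from $\mathcal{E}^{op}$ into $R$-modules are exactly the ($R$-linear cohomological) ones that are locally bounded and take values in finitely generated $R$-modules. A $t$-structure $t=(\mathcal{C}_{t\le 0},\mathcal{C}_{t\ge 0})$ on $\mathcal{C}$ (homological convention) is a pair of classes of objects closed under isomorphism such that $\mathcal{C}_{t\le 0}\subset \mathcal{C}_{t\le 0}[1]$, $\mathcal{C}_{t\ge 0}[1]\subset \mathcal{C}_{t\ge 0}$, $\mathcal{C}_{t\ge 0}[1]\perp \mathcal{C}_{t\le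 0}$, and every object $M$ fits into a distinguished triangle $L_tM\to M\to R_tM\to L_tM[1]$ with $L_tM\in \mathcal{C}_{t\ge 0}$, $R_tM\in\mathcal{C}_{t\le 0}[-1]$ (functorial in $M$). $\mathcal{C}_{t\le i}=\mathcal{C}_{t\le 0}[i]$, $\mathcal{C}_{t\ge i}=\mathcal{C}_{t\ge 0}[i]$; the heart $\underline{Ht}$ is the full (abelian) subcategory with objects $\mathcal{C}_{t\le 0}\cap \mathcal{C}_{t\ge 0}$. $t_{\ge 0}=L_t$, $t_{\le 0}=[1]\circ R_t\circ[-1]$, $H_0^t=t_{\le 0}\circ t_{\ge 0}:\mathcal{C}\to\underline{Ht}$ is the corresponding homological functor, and $H_i^t=H_0^t\circ[-i]$. $t$ is essentially bounded (resp. essentially bounded below) if for any $M\in\mathrm{Obj}\,\mathcal{C}$ we have $H_i^t(M)=0$ for $|i|\gg 0$ (resp. for $i\ll 0$). $P_t={}^{\perp}(\mathcal{C}_{t\le -1}\cup\mathcal{C}_{t\ge 1})$. A weight structure $w=(\mathcal{C}_{w\le 0},\mathcal{C}_{w\ge 0})$ on $\mathcal{C}$ is a pair of classes of objects closed under retracts such that $\mathcal{C}_{w\le 0}\subset \mathcal{C}_{w\le 0}[1]$, $\mathcal{C}_{w\ge 0}[1]\subset \mathcal{C}_{w\ge 0}$, $\mathcal{C}_{w\le 0}\perp \mathcal{C}_{w\ge 0}[1]$, and every object $M$ fits into a distinguished triangle $L_wM\to M\to R_wM\to L_wM[1]$ with $L_wM\in \mathcal{C}_{w\le 0}$, $R_wM\in\mathcal{C}_{w\ge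 0}[1]$. $w$ is essentially bounded below if for every $M\in\mathrm{Obj}\,\mathcal{C}$ there is $n\in\mathbb{Z}$ such that for $N=M[-n]$ there is a distinguished triangle $RD\to N\oplus N[1]\to Y\to RD[1]$ with $Y\in\mathcal{C}_{w\ge 0}$ and $RD\in\bigcap_{i\in\mathbb{Z}}\mathcal{C}_{w\le 0}[i]$. $w$ is left adjacent to $t$ if $\mathcal{C}_{w\ge 0}=\mathcal{C}_{t\ge 0}$. *)

theory Defs
  imports "HOL-Algebra.Module" "HOL-Algebra.Ring_Divisibility"
begin

section \<open>Modules\<close>

definition linear_map ::
  "('r, 'q) ring_scheme \<Rightarrow> ('r, 'a) module \<Rightarrow> ('r, 'b) module \<Rightarrow> ('a \<Rightarrow> 'b) \<Rightarrow> bool" where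
  "linear_map R M N \<phi> \<longleftrightarrow>
     \<phi> \<in> carrier M \<rightarrow> carrier N \<and>
     (\<forall>x\<in>carrier M. \<forall>y\<in>carrier M. \<phi> (x \<oplus>\<^bsub>M\<^esub> y) = \<phi> x \<oplus>\<^bsub>N\<^esub> \<phi> y) \<and>
     (\<forall>a\<in>carrier R. \<forall>x\<in>carrier M. \<phi> (a \<odot>\<^bsub>M\<^esub> x) = a \<odot>\<^bsub>N\<^esub> \<phi> x)"

definition fin_gen_module :: "('r, 'q) ring_scheme \<Rightarrow> ('r, 'a) module \<Rightarrow> bool" where
  "fin_gen_module R M \<longleftrightarrow>
     (\<exists>A. finite A \<and> A \<subseteq> carrier M \<and>
        carrier M = {(\<Oplus>\<^bsub>M\<^esub>a\<in>A. c a \<odot>\<^bsub>M\<^esub> a) | c. c \<in> A \<rightarrow> carrier R})"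

definition zero_module :: "('r, 'a) module \<Rightarrow> bool" where
  "zero_module M \<longleftrightarrow> carrier M = {\<zero>\<^bsub>M\<^esub>}"


section \<open>Linear categories\<close>

text \<open>
  A category with object set \<open>Ob\<close>, whose hom sets \<open>carrier (Hom X Y)\<close> carry the structure of
  modules.  (The fields \<open>mult\<close> and \<open>one\<close> of the record type of modules are irrelevant.)
  \<open>Cmp g f\<close> is the composite "\<open>g\<close> after \<open>f\<close>".  The hom sets are required to be pairwise
  disjoint below, so that a morphism determines its source and target.
\<close>

record ('r, 'o, 'm) lin_cat =
  Ob :: "'o set"
  Hom :: "'o \<Rightarrow> 'o \<Rightarrow> ('r, 'm) module"
  Idm :: "'o \<Rightarrow> 'm"
  Cmp :: "'m \<Rightarrow> 'm \<Rightarrow> 'm"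

abbreviation hom_set :: "('r, 'o, 'm, 'z) lin_cat_scheme \<Rightarrow> 'o \<Rightarrow> 'o \<Rightarrow> 'm set" where
  "hom_set C X Y \<equiv> carrier (Hom C X Y)"

locale linear_category = cring R
  for R :: "('r, 'q) ring_scheme" (structure) and C :: "('r, 'o, 'm, 'z) lin_cat_scheme" +
  assumes hom_module: "\<lbrakk>X \<in> Ob C; Y \<in> Ob C\<rbrakk> \<Longrightarrow> module R (Hom C X Y)"
    and hom_disjoint: "\<lbrakk>X \<in> Ob C; Y \<in> Ob C; X' \<in> Ob C; Y' \<in> Ob C;
      f \<in> hom_set C X Y; f \<in> hom_set C X' Y'\<rbrakk> \<Longrightarrow> X = X' \<and> Y = Y'"
    and id_hom: "X \<in> Ob C \<Longrightarrow> Idm C X \<in> hom_set C X X"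
    and cmp_hom: "\<lbrakk>X \<in> Ob C; Y \<in> Ob C; Z \<in> Ob C; f \<in> hom_set C X Y; g \<in> hom_set C Y Z\<rbrakk>
      \<Longrightarrow> Cmp C g f \<in> hom_set C X Z"
    and cmp_id: "\<lbrakk>X \<in> Ob C; Y \<in> Ob C; f \<in> hom_set C X Y\<rbrakk>
      \<Longrightarrow> Cmp C f (Idm C X) = f \<and> Cmp C (Idm C Y) f = f"
    and cmp_assoc: "\<lbrakk>X \<in> Ob C; Y \<in> Ob C; Z \<in> Ob C; W \<in> Ob C;
      f \<in> hom_set C X Y; g \<in> hom_set C Y Z; h \<in> hom_set C Z W\<rbrakk>
      \<Longrightarrow> Cmp C h (Cmp C g f) = Cmp C (Cmp C h g) f"
    and cmp_linear_right: "\<lbrakk>X \<in> Ob C; Y \<in> Ob C; Z \<in> Ob C; g \<in> hom_set C Y Z\<rbrakk>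
      \<Longrightarrow> linear_map R (Hom C X Y) (Hom C X Z) (\<lambda>f. Cmp C g f)"
    and cmp_linear_left: "\<lbrakk>X \<in> Ob C; Y \<in> Ob C; Z \<in> Ob C; f \<in> hom_set C X Y\<rbrakk>
      \<Longrightarrow> linear_map R (Hom C Y Z) (Hom C X Z) (\<lambda>g. Cmp C g f)"

definition iso_map :: "('r, 'o, 'm, 'z) lin_cat_scheme \<Rightarrow> 'o \<Rightarrow> 'o \<Rightarrow> 'm \<Rightarrow> bool" where
  "iso_map C X Y f \<longleftrightarrow> f \<in> hom_set C X Y \<and>
     (\<exists>g\<in>hom_set C Y X. Cmp C g f = Idm C X \<and> Cmp C f g = Idm C Y)"

definition isomorphic :: "('r, 'o, 'm, 'z) lin_cat_scheme \<Rightarrow> 'o \<Rightarrow> 'o \<Rightarrow> bool" where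
  "isomorphic C X Y \<longleftrightarrow> X \<in> Ob C \<and> Y \<in> Ob C \<and> (\<exists>f. iso_map C X Y f)"

definition zero_obj :: "('r, 'o, 'm, 'z) lin_cat_scheme \<Rightarrow> 'o \<Rightarrow> bool" where
  "zero_obj C Z \<longleftrightarrow> Z \<in> Ob C \<and>
     (\<forall>X\<in>Ob C. zero_module (Hom C X Z) \<and> zero_module (Hom C Z X))"

definition direct_sum :: "('r, 'o, 'm, 'z) lin_cat_scheme \<Rightarrow> 'o \<Rightarrow> 'o \<Rightarrow> 'o \<Rightarrow> bool" where
  "direct_sum C X Y S \<longleftrightarrow> X \<in> Ob C \<and> Y \<in> Ob C \<and> S \<in> Ob C \<and>
     (\<exists>i\<in>hom_set C X S. \<exists>j\<in>hom_set C Y S. \<exists>p\<in>hom_set C S X. \<exists>q\<in>hom_set C S Y.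
        Cmp C p i = Idm C X \<and> Cmp C q j = Idm C Y \<and>
        Cmp C p j = \<zero>\<^bsub>Hom C Y X\<^esub> \<and> Cmp C q i = \<zero>\<^bsub>Hom C X Y\<^esub> \<and>
        Cmp C i p \<oplus>\<^bsub>Hom C S S\<^esub> Cmp C j q = Idm C S)"

definition epi_map :: "('r, 'o, 'm, 'z) lin_cat_scheme \<Rightarrow> 'o \<Rightarrow> 'o \<Rightarrow> 'm \<Rightarrow> bool" where
  "epi_map C X Y f \<longleftrightarrow> X \<in> Ob C \<and> Y \<in> Ob C \<and> f \<in> hom_set C X Y \<and>
     (\<forall>Z\<in>Ob C. \<forall>g\<in>hom_set C Y Z. \<forall>h\<in>hom_set C Y Z. Cmp C g f = Cmp C h f \<longrightarrow> g = h)"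

definition projective_obj :: "('r, 'o, 'm, 'z) lin_cat_scheme \<Rightarrow> 'o \<Rightarrow> bool" where
  "projective_obj C P \<longleftrightarrow> P \<in> Ob C \<and>
     (\<forall>X Y e. epi_map C X Y e \<longrightarrow>
        (\<forall>f\<in>hom_set C P Y. \<exists>g\<in>hom_set C P X. Cmp C e g = f))"

definition enough_projectives :: "('r, 'o, 'm, 'z) lin_cat_scheme \<Rightarrow> bool" where
  "enough_projectives C \<longleftrightarrow> (\<forall>X\<in>Ob C. \<exists>P e. projective_obj C P \<and> epi_map C P X e)"

definition full_subcat ::
  "('r, 'o, 'm, 'z) lin_cat_scheme \<Rightarrow> 'o set \<Rightarrow> ('r, 'o, 'm) lin_cat" where
  "full_subcat C D = \<lparr>Ob = D, Hom = Hom C, Idm = Idm C, Cmp = Cmp C\<rparr>"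

definition iso_closed :: "('r, 'o, 'm, 'z) lin_cat_scheme \<Rightarrow> 'o set \<Rightarrow> bool" where
  "iso_closed C D \<longleftrightarrow> (\<forall>X\<in>D. \<forall>Y. isomorphic C X Y \<longrightarrow> Y \<in> D)"

definition retract_closed :: "('r, 'o, 'm, 'z) lin_cat_scheme \<Rightarrow> 'o set \<Rightarrow> bool" where
  "retract_closed C D \<longleftrightarrow> (\<forall>X\<in>D. \<forall>Y\<in>Ob C.
     (\<exists>i\<in>hom_set C Y X. \<exists>p\<in>hom_set C X Y. Cmp C p i = Idm C Y) \<longrightarrow> Y \<in> D)"

definition orth :: "('r, 'o, 'm, 'z) lin_cat_scheme \<Rightarrow> 'o set \<Rightarrow> 'o set \<Rightarrow> bool" where
  "orth C D E \<longleftrightarrow> (\<forall>X\<in>D. \<forall>Y\<in>E. zero_module (Hom C X Y))"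

definition left_orth :: "('r, 'o, 'm, 'z) lin_cat_scheme \<Rightarrow> 'o set \<Rightarrow> 'o set" where
  "left_orth C D = {Y \<in> Ob C. orth C {Y} D}"


section \<open>Triangulated categories\<close>

text \<open>
  The shift is an automorphism of the category.  It is given together with all its integral
  powers: \<open>Sho C i X\<close> and \<open>Shm C i f\<close> stand for \<open>X[i]\<close> and \<open>f[i]\<close>.
  \<open>Tri C X Y Z f g h\<close> says that \<open>X \<rightarrow> Y \<rightarrow> Z \<rightarrow> X[1]\<close>, with maps \<open>f\<close>, \<open>g\<close>, \<open>h\<close>, is a
  distinguished triangle.
\<close>

record ('r, 'o, 'm) tri_cat = "('r, 'o, 'm) lin_cat" +
  Sho :: "int \<Rightarrow> 'o \<Rightarrow> 'o"
  Shm :: "int \<Rightarrow> 'm \<Rightarrow> 'm"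
  Tri :: "'o \<Rightarrow> 'o \<Rightarrow> 'o \<Rightarrow> 'm \<Rightarrow> 'm \<Rightarrow> 'm \<Rightarrow> bool"

locale linear_triangulated_category = linear_category R C
  for R :: "('r, 'q) ring_scheme" (structure) and C :: "('r, 'o, 'm, 'z) tri_cat_scheme" +
  assumes zero_ex: "\<exists>Z. zero_obj C Z"
    and sum_ex: "\<lbrakk>X \<in> Ob C; Y \<in> Ob C\<rbrakk> \<Longrightarrow> \<exists>S. direct_sum C X Y S"
    and sho_ob: "X \<in> Ob C \<Longrightarrow> Sho C p X \<in> Ob C"
    and sho_0: "X \<in> Ob C \<Longrightarrow> Sho C 0 X = X"
    and sho_add: "X \<in> Ob C \<Longrightarrow> Sho C (p + q) X = Sho C p (Sho C q X)"
    and shm_linear: "\<lbrakk>X \<in> Ob C; Y \<in> Ob C\<rbrakk>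
      \<Longrightarrow> linear_map R (Hom C X Y) (Hom C (Sho C p X) (Sho C p Y)) (Shm C p)"
    and shm_0: "\<lbrakk>X \<in> Ob C; Y \<in> Ob C; f \<in> hom_set C X Y\<rbrakk> \<Longrightarrow> Shm C 0 f = f"
    and shm_add: "\<lbrakk>X \<in> Ob C; Y \<in> Ob C; f \<in> hom_set C X Y\<rbrakk>
      \<Longrightarrow> Shm C (p + q) f = Shm C p (Shm C q f)"
    and shm_id: "X \<in> Ob C \<Longrightarrow> Shm C p (Idm C X) = Idm C (Sho C p X)"
    and shm_cmp: "\<lbrakk>X \<in> Ob C; Y \<in> Ob C; Z \<in> Ob C; f \<in> hom_set C X Y; g \<in> hom_set C Y Z\<rbrakk>
      \<Longrightarrow> Shm C p (Cmp C g f) = Cmp C (Shm C p g) (Shm C p f)"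
    and tri_type: "Tri C X Y Z f g h \<Longrightarrow> X \<in> Ob C \<and> Y \<in> Ob C \<and> Z \<in> Ob C \<and>
      f \<in> hom_set C X Y \<and> g \<in> hom_set C Y Z \<and> h \<in> hom_set C Z (Sho C 1 X)"
    and TR1_iso: "\<lbrakk>Tri C X Y Z f g h; X' \<in> Ob C; Y' \<in> Ob C; Z' \<in> Ob C;
      f' \<in> hom_set C X' Y'; g' \<in> hom_set C Y' Z'; h' \<in> hom_set C Z' (Sho C 1 X');
      iso_map C X X' a; iso_map C Y Y' b; iso_map C Z Z' c;
      Cmp C b f = Cmp C f' a; Cmp C c g = Cmp C g' b;
      Cmp C (Shm C 1 a) h = Cmp C h' c\<rbrakk> \<Longrightarrow> Tri C X' Y' Z' f' g' h'"
    and TR1_id: "\<lbrakk>X \<in> Ob C; zero_obj C Z\<rbrakk>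
      \<Longrightarrow> Tri C X X Z (Idm C X) \<zero>\<^bsub>Hom C X Z\<^esub> \<zero>\<^bsub>Hom C Z (Sho C 1 X)\<^esub>"
    and TR1_cone: "\<lbrakk>X \<in> Ob C; Y \<in> Ob C; f \<in> hom_set C X Y\<rbrakk> \<Longrightarrow> \<exists>Z g h. Tri C X Y Z f g h"
    and TR2: "\<lbrakk>X \<in> Ob C; Y \<in> Ob C; Z \<in> Ob C;
      f \<in> hom_set C X Y; g \<in> hom_set C Y Z; h \<in> hom_set C Z (Sho C 1 X)\<rbrakk>
      \<Longrightarrow> Tri C X Y Z f g h \<longleftrightarrow>
          Tri C Y Z (Sho C 1 X) g h (\<ominus>\<^bsub>Hom C (Sho C 1 X) (Sho C 1 Y)\<^esub> (Shm C 1 f))"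
    and TR3: "\<lbrakk>Tri C X Y Z f g h; Tri C X' Y' Z' f' g' h';
      a \<in> hom_set C X X'; b \<in> hom_set C Y Y'; Cmp C b f = Cmp C f' a\<rbrakk>
      \<Longrightarrow> \<exists>c\<in>hom_set C Z Z'. Cmp C c g = Cmp C g' b \<and> Cmp C (Shm C 1 a) h = Cmp C h' c"
    and TR4: "\<lbrakk>Tri C X Y Z' u j k; Tri C Y Z X' v l i; Tri C X Z Y' (Cmp C v u) m n\<rbrakk>
      \<Longrightarrow> \<exists>f\<in>hom_set C Z' Y'. \<exists>g\<in>hom_set C Y' X'.
            Tri C Z' Y' X' f g (Cmp C (Shm C 1 j) i) \<and>
            Cmp C f j = Cmp C m v \<and> Cmp C n f = k \<and>
            Cmp C g m = l \<and> Cmp C i g = Cmp C (Shm C 1 u) n"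

text \<open>
  In the opposite category the shift is inverted, and a diagram \<open>X \<rightarrow> Y \<rightarrow> Z \<rightarrow> X[-1]\<close> of
  opposite arrows with maps \<open>f\<close>, \<open>g\<close>, \<open>h\<close> is a distinguished triangle iff
  \<open>X[-1] \<rightarrow> Z \<rightarrow> Y \<rightarrow> X\<close> with maps \<open>h\<close>, \<open>g\<close>, \<open>f\<close> is one in the original category.
\<close>

definition op_cat :: "('r, 'o, 'm, 'z) tri_cat_scheme \<Rightarrow> ('r, 'o, 'm) tri_cat" where
  "op_cat C = \<lparr>Ob = Ob C, Hom = (\<lambda>X Y. Hom C Y X), Idm = Idm C, Cmp = (\<lambda>g f. Cmp C f g),
     Sho = (\<lambda>i. Sho C (- i)), Shm = (\<lambda>i. Shm C (- i)),
     Tri = (\<lambda>X Y Z f g h. Tri C (Sho C (- 1) X) Z Y h g f)\<rparr>"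

text \<open>\<open>D[i]\<close> for a class of objects \<open>D\<close>\<close>

definition shift_class :: "('r, 'o, 'm, 'z) tri_cat_scheme \<Rightarrow> int \<Rightarrow> 'o set \<Rightarrow> 'o set" where
  "shift_class C i D = Sho C i ` D"


section \<open>Cohomological functors and saturated categories\<close>

text \<open>
  A functor from \<open>E\<^sup>o\<^sup>p\<close> to \<open>R\<close>-modules is given by its values \<open>F X\<close> on objects and its
  values \<open>\<Phi> f : F Y \<rightarrow> F X\<close> on morphisms \<open>f : X \<rightarrow> Y\<close> of \<open>E\<close>.
\<close>

definition linear_functor ::
  "('r, 'q) ring_scheme \<Rightarrow> ('r, 'o, 'm, 'z) lin_cat_scheme \<Rightarrow>
   ('o \<Rightarrow> ('r, 'v) module) \<Rightarrow> ('m \<Rightarrow> 'v \<Rightarrow> 'v) \<Rightarrow> bool" where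
  "linear_functor R E F \<Phi> \<longleftrightarrow>
     (\<forall>X\<in>Ob E. module R (F X)) \<and>
     (\<forall>X\<in>Ob E. \<forall>Y\<in>Ob E. \<forall>f\<in>hom_set E X Y. linear_map R (F Y) (F X) (\<Phi> f)) \<and>
     (\<forall>X\<in>Ob E. \<forall>x\<in>carrier (F X). \<Phi> (Idm E X) x = x) \<and>
     (\<forall>X\<in>Ob E. \<forall>Y\<in>Ob E. \<forall>Z\<in>Ob E. \<forall>f\<in>hom_set E X Y. \<forall>g\<in>hom_set E Y Z.
        \<forall>x\<in>carrier (F Z). \<Phi> (Cmp E g f) x = \<Phi> f (\<Phi> g x)) \<and>
     (\<forall>X\<in>Ob E. \<forall>Y\<in>Ob E. \<forall>f\<in>hom_set E X Y. \<forall>g\<in>hom_set E X Y.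
        \<forall>x\<in>carrier (F Y). \<Phi> (f \<oplus>\<^bsub>Hom E X Y\<^esub> g) x = \<Phi> f x \<oplus>\<^bsub>F X\<^esub> \<Phi> g x) \<and>
     (\<forall>X\<in>Ob E. \<forall>Y\<in>Ob E. \<forall>a\<in>carrier R. \<forall>f\<in>hom_set E X Y.
        \<forall>x\<in>carrier (F Y). \<Phi> (a \<odot>\<^bsub>Hom E X Y\<^esub> f) x = a \<odot>\<^bsub>F X\<^esub> \<Phi> f x)"

definition cohomological ::
  "('r, 'o, 'm, 'z) tri_cat_scheme \<Rightarrow> ('o \<Rightarrow> ('r, 'v) module) \<Rightarrow> ('m \<Rightarrow> 'v \<Rightarrow> 'v) \<Rightarrow> bool" where
  "cohomological E F \<Phi> \<longleftrightarrow> (\<forall>X Y Z f g h. Tri E X Y Z f g h \<longrightarrow>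
     {y \<in> carrier (F Y). \<Phi> f y = \<zero>\<^bsub>F X\<^esub>} = \<Phi> g ` carrier (F Z))"

definition locally_bounded ::
  "('r, 'o, 'm, 'z) tri_cat_scheme \<Rightarrow> ('o \<Rightarrow> ('r, 'v) module) \<Rightarrow> bool" where
  "locally_bounded E F \<longleftrightarrow>
     (\<forall>M\<in>Ob E. \<exists>n. \<forall>i. \<bar>i\<bar> > n \<longrightarrow> zero_module (F (Sho E (- i) M)))"

definition admissible_functor ::
  "('r, 'q) ring_scheme \<Rightarrow> ('r, 'o, 'm, 'z) tri_cat_scheme \<Rightarrow>
   ('o \<Rightarrow> ('r, 'v) module) \<Rightarrow> ('m \<Rightarrow> 'v \<Rightarrow> 'v) \<Rightarrow> bool" where
  "admissible_functor R E F \<Phi> \<longleftrightarrow>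
     linear_functor R E F \<Phi> \<and> cohomological E F \<Phi> \<and> locally_bounded E F \<and>
     (\<forall>X\<in>Ob E. fin_gen_module R (F X))"

text \<open>\<open>(F, \<Phi>)\<close> is represented by \<open>Z\<close>: there are isomorphisms \<open>Hom X Z \<cong> F X\<close>, natural in \<open>X\<close>.\<close>

definition represented_by ::
  "('r, 'q) ring_scheme \<Rightarrow> ('r, 'o, 'm, 'z) lin_cat_scheme \<Rightarrow>
   ('o \<Rightarrow> ('r, 'v) module) \<Rightarrow> ('m \<Rightarrow> 'v \<Rightarrow> 'v) \<Rightarrow> 'o \<Rightarrow> bool" where
  "represented_by R E F \<Phi> Z \<longleftrightarrow> Z \<in> Ob E \<and>
     (\<exists>\<eta>. (\<forall>X\<in>Ob E. linear_map R (Hom E X Z) (F X) (\<eta> X) \<and>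
                     bij_betw (\<eta> X) (hom_set E X Z) (carrier (F X))) \<and>
          (\<forall>X\<in>Ob E. \<forall>Y\<in>Ob E. \<forall>f\<in>hom_set E X Y. \<forall>x\<in>hom_set E Y Z.
             \<eta> X (Cmp E x f) = \<Phi> f (\<eta> Y x)))"

text \<open>
  \<open>R\<close>-saturated categories.  The first conjunct says that every representable functor is
  cohomological, locally bounded and has finitely generated values; the second one says that
  every functor with these properties is representable.  In the latter, the functors take values
  in modules whose elements are of type \<open>(nat \<Rightarrow> 'r) set\<close>.  This is no restriction:
  a finitely generated module is isomorphic to a quotient of some \<open>R\<^sup>n\<close>, whose elements are
  cosets in \<open>R\<^sup>n\<close>, i.e. sets of sequences supported on \<open>{..<n}\<close>.
\<close>

definition R_saturated ::
  "('r, 'q) ring_scheme \<Rightarrow> ('r, 'o, 'm, 'z) tri_cat_scheme \<Rightarrow> bool" where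
  "R_saturated R E \<longleftrightarrow>
     (\<forall>Z\<in>Ob E. admissible_functor R E (\<lambda>X. Hom E X Z) (\<lambda>f x. Cmp E x f)) \<and>
     (\<forall>(F :: 'o \<Rightarrow> ('r, (nat \<Rightarrow> 'r) set) module) \<Phi>.
        admissible_functor R E F \<Phi> \<longrightarrow> (\<exists>Z. represented_by R E F \<Phi> Z))"


section \<open>t-structures\<close>

text \<open>
  Throughout, \<open>A = C\<^bsub>t\<le>0\<^esub>\<close> and \<open>B = C\<^bsub>t\<ge>0\<^esub>\<close> (homological convention).
\<close>

definition t_decomp ::
  "('r, 'o, 'm, 'z) tri_cat_scheme \<Rightarrow> 'o set \<Rightarrow> 'o set \<Rightarrow> 'o \<Rightarrow> 'o \<Rightarrow> 'o \<Rightarrow> bool" where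
  "t_decomp C A B M L N \<longleftrightarrow>
     L \<in> B \<and> N \<in> shift_class C (- 1) A \<and> (\<exists>f g h. Tri C L M N f g h)"

definition t_structure ::
  "('r, 'o, 'm, 'z) tri_cat_scheme \<Rightarrow> 'o set \<Rightarrow> 'o set \<Rightarrow> bool" where
  "t_structure C A B \<longleftrightarrow>
     A \<subseteq> Ob C \<and> B \<subseteq> Ob C \<and> iso_closed C A \<and> iso_closed C B \<and>
     A \<subseteq> shift_class C 1 A \<and> shift_class C 1 B \<subseteq> B \<and>
     orth C (shift_class C 1 B) A \<and>
     (\<forall>M\<in>Ob C. \<exists>L N. t_decomp C A B M L N)"

text \<open>
  The decomposition triangle of an object is unique up to unique isomorphism; we choose one, and
  thereby values of the truncation functors \<open>L\<^sub>t\<close>, \<open>R\<^sub>t\<close>, \<open>t\<^bsub>\<ge>0\<^esub>\<close>, \<open>t\<^bsub>\<le>0\<^esub>\<close> and of the homology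
  \<open>H\<^sub>i\<^sup>t\<close> on objects.
\<close>

definition t_chosen ::
  "('r, 'o, 'm, 'z) tri_cat_scheme \<Rightarrow> 'o set \<Rightarrow> 'o set \<Rightarrow> 'o \<Rightarrow> 'o \<times> 'o" where
  "t_chosen C A B M = (SOME p. t_decomp C A B M (fst p) (snd p))"

definition t_L :: "('r, 'o, 'm, 'z) tri_cat_scheme \<Rightarrow> 'o set \<Rightarrow> 'o set \<Rightarrow> 'o \<Rightarrow> 'o" where
  "t_L C A B M = fst (t_chosen C A B M)"

definition t_R :: "('r, 'o, 'm, 'z) tri_cat_scheme \<Rightarrow> 'o set \<Rightarrow> 'o set \<Rightarrow> 'o \<Rightarrow> 'o" where
  "t_R C A B M = snd (t_chosen C A B M)"

definition t_ge0 :: "('r, 'o, 'm, 'z) tri_cat_scheme \<Rightarrow> 'o set \<Rightarrow> 'o set \<Rightarrow> 'o \<Rightarrow> 'o" where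
  "t_ge0 C A B M = t_L C A B M"

definition t_le0 :: "('r, 'o, 'm, 'z) tri_cat_scheme \<Rightarrow> 'o set \<Rightarrow> 'o set \<Rightarrow> 'o \<Rightarrow> 'o" where
  "t_le0 C A B M = Sho C 1 (t_R C A B (Sho C (- 1) M))"

definition t_H0 :: "('r, 'o, 'm, 'z) tri_cat_scheme \<Rightarrow> 'o set \<Rightarrow> 'o set \<Rightarrow> 'o \<Rightarrow> 'o" where
  "t_H0 C A B M = t_le0 C A B (t_ge0 C A B M)"

definition t_H :: "('r, 'o, 'm, 'z) tri_cat_scheme \<Rightarrow> 'o set \<Rightarrow> 'o set \<Rightarrow> int \<Rightarrow> 'o \<Rightarrow> 'o" where
  "t_H C A B i M = t_H0 C A B (Sho C (- i) M)"

definition t_heart ::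
  "('r, 'o, 'm, 'z) tri_cat_scheme \<Rightarrow> 'o set \<Rightarrow> 'o set \<Rightarrow> ('r, 'o, 'm) lin_cat" where
  "t_heart C A B = full_subcat C (A \<inter> B)"

definition t_ess_bounded ::
  "('r, 'o, 'm, 'z) tri_cat_scheme \<Rightarrow> 'o set \<Rightarrow> 'o set \<Rightarrow> bool" where
  "t_ess_bounded C A B \<longleftrightarrow>
     (\<forall>M\<in>Ob C. \<exists>n. \<forall>i. \<bar>i\<bar> > n \<longrightarrow> zero_obj (t_heart C A B) (t_H C A B i M))"

definition t_ess_bounded_below ::
  "('r, 'o, 'm, 'z) tri_cat_scheme \<Rightarrow> 'o set \<Rightarrow> 'o set \<Rightarrow> bool" where
  "t_ess_bounded_below C A B \<longleftrightarrow>
     (\<forall>M\<in>Ob C. \<exists>n. \<forall>i. i < n \<longrightarrow> zero_obj (t_heart C A B) (t_H C A B i M))"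

definition t_P :: "('r, 'o, 'm, 'z) tri_cat_scheme \<Rightarrow> 'o set \<Rightarrow> 'o set \<Rightarrow> 'o set" where
  "t_P C A B = left_orth C (shift_class C (- 1) A \<union> shift_class C 1 B)"


section \<open>Weight structures\<close>

text \<open>
  Here \<open>U = C\<^bsub>w\<le>0\<^esub>\<close> and \<open>V = C\<^bsub>w\<ge>0\<^esub>\<close>.
\<close>

definition weight_structure ::
  "('r, 'o, 'm, 'z) tri_cat_scheme \<Rightarrow> 'o set \<Rightarrow> 'o set \<Rightarrow> bool" where
  "weight_structure C U V \<longleftrightarrow>
     U \<subseteq> Ob C \<and> V \<subseteq> Ob C \<and> retract_closed C U \<and> retract_closed C V \<and>
     U \<subseteq> shift_class C 1 U \<and> shift_class C 1 V \<subseteq> V \<and>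
     orth C U (shift_class C 1 V) \<and>
     (\<forall>M\<in>Ob C. \<exists>L N f g h. Tri C L M N f g h \<and> L \<in> U \<and> N \<in> shift_class C 1 V)"

definition w_ess_bounded_below ::
  "('r, 'o, 'm, 'z) tri_cat_scheme \<Rightarrow> 'o set \<Rightarrow> 'o set \<Rightarrow> bool" where
  "w_ess_bounded_below C U V \<longleftrightarrow>
     (\<forall>M\<in>Ob C. \<exists>n. \<exists>S D Y f g h.
        direct_sum C (Sho C (- n) M) (Sho C 1 (Sho C (- n) M)) S \<and>
        Tri C D S Y f g h \<and> Y \<in> V \<and> D \<in> (\<Inter>i. shift_class C i U))"

text \<open>\<open>w\<close> is left adjacent to \<open>t\<close>: \<open>C\<^bsub>w\<ge>0\<^esub> = C\<^bsub>t\<ge>0\<^esub>\<close>\<close>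

definition left_adjacent :: "'o set \<times> 'o set \<Rightarrow> 'o set \<times> 'o set \<Rightarrow> bool" where
  "left_adjacent w t \<longleftrightarrow> snd w = snd t"

end

theory Submission
  imports Defs
begin

text \<open>
  Write \<open>\<ge> n\<close> and \<open>\<le> n\<close> for the shifted classes of the \<open>t\<close>-structure, and \<open>\<rho> : X \<rightarrow> T X\<close> for the
  universal map from \<open>X\<close> to an object of \<open>\<le> 0\<close>. Both parts come from a single construction,
  \<open>truncated_hom_corepresentable\<close>. Let \<open>P\<close> be an object without nonzero maps to \<open>N[1]\<close> for \<open>N\<close> in
  the heart. Then \<open>X \<mapsto> Hom(P, T X)\<close> is homological: for a triangle \<open>X \<rightarrow> Y \<rightarrow> Z\<close> let \<open>W\<close> be the cone
  of \<open>T X \<rightarrow> T Y\<close>; the axiom TR3 gives a map \<open>Z \<rightarrow> W\<close>, hence \<open>T Z \<rightarrow> T W\<close>, and \<open>W \<rightarrow> T W\<close> only kills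
  the shift of an object of the heart, which \<open>P\<close> does not see. So a map \<open>P \<rightarrow> T Y\<close> that vanishes in
  \<open>T Z\<close> vanishes in \<open>W\<close> and comes from \<open>T X\<close>. The values of the functor are finitely generated;
  if it is also locally bounded, saturation of \<open>C\<^sup>o\<^sup>p\<close> yields an object \<open>D\<close> with
  \<open>Hom(D, X) \<cong> Hom(P, T X)\<close>. Thus \<open>D\<close> has the same maps to \<open>\<le> 0\<close> as \<open>P\<close>, but none to \<open>\<ge> 1\<close>.
  
  For the first part let \<open>P\<close> be projective in the heart. A map \<open>P \<rightarrow> N[1]\<close> is an extension of \<open>P\<close> by
  \<open>N\<close> inside the heart, hence zero (\<open>projective_perp\<close>), and essential boundedness makes the functor
  locally bounded. The resulting \<open>D\<close> has no maps to \<open>\<le> -1\<close> because \<open>P\<close> has none, so it lies in \<open>P_t\<close>,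
  and \<open>H_0(D) \<cong> T D \<cong> P\<close> by the Yoneda lemma (\<open>projectives_lift\<close>).
  
  For the second part the only candidate is \<open>C_{w\<ge>0} = (\<ge> 0)\<close>, \<open>C_{w\<le>0} = \<^sup>\<bottom>(\<ge> 1)\<close>, and only the existence
  of weight decompositions is not formal. If \<open>M\<close> lies in \<open>\<ge> n\<close> with \<open>n \<le> 0\<close>, an object \<open>D\<close> of \<open>P_t\<close>
  whose \<open>H_0\<close> maps onto \<open>H_n(M)\<close> provides a map \<open>D[n] \<rightarrow> M\<close> with cone in \<open>\<ge> n+1\<close>
  (\<open>cone_of_projective_cover\<close>). Repeating this leads to a cone in \<open>\<ge> 1\<close>, and the cocone is an
  iterated extension of objects \<open>D[i]\<close> with \<open>i \<le> 0\<close>, all of which are orthogonal to \<open>\<ge> 1\<close>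
  (\<open>weight_decomposition_of_ge\<close>).
  
  An arbitrary \<open>M\<close> is reduced to this case as follows. As \<open>t\<close> is essentially bounded below,
  \<open>(\<Inter>n. \<le> n, \<Union>n. \<ge> n)\<close> is a \<open>t\<close>-structure too (\<open>stable_t_structure\<close>). It is stable under shifts, so
  that its heart is zero, and the construction applies to it with \<open>P = M\<close>. It yields a triangle
  \<open>D \<rightarrow> M \<rightarrow> Y\<close> with \<open>D\<close> orthogonal to every \<open>\<ge> n\<close> and \<open>Y\<close> in some \<open>\<ge> n\<close>
  (\<open>left_complement_of_t_plus\<close>). The octahedral axiom combines this triangle with a weight
  decomposition of \<open>Y\<close>; the same triangle for \<open>M \<oplus> M[1]\<close> shows that \<open>w\<close> is essentially bounded
  below (\<open>adjacent_weight_structure\<close>).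
\<close>

section \<open>Linear maps and transport of module structures\<close>

lemma linear_map_closed:
  "linear_map R M N \<phi> \<Longrightarrow> x \<in> carrier M \<Longrightarrow> \<phi> x \<in> carrier N"
  by (auto simp: linear_map_def)

lemma linear_map_add:
  "\<lbrakk>linear_map R M N \<phi>; x \<in> carrier M; y \<in> carrier M\<rbrakk> \<Longrightarrow> \<phi> (x \<oplus>\<^bsub>M\<^esub> y) = \<phi> x \<oplus>\<^bsub>N\<^esub> \<phi> y"
  by (auto simp: linear_map_def)

lemma linear_map_smult:
  "\<lbrakk>linear_map R M N \<phi>; a \<in> carrier R; x \<in> carrier M\<rbrakk> \<Longrightarrow> \<phi> (a \<odot>\<^bsub>M\<^esub> x) = a \<odot>\<^bsub>N\<^esub> \<phi> x"
  by (auto simp: linear_map_def)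

lemma linear_map_zero:
  assumes "module R M" and "module R N" and "linear_map R M N \<phi>"
  shows "\<phi> \<zero>\<^bsub>M\<^esub> = \<zero>\<^bsub>N\<^esub>"
proof -
  interpret M: module R M by fact
  interpret N: module R N by fact
  have "\<phi> \<zero>\<^bsub>M\<^esub> = \<phi> (\<zero>\<^bsub>R\<^esub> \<odot>\<^bsub>M\<^esub> \<zero>\<^bsub>M\<^esub>)" by simp
  also have "\<dots> = \<zero>\<^bsub>R\<^esub> \<odot>\<^bsub>N\<^esub> \<phi> \<zero>\<^bsub>M\<^esub>"
    by (rule linear_map_smult[OF assms(3)]) auto
  also have "\<dots> = \<zero>\<^bsub>N\<^esub>"
    by (simp add: linear_map_closed[OF assms(3)])
  finally show ?thesis .
qed

lemma linear_map_minus: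
  assumes "module R M" and "module R N" and "linear_map R M N \<phi>" and "x \<in> carrier M"
  shows "\<phi> (\<ominus>\<^bsub>M\<^esub> x) = \<ominus>\<^bsub>N\<^esub> \<phi> x"
proof -
  interpret M: module R M by fact
  interpret N: module R N by fact
  have "\<phi> (\<ominus>\<^bsub>M\<^esub> x) \<oplus>\<^bsub>N\<^esub> \<phi> x = \<phi> (\<ominus>\<^bsub>M\<^esub> x \<oplus>\<^bsub>M\<^esub> x)"
    using assms(4) by (intro linear_map_add[OF assms(3), symmetric]) auto
  also have "\<dots> = \<zero>\<^bsub>N\<^esub>"
    using assms(4) by (simp add: M.M.l_neg linear_map_zero[OF assms(1-3)])
  finally show ?thesis
    using assms(4) by (intro N.M.minus_equality[symmetric]) (auto intro: linear_map_closed[OF assms(3)])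
qed

lemma linear_map_finsum:
  assumes "module R M" and "module R N" and "linear_map R M N \<phi>" and "finite S" and "g \<in> S \<rightarrow> carrier M"
  shows "\<phi> (\<Oplus>\<^bsub>M\<^esub>s\<in>S. g s) = (\<Oplus>\<^bsub>N\<^esub>s\<in>S. \<phi> (g s))"
  using assms(4,5)
proof (induction S rule: finite_induct)
  case empty
  interpret M: module R M by fact
  interpret N: module R N by fact
  show ?case by (simp add: linear_map_zero[OF assms(1-3)])
next
  case (insert s S)
  interpret M: module R M by fact
  interpret N: module R N by fact
  have g: "g \<in> S \<rightarrow> carrier M" "g s \<in> carrier M" using insert.prems by auto
  have pg: "(\<lambda>s. \<phi> (g s)) \<in> S \<rightarrow> carrier N" "\<phi> (g s) \<in> carrier N"
    using g linear_map_closed[OF assms(3)] by auto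
  show ?case
    using insert.hyps insert.IH[OF g(1)] g pg
    by (simp add: M.finsum_insert N.finsum_insert linear_map_add[OF assms(3)] M.finsum_closed)
qed

lemma linear_map_compose:
  assumes "linear_map R L M \<phi>" and "linear_map R M N \<psi>"
  shows "linear_map R L N (\<lambda>x. \<psi> (\<phi> x))"
  using assms by (auto simp: linear_map_def Pi_iff)

text \<open>
  Saturation is formulated for functors with values in modules of one particular type, so module
  structures have to be moved along injections of the underlying sets.
\<close>
definition transport_module :: "('a \<Rightarrow> 'b) \<Rightarrow> ('r, 'a) module \<Rightarrow> ('r, 'b) module" where
  "transport_module \<iota> M =
     \<lparr>carrier = \<iota> ` carrier M, mult = undefined, one = undefined, zero = \<iota> \<zero>\<^bsub>M\<^esub>,
      add = (\<lambda>x y. \<iota> (inv_into (carrier M) \<iota> x \<oplus>\<^bsub>M\<^esub> inv_into (carrier M) \<iota> y)),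
      smult = (\<lambda>a x. \<iota> (a \<odot>\<^bsub>M\<^esub> inv_into (carrier M) \<iota> x))\<rparr>"

lemma transport_module_properties:
  assumes M: "module R M" and \<iota>: "inj_on \<iota> (carrier M)"
  defines "N \<equiv> transport_module \<iota> M"
  shows transport_module_linear: "linear_map R M N \<iota>"
    and transport_module_inverse_linear: "linear_map R N M (inv_into (carrier M) \<iota>)"
    and transport_module_module: "module R N"
proof -
  interpret M: module R M by fact
  have c: "carrier N = \<iota> ` carrier M" by (simp add: N_def transport_module_def)
  have a: "\<iota> x \<oplus>\<^bsub>N\<^esub> \<iota> y = \<iota> (x \<oplus>\<^bsub>M\<^esub> y)" if "x \<in> carrier M" "y \<in> carrier M" for x y
    using that \<iota> by (simp add: N_def transport_module_def)
  have s: "a \<odot>\<^bsub>N\<^esub> \<iota> x = \<iota> (a \<odot>\<^bsub>M\<^esub> x)" if "x \<in> carrier M" for a x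
    using that \<iota> by (simp add: N_def transport_module_def)
  have z: "\<zero>\<^bsub>N\<^esub> = \<iota> \<zero>\<^bsub>M\<^esub>" by (simp add: N_def transport_module_def)
  show "linear_map R M N \<iota>"
    by (auto simp: linear_map_def c a s)
  show "linear_map R N M (inv_into (carrier M) \<iota>)"
    using \<iota> by (auto simp: linear_map_def c a s)
  have "abelian_group N"
  proof (rule abelian_groupI)
    fix x assume "x \<in> carrier N"
    then obtain x' where x': "x' \<in> carrier M" "x = \<iota> x'" by (auto simp: c)
    show "\<exists>y\<in>carrier N. y \<oplus>\<^bsub>N\<^esub> x = \<zero>\<^bsub>N\<^esub>"
      using x' by (intro bexI[of _ "\<iota> (\<ominus>\<^bsub>M\<^esub> x')"]) (auto simp: a z c M.M.l_neg)
  qed (auto simp: c a z M.M.a_ac)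
  then show "module R N"
    by (intro moduleI)
      (auto simp: c a s M.R.is_cring M.smult_l_distr M.smult_r_distr M.smult_assoc1)
qed

lemma transport_module_bij:
  assumes "inj_on \<iota> (carrier M)"
  shows "bij_betw \<iota> (carrier M) (carrier (transport_module \<iota> M))"
  using assms by (simp add: bij_betw_def transport_module_def)

lemma fin_gen_transport_module:
  assumes M: "module R M" and \<iota>: "inj_on \<iota> (carrier M)" and fg: "fin_gen_module R M"
  shows "fin_gen_module R (transport_module \<iota> M)"
proof -
  let ?N = "transport_module \<iota> M"
  interpret M: module R M by fact
  interpret N: module R ?N by (rule transport_module_module[OF M \<iota>])
  note lin = transport_module_linear[OF M \<iota>]
  have c: "carrier ?N = \<iota> ` carrier M" by (simp add: transport_module_def)
  obtain S where S: "finite S" "S \<subseteq> carrier M"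
    "carrier M = {(\<Oplus>\<^bsub>M\<^esub>a\<in>S. k a \<odot>\<^bsub>M\<^esub> a) | k. k \<in> S \<rightarrow> carrier R}"
    using fg by (auto simp: fin_gen_module_def)
  have injS: "inj_on \<iota> S" using \<iota> S(2) by (rule inj_on_subset)
  have comb: "(\<Oplus>\<^bsub>?N\<^esub>b\<in>\<iota> ` S. k b \<odot>\<^bsub>?N\<^esub> b) = \<iota> (\<Oplus>\<^bsub>M\<^esub>a\<in>S. k (\<iota> a) \<odot>\<^bsub>M\<^esub> a)"
    if k: "k \<in> \<iota> ` S \<rightarrow> carrier R" for k
  proof -
    have "(\<Oplus>\<^bsub>?N\<^esub>b\<in>\<iota> ` S. k b \<odot>\<^bsub>?N\<^esub> b) = (\<Oplus>\<^bsub>?N\<^esub>a\<in>S. k (\<iota> a) \<odot>\<^bsub>?N\<^esub> \<iota> a)"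
      using k S(2) c
      by (intro N.finsum_reindex injS Pi_I N.smult_closed) auto
    also have "\<dots> = (\<Oplus>\<^bsub>?N\<^esub>a\<in>S. \<iota> (k (\<iota> a) \<odot>\<^bsub>M\<^esub> a))"
      using k S(2) by (intro N.finsum_cong') (auto simp: c linear_map_smult[OF lin, symmetric] Pi_iff subset_iff)
    also have "\<dots> = \<iota> (\<Oplus>\<^bsub>M\<^esub>a\<in>S. k (\<iota> a) \<odot>\<^bsub>M\<^esub> a)"
      using k S(2)
      by (intro linear_map_finsum[OF M N.module_axioms lin S(1), symmetric]) (auto simp: Pi_iff subset_iff)
    finally show ?thesis .
  qed
  have "carrier ?N = {(\<Oplus>\<^bsub>?N\<^esub>b\<in>\<iota> ` S. k b \<odot>\<^bsub>?N\<^esub> b) | k. k \<in> \<iota> ` S \<rightarrow> carrier R}"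
  proof (intro equalityI subsetI)
    fix x assume "x \<in> carrier ?N"
    then obtain k where k: "k \<in> S \<rightarrow> carrier R" and x: "x = \<iota> (\<Oplus>\<^bsub>M\<^esub>a\<in>S. k a \<odot>\<^bsub>M\<^esub> a)"
      using c S(3) by auto
    let ?k = "\<lambda>b. k (inv_into S \<iota> b)"
    have "(\<Oplus>\<^bsub>M\<^esub>a\<in>S. ?k (\<iota> a) \<odot>\<^bsub>M\<^esub> a) = (\<Oplus>\<^bsub>M\<^esub>a\<in>S. k a \<odot>\<^bsub>M\<^esub> a)"
      using k S(2) injS by (intro M.finsum_cong') (auto simp: Pi_iff subset_iff)
    moreover have "?k \<in> \<iota> ` S \<rightarrow> carrier R" using k injS by auto
    ultimately show "x \<in> {(\<Oplus>\<^bsub>?N\<^esub>b\<in>\<iota> ` S. k b \<odot>\<^bsub>?N\<^esub> b) | k. k \<in> \<iota> ` S \<rightarrow> carrier R}"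
      using comb[of ?k] x by (intro CollectI exI[of _ ?k]) simp
  next
    fix x assume "x \<in> {(\<Oplus>\<^bsub>?N\<^esub>b\<in>\<iota> ` S. k b \<odot>\<^bsub>?N\<^esub> b) | k. k \<in> \<iota> ` S \<rightarrow> carrier R}"
    then obtain k where k: "k \<in> \<iota> ` S \<rightarrow> carrier R" and x: "x = (\<Oplus>\<^bsub>?N\<^esub>b\<in>\<iota> ` S. k b \<odot>\<^bsub>?N\<^esub> b)"
      by auto
    show "x \<in> carrier ?N"
      using k S(2) c unfolding x by (intro N.finsum_closed Pi_I N.smult_closed) auto
  qed
  with S(1,2) c show ?thesis
    unfolding fin_gen_module_def by (intro exI[of _ "\<iota> ` S"]) auto
qed

text \<open>
  An element is encoded by the set of all coordinate sequences that represent it with respect to a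
  finite generating set indexed by natural numbers. These sets are nonempty, and sets belonging to
  different elements are disjoint.
\<close>
lemma fin_gen_module_encoding:
  fixes M :: "('r, 'a) module"
  assumes M: "module R M" and fg: "fin_gen_module R M"
  obtains \<iota> :: "'a \<Rightarrow> (nat \<Rightarrow> 'r) set" where "inj_on \<iota> (carrier M)"
proof -
  interpret M: module R M by fact
  obtain S where S: "finite S" "S \<subseteq> carrier M"
    "carrier M = {(\<Oplus>\<^bsub>M\<^esub>a\<in>S. k a \<odot>\<^bsub>M\<^esub> a) | k. k \<in> S \<rightarrow> carrier R}"
    using fg by (auto simp: fin_gen_module_def)
  obtain idx :: "'a \<Rightarrow> nat" where idx: "inj_on idx S"
    using finite_imp_inj_to_nat_seg[OF S(1)] by blast
  let ?\<iota> = "\<lambda>m. {s. (\<lambda>a. s (idx a)) \<in> S \<rightarrow> carrier R \<and> m = (\<Oplus>\<^bsub>M\<^esub>a\<in>S. s (idx a) \<odot>\<^bsub>M\<^esub> a)}"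
  have "inj_on ?\<iota> (carrier M)"
  proof (rule inj_onI)
    fix m m' assume m: "m \<in> carrier M" and eq: "?\<iota> m = ?\<iota> m'"
    obtain k where k: "k \<in> S \<rightarrow> carrier R" "m = (\<Oplus>\<^bsub>M\<^esub>a\<in>S. k a \<odot>\<^bsub>M\<^esub> a)"
      using m S(3) by auto
    have "(\<Oplus>\<^bsub>M\<^esub>a\<in>S. k (inv_into S idx (idx a)) \<odot>\<^bsub>M\<^esub> a) = m"
      unfolding k(2) using k(1) S(2) idx by (intro M.finsum_cong') (auto simp: Pi_iff subset_iff)
    then have "(\<lambda>n. k (inv_into S idx n)) \<in> ?\<iota> m" using k(1) idx by auto
    then have "(\<lambda>n. k (inv_into S idx n)) \<in> ?\<iota> m'" unfolding eq .
    with \<open>(\<lambda>n. k (inv_into S idx n)) \<in> ?\<iota> m\<close> show "m = m'" by simp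
  qed
  then show thesis by (rule that)
qed

section \<open>Morphisms and shifts\<close>

context linear_triangulated_category
begin

abbreviation comp (infixl "\<cdot>" 70) where "g \<cdot> f \<equiv> Cmp C g f"

abbreviation zm where "zm X Y \<equiv> \<zero>\<^bsub>Hom C X Y\<^esub>"

text \<open>
  Typing a morphism together with its source and target makes one fact per morphism suffice.
\<close>
definition arr where "arr X Y f \<longleftrightarrow> X \<in> Ob C \<and> Y \<in> Ob C \<and> f \<in> hom_set C X Y"

definition perp where "perp X Y \<longleftrightarrow> X \<in> Ob C \<and> Y \<in> Ob C \<and> zero_module (Hom C X Y)"

lemma arr_ob: "arr X Y f \<Longrightarrow> X \<in> Ob C" "arr X Y f \<Longrightarrow> Y \<in> Ob C"
  by (auto simp: arr_def)

lemma arr_cmp: "\<lbrakk>arr X Y f; arr Y Z g\<rbrakk> \<Longrightarrow> arr X Z (g \<cdot> f)"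
  using cmp_hom by (auto simp: arr_def)

lemma arr_id: "X \<in> Ob C \<Longrightarrow> arr X X (Idm C X)"
  using id_hom by (auto simp: arr_def)

lemma arr_zm: "\<lbrakk>X \<in> Ob C; Y \<in> Ob C\<rbrakk> \<Longrightarrow> arr X Y (zm X Y)"
proof -
  assume o: "X \<in> Ob C" "Y \<in> Ob C"
  interpret H: module R "Hom C X Y" by (rule hom_module[OF o])
  show ?thesis using o by (simp add: arr_def)
qed

lemma arr_shm: "arr X Y f \<Longrightarrow> arr (Sho C p X) (Sho C p Y) (Shm C p f)"
  using linear_map_closed[OF shm_linear] sho_ob by (auto simp: arr_def)

lemma arr_neg: "arr X Y f \<Longrightarrow> arr X Y (\<ominus>\<^bsub>Hom C X Y\<^esub> f)"
proof -
  assume f: "arr X Y f"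
  interpret H: module R "Hom C X Y" using hom_module f by (auto simp: arr_def)
  show ?thesis using f by (simp add: arr_def)
qed

lemma arr_add: "\<lbrakk>arr X Y f; arr X Y g\<rbrakk> \<Longrightarrow> arr X Y (f \<oplus>\<^bsub>Hom C X Y\<^esub> g)"
proof -
  assume fg: "arr X Y f" "arr X Y g"
  interpret H: module R "Hom C X Y" using hom_module fg by (auto simp: arr_def)
  show ?thesis using fg by (simp add: arr_def)
qed

lemma arr_smult: "\<lbrakk>a \<in> carrier R; arr X Y f\<rbrakk> \<Longrightarrow> arr X Y (a \<odot>\<^bsub>Hom C X Y\<^esub> f)"
proof -
  assume f: "arr X Y f" and a: "a \<in> carrier R"
  interpret H: module R "Hom C X Y" using hom_module f by (auto simp: arr_def)
  show ?thesis using f a by (simp add: arr_def)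
qed

lemma id_left: "arr X Y f \<Longrightarrow> Idm C Y \<cdot> f = f"
  and id_right: "arr X Y f \<Longrightarrow> f \<cdot> Idm C X = f"
  using cmp_id by (auto simp: arr_def)

lemma assoc: "\<lbrakk>arr X Y f; arr Y Z g; arr Z W h\<rbrakk> \<Longrightarrow> h \<cdot> (g \<cdot> f) = (h \<cdot> g) \<cdot> f"
  using cmp_assoc by (auto simp: arr_def)

lemma cmp_zm_right: "\<lbrakk>X \<in> Ob C; arr Y Z g\<rbrakk> \<Longrightarrow> g \<cdot> zm X Y = zm X Z"
  using linear_map_zero[OF hom_module hom_module cmp_linear_right] by (auto simp: arr_def)

lemma cmp_zm_left: "\<lbrakk>arr X Y f; Z \<in> Ob C\<rbrakk> \<Longrightarrow> zm Y Z \<cdot> f = zm X Z"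
  using linear_map_zero[OF hom_module hom_module cmp_linear_left] by (auto simp: arr_def)

lemma cmp_neg_right: "\<lbrakk>arr X Y f; arr Y Z g\<rbrakk> \<Longrightarrow> g \<cdot> (\<ominus>\<^bsub>Hom C X Y\<^esub> f) = \<ominus>\<^bsub>Hom C X Z\<^esub> (g \<cdot> f)"
  using linear_map_minus[OF hom_module hom_module cmp_linear_right] by (auto simp: arr_def)

lemma cmp_neg_left: "\<lbrakk>arr X Y f; arr Y Z g\<rbrakk> \<Longrightarrow> (\<ominus>\<^bsub>Hom C Y Z\<^esub> g) \<cdot> f = \<ominus>\<^bsub>Hom C X Z\<^esub> (g \<cdot> f)"
  using linear_map_minus[OF hom_module hom_module cmp_linear_left] by (auto simp: arr_def)

lemma cmp_add_left: "\<lbrakk>arr X Y e; arr Y Z f; arr Y Z g\<rbrakk>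
    \<Longrightarrow> (f \<oplus>\<^bsub>Hom C Y Z\<^esub> g) \<cdot> e = f \<cdot> e \<oplus>\<^bsub>Hom C X Z\<^esub> g \<cdot> e"
  using linear_map_add[OF cmp_linear_left] by (auto simp: arr_def)

lemma cmp_add_right: "\<lbrakk>arr Y Z e; arr X Y f; arr X Y g\<rbrakk>
    \<Longrightarrow> e \<cdot> (f \<oplus>\<^bsub>Hom C X Y\<^esub> g) = e \<cdot> f \<oplus>\<^bsub>Hom C X Z\<^esub> e \<cdot> g"
  using linear_map_add[OF cmp_linear_right] by (auto simp: arr_def)

lemma cmp_smult_left: "\<lbrakk>arr X Y e; arr Y Z f; a \<in> carrier R\<rbrakk>
    \<Longrightarrow> (a \<odot>\<^bsub>Hom C Y Z\<^esub> f) \<cdot> e = a \<odot>\<^bsub>Hom C X Z\<^esub> (f \<cdot> e)"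
  using linear_map_smult[OF cmp_linear_left] by (auto simp: arr_def)

lemma cmp_smult_right: "\<lbrakk>arr Y Z e; arr X Y f; a \<in> carrier R\<rbrakk>
    \<Longrightarrow> e \<cdot> (a \<odot>\<^bsub>Hom C X Y\<^esub> f) = a \<odot>\<^bsub>Hom C X Z\<^esub> (e \<cdot> f)"
  using linear_map_smult[OF cmp_linear_right] by (auto simp: arr_def)

lemma neg_neg: "arr X Y f \<Longrightarrow> \<ominus>\<^bsub>Hom C X Y\<^esub> (\<ominus>\<^bsub>Hom C X Y\<^esub> f) = f"
proof -
  assume f: "arr X Y f"
  interpret H: module R "Hom C X Y" using hom_module f by (auto simp: arr_def)
  show ?thesis using f by (simp add: arr_def)
qed

text \<open>
  Composition is additive, so injectivity need only be tested on zero. The later uniqueness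
  arguments about morphisms appeal to this lemma and the next one instead of subtracting.
\<close>
lemma eq_if_precomp_kernel_zero:
  assumes e: "arr X Y e" and a: "arr Y W a" and b: "arr Y W b" and ab: "a \<cdot> e = b \<cdot> e"
    and ker: "\<And>c. \<lbrakk>arr Y W c; c \<cdot> e = zm X W\<rbrakk> \<Longrightarrow> c = zm Y W"
  shows "a = b"
proof -
  interpret H: module R "Hom C Y W" using hom_module a by (auto simp: arr_def)
  interpret H': module R "Hom C X W" using hom_module a e by (auto simp: arr_def)
  have o: "X \<in> Ob C" "Y \<in> Ob C" "W \<in> Ob C" "e \<in> hom_set C X Y"
    and h: "a \<in> hom_set C Y W" "b \<in> hom_set C Y W"
    using e a b by (auto simp: arr_def)
  have be: "b \<cdot> e \<in> hom_set C X W" using cmp_hom[OF o h(2)] .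
  have "(a \<ominus>\<^bsub>Hom C Y W\<^esub> b) \<cdot> e = a \<cdot> e \<ominus>\<^bsub>Hom C X W\<^esub> b \<cdot> e"
    using linear_map_add[OF cmp_linear_left[OF o]] h b cmp_neg_left[OF e b]
    by (simp add: a_minus_def)
  also have "\<dots> = zm X W" using be by (simp add: ab a_minus_def H'.M.r_neg)
  finally have "a \<ominus>\<^bsub>Hom C Y W\<^esub> b = zm Y W"
    using h o by (intro ker) (auto simp: arr_def)
  then show ?thesis using h by (metis H.M.add.inv_solve_right' H.M.l_zero H.M.zero_closed a_minus_def)
qed

lemma eq_if_postcomp_kernel_zero:
  assumes e: "arr X Y e" and a: "arr W X a" and b: "arr W X b" and ab: "e \<cdot> a = e \<cdot> b"
    and ker: "\<And>c. \<lbrakk>arr W X c; e \<cdot> c = zm W Y\<rbrakk> \<Longrightarrow> c = zm W X"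
  shows "a = b"
proof -
  interpret H: module R "Hom C W X" using hom_module a by (auto simp: arr_def)
  interpret H': module R "Hom C W Y" using hom_module a e by (auto simp: arr_def)
  have o: "W \<in> Ob C" "X \<in> Ob C" "Y \<in> Ob C" "e \<in> hom_set C X Y"
    and h: "a \<in> hom_set C W X" "b \<in> hom_set C W X"
    using e a b by (auto simp: arr_def)
  have be: "e \<cdot> b \<in> hom_set C W Y" using cmp_hom[OF o(1-3) h(2) o(4)] .
  have "e \<cdot> (a \<ominus>\<^bsub>Hom C W X\<^esub> b) = e \<cdot> a \<ominus>\<^bsub>Hom C W Y\<^esub> e \<cdot> b"
    using linear_map_add[OF cmp_linear_right[OF o]] h b cmp_neg_right[OF b e]
    by (simp add: a_minus_def)
  also have "\<dots> = zm W Y" using be by (simp add: ab a_minus_def H'.M.r_neg)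
  finally have "a \<ominus>\<^bsub>Hom C W X\<^esub> b = zm W X"
    using h o by (intro ker) (auto simp: arr_def)
  then show ?thesis using h by (metis H.M.add.inv_solve_right' H.M.l_zero H.M.zero_closed a_minus_def)
qed

lemma sho_sho: "X \<in> Ob C \<Longrightarrow> Sho C p (Sho C q X) = Sho C (p + q) X"
  by (simp add: sho_add)

lemma shm_shm: "arr X Y f \<Longrightarrow> Shm C p (Shm C q f) = Shm C (p + q) f"
  using shm_add[of X Y f p q] by (simp add: arr_def)

lemma shm_zero: "arr X Y f \<Longrightarrow> Shm C 0 f = f"
  by (auto simp: shm_0 arr_def)

lemma shm_comp: "\<lbrakk>arr X Y f; arr Y Z g\<rbrakk> \<Longrightarrow> Shm C p (g \<cdot> f) = Shm C p g \<cdot> Shm C p f"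
  using shm_cmp by (auto simp: arr_def)

lemma shm_zm: "\<lbrakk>X \<in> Ob C; Y \<in> Ob C\<rbrakk> \<Longrightarrow> Shm C p (zm X Y) = zm (Sho C p X) (Sho C p Y)"
  using linear_map_zero[OF hom_module hom_module[OF sho_ob sho_ob] shm_linear] by auto

lemma shm_surj:
  assumes "X \<in> Ob C" "Y \<in> Ob C" "arr (Sho C p X) (Sho C p Y) g"
  obtains f where "arr X Y f" "Shm C p f = g"
proof
  show "arr X Y (Shm C (- p) g)"
    using arr_shm[OF assms(3), of "- p"] assms(1,2) by (simp add: sho_sho sho_0)
  show "Shm C p (Shm C (- p) g) = g"
    using shm_shm[OF assms(3)] shm_zero[OF assms(3)] by simp
qed

lemma perp_ob: "perp X Y \<Longrightarrow> X \<in> Ob C" "perp X Y \<Longrightarrow> Y \<in> Ob C"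
  by (auto simp: perp_def)

lemma perpD: "\<lbrakk>perp X Y; arr X Y f\<rbrakk> \<Longrightarrow> f = zm X Y"
  by (auto simp: perp_def arr_def zero_module_def)

lemma perpI:
  assumes "X \<in> Ob C" "Y \<in> Ob C" "\<And>f. arr X Y f \<Longrightarrow> f = zm X Y"
  shows "perp X Y"
proof -
  have "hom_set C X Y = {zm X Y}"
    using assms(3) arr_zm[OF assms(1,2)] assms(1,2) unfolding arr_def by blast
  then show ?thesis using assms(1,2) by (simp add: perp_def zero_module_def)
qed

lemma perp_shift:
  assumes "perp X Y"
  shows "perp (Sho C p X) (Sho C p Y)"
proof (rule perpI)
  note o = perp_ob[OF assms]
  show "Sho C p X \<in> Ob C" "Sho C p Y \<in> Ob C" using o sho_ob by auto
  fix g assume "arr (Sho C p X) (Sho C p Y) g"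
  then obtain f where "arr X Y f" "Shm C p f = g" using shm_surj[OF o] by blast
  then show "g = zm (Sho C p X) (Sho C p Y)" using perpD[OF assms] shm_zm[OF o] by metis
qed

lemma perp_shift_iff:
  assumes "X \<in> Ob C" "Y \<in> Ob C"
  shows "perp (Sho C p X) (Sho C p Y) \<longleftrightarrow> perp X Y"
  using perp_shift[of "Sho C p X" "Sho C p Y" "- p"] perp_shift[of X Y p] assms
  by (auto simp: sho_sho sho_0)

lemma perp_shift_left_iff:
  assumes "X \<in> Ob C" "Y \<in> Ob C"
  shows "perp (Sho C p X) Y \<longleftrightarrow> perp X (Sho C (- p) Y)"
  using perp_shift_iff[OF assms(1) sho_ob[OF assms(2)], of p "- p"] assms by (simp add: sho_sho sho_0)

lemma perp_retract:
  assumes "perp X W" and "arr Y X i" "arr X Y p" "p \<cdot> i = Idm C Y"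
  shows "perp Y W"
proof (rule perpI)
  show o: "Y \<in> Ob C" "W \<in> Ob C" using assms by (auto simp: perp_def arr_def)
  fix f assume f: "arr Y W f"
  have "f = (f \<cdot> p) \<cdot> i" using assoc[OF assms(2,3) f] assms(4) id_right[OF f] by simp
  also have "f \<cdot> p = zm X W" by (rule perpD[OF assms(1) arr_cmp[OF assms(3) f]])
  finally show "f = zm Y W" using cmp_zm_left[OF assms(2) o(2)] by simp
qed

text \<open>
  The identity of \<open>N\<close> is zero.
\<close>
lemma perp_self_imp_perp:
  assumes N: "perp N N" and W: "W \<in> Ob C"
  shows "perp W N"
proof (rule perpI[OF W perp_ob(1)[OF N]])
  have id0: "Idm C N = zm N N" by (rule perpD[OF N arr_id[OF perp_ob(1)[OF N]]])
  fix f assume f: "arr W N f"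
  then show "f = zm W N" using id_left[OF f] cmp_zm_left[OF f perp_ob(1)[OF N]] id0 by simp
qed

lemma iso_mapI:
  "\<lbrakk>arr X Y f; arr Y X g; g \<cdot> f = Idm C X; f \<cdot> g = Idm C Y\<rbrakk> \<Longrightarrow> iso_map C X Y f"
  by (auto simp: iso_map_def arr_def)

lemma iso_mapE:
  assumes "iso_map C X Y f" "X \<in> Ob C" "Y \<in> Ob C"
  obtains g where "arr X Y f" "arr Y X g" "g \<cdot> f = Idm C X" "f \<cdot> g = Idm C Y" "iso_map C Y X g"
  using assms by (auto simp: iso_map_def arr_def)

lemma isomorphicI: "\<lbrakk>iso_map C X Y f; X \<in> Ob C; Y \<in> Ob C\<rbrakk> \<Longrightarrow> isomorphic C X Y"
  by (auto simp: isomorphic_def)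

lemma iso_map_id: "X \<in> Ob C \<Longrightarrow> iso_map C X X (Idm C X)"
  using iso_mapI[OF arr_id arr_id] id_left[OF arr_id] by auto

lemma isomorphic_sym: "isomorphic C X Y \<Longrightarrow> isomorphic C Y X"
  by (auto simp: isomorphic_def iso_map_def)

lemma iso_map_comp:
  assumes f: "iso_map C X Y f" and g: "iso_map C Y Z g"
    and o: "X \<in> Ob C" "Y \<in> Ob C" "Z \<in> Ob C"
  shows "iso_map C X Z (g \<cdot> f)"
proof -
  obtain f' where f': "arr X Y f" "arr Y X f'" "f' \<cdot> f = Idm C X" "f \<cdot> f' = Idm C Y"
    using iso_mapE[OF f o(1,2)] .
  obtain g' where g': "arr Y Z g" "arr Z Y g'" "g' \<cdot> g = Idm C Y" "g \<cdot> g' = Idm C Z"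
    using iso_mapE[OF g o(2,3)] .
  have "(f' \<cdot> g') \<cdot> (g \<cdot> f) = f' \<cdot> ((g' \<cdot> g) \<cdot> f)"
    using assoc[OF arr_cmp[OF f'(1) g'(1)] g'(2) f'(2)] assoc[OF f'(1) g'(1,2)] by simp
  also have "\<dots> = Idm C X" by (simp add: g' f' id_left[OF f'(1)])
  finally have 1: "(f' \<cdot> g') \<cdot> (g \<cdot> f) = Idm C X" .
  have "(g \<cdot> f) \<cdot> (f' \<cdot> g') = g \<cdot> ((f \<cdot> f') \<cdot> g')"
    using assoc[OF arr_cmp[OF g'(2) f'(2)] f'(1) g'(1)] assoc[OF g'(2) f'(2,1)] by simp
  also have "\<dots> = Idm C Z" by (simp add: g' f' id_left[OF g'(2)])
  finally show ?thesis
    using 1 iso_mapI[OF arr_cmp[OF f'(1) g'(1)] arr_cmp[OF g'(2) f'(2)]] by blast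
qed

lemma isomorphic_trans: "isomorphic C X Y \<Longrightarrow> isomorphic C Y Z \<Longrightarrow> isomorphic C X Z"
  unfolding isomorphic_def using iso_map_comp by blast

lemma isomorphic_shift:
  assumes "isomorphic C X Y"
  shows "isomorphic C (Sho C k X) (Sho C k Y)"
proof -
  have o: "X \<in> Ob C" "Y \<in> Ob C" using assms by (auto simp: isomorphic_def)
  obtain f where "iso_map C X Y f" using assms by (auto simp: isomorphic_def)
  then obtain g where g: "arr X Y f" "arr Y X g" "g \<cdot> f = Idm C X" "f \<cdot> g = Idm C Y"
    using iso_mapE o by blast
  have "iso_map C (Sho C k X) (Sho C k Y) (Shm C k f)"
    using shm_comp[OF g(1,2), of k] shm_comp[OF g(2,1), of k] g(3,4) o
    by (intro iso_mapI[OF arr_shm[OF g(1)] arr_shm[OF g(2)]]) (auto simp: shm_id)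
  then show ?thesis using o by (auto intro: isomorphicI sho_ob)
qed

lemma perp_iso_right: "\<lbrakk>isomorphic C Y Y'; perp X Y\<rbrakk> \<Longrightarrow> perp X Y'"
proof (rule perpI)
  assume i: "isomorphic C Y Y'" and p: "perp X Y"
  show o: "X \<in> Ob C" "Y' \<in> Ob C" using i perp_ob[OF p] by (auto simp: isomorphic_def)
  obtain u v where u: "arr Y Y' u" "arr Y' Y v" "u \<cdot> v = Idm C Y'"
    using i iso_mapE unfolding isomorphic_def by metis
  fix f assume f: "arr X Y' f"
  have "f = u \<cdot> (v \<cdot> f)" using assoc[OF f u(2,1)] u(3) id_left[OF f] by simp
  also have "v \<cdot> f = zm X Y" using perpD[OF p arr_cmp[OF f u(2)]] .
  finally show "f = zm X Y'" using cmp_zm_right[OF o(1) u(1)] by simp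
qed

lemma direct_sum_shift:
  assumes "direct_sum C X Y S"
  shows "direct_sum C (Sho C n X) (Sho C n Y) (Sho C n S)"
proof -
  obtain i j p q where o: "X \<in> Ob C" "Y \<in> Ob C" "S \<in> Ob C"
    and m: "arr X S i" "arr Y S j" "arr S X p" "arr S Y q"
    and e: "p \<cdot> i = Idm C X" "q \<cdot> j = Idm C Y" "p \<cdot> j = zm Y X" "q \<cdot> i = zm X Y"
      "i \<cdot> p \<oplus>\<^bsub>Hom C S S\<^esub> j \<cdot> q = Idm C S"
    using assms by (auto simp: direct_sum_def arr_def)
  have ip: "arr S S (i \<cdot> p)" and jq: "arr S S (j \<cdot> q)" using arr_cmp m by blast+
  have "Shm C n (i \<cdot> p \<oplus>\<^bsub>Hom C S S\<^esub> j \<cdot> q)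
      = Shm C n (i \<cdot> p) \<oplus>\<^bsub>Hom C (Sho C n S) (Sho C n S)\<^esub> Shm C n (j \<cdot> q)"
    using ip jq by (intro linear_map_add[OF shm_linear[OF o(3,3)]]) (auto simp: arr_def)
  then have sum: "Shm C n i \<cdot> Shm C n p \<oplus>\<^bsub>Hom C (Sho C n S) (Sho C n S)\<^esub> Shm C n j \<cdot> Shm C n q
      = Idm C (Sho C n S)"
    using e(5) m o by (simp add: shm_comp[symmetric] shm_id)
  have s: "Shm C n p \<cdot> Shm C n i = Idm C (Sho C n X)" "Shm C n q \<cdot> Shm C n j = Idm C (Sho C n Y)"
    "Shm C n p \<cdot> Shm C n j = zm (Sho C n Y) (Sho C n X)"
    "Shm C n q \<cdot> Shm C n i = zm (Sho C n X) (Sho C n Y)"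
    using e m o by (simp_all add: shm_comp[symmetric] shm_id shm_zm)
  show ?thesis
    unfolding direct_sum_def
    by (intro conjI sho_ob o bexI[of _ "Shm C n i"] bexI[of _ "Shm C n j"]
        bexI[of _ "Shm C n p"] bexI[of _ "Shm C n q"] s sum)
      (use m arr_shm in \<open>auto simp: arr_def\<close>)
qed

end

section \<open>Triangles and orthogonality\<close>

context linear_triangulated_category
begin

lemma tri_arr:
  assumes "Tri C X Y Z f g h"
  shows "arr X Y f" "arr Y Z g" "arr Z (Sho C 1 X) h"
  using tri_type[OF assms] sho_ob by (auto simp: arr_def)

lemma tri_ob:
  assumes "Tri C X Y Z f g h"
  shows "X \<in> Ob C" "Y \<in> Ob C" "Z \<in> Ob C"
  using tri_type[OF assms] by auto

lemma tri_rotate: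
  assumes "Tri C X Y Z f g h"
  shows "Tri C Y Z (Sho C 1 X) g h (\<ominus>\<^bsub>Hom C (Sho C 1 X) (Sho C 1 Y)\<^esub> (Shm C 1 f))"
  using TR2[of X Y Z f g h] tri_type[OF assms] assms by auto

text \<open>
  The first map is \<open>-h[-1]\<close>: the rotation of triangles introduces a sign, which this one cancels.
\<close>
lemma tri_unrotate:
  assumes T: "Tri C X Y Z f g h"
  obtains k where "Tri C (Sho C (- 1) Z) X Y k f g"
proof
  let ?Z = "Sho C (- 1) Z"
  have o: "?Z \<in> Ob C" "X \<in> Ob C" "Y \<in> Ob C" "Z \<in> Ob C" using tri_ob[OF T] sho_ob by auto
  have h: "arr ?Z X (Shm C (- 1) h)"
    using arr_shm[OF tri_arr(3)[OF T], of "- 1"] o by (simp add: sho_sho sho_0)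
  let ?k = "\<ominus>\<^bsub>Hom C ?Z X\<^esub> (Shm C (- 1) h)"
  have Z: "Sho C 1 ?Z = Z" using o by (simp add: sho_sho sho_0)
  have "Shm C 1 ?k = \<ominus>\<^bsub>Hom C (Sho C 1 ?Z) (Sho C 1 X)\<^esub> (Shm C 1 (Shm C (- 1) h))"
    using h o by (intro linear_map_minus[OF hom_module hom_module[OF sho_ob sho_ob] shm_linear])
      (auto simp: arr_def)
  also have "Shm C 1 (Shm C (- 1) h) = h"
    using shm_shm[OF tri_arr(3)[OF T]] shm_zero[OF tri_arr(3)[OF T]] by simp
  finally have "\<ominus>\<^bsub>Hom C (Sho C 1 ?Z) (Sho C 1 X)\<^esub> (Shm C 1 ?k) = h"
    using neg_neg[of "Sho C 1 ?Z" "Sho C 1 X" h] tri_arr(3)[OF T] Z by simp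
  then show "Tri C ?Z X Y ?k f g"
    using TR2[OF o(1-3), of ?k f g] arr_neg[OF h] tri_arr[OF T] T Z by (simp add: arr_def)
qed

text \<open>
  By TR3 the map from the triangle of the identity of \<open>X\<close> given by \<open>id\<close> and \<open>f\<close> extends to the third
  vertices, so \<open>g \<cdot> f\<close> factors through a zero object.
\<close>
lemma tri_comp_zero:
  assumes T: "Tri C X Y Z f g h"
  shows "g \<cdot> f = zm X Z"
proof -
  note o = tri_ob[OF T] and a = tri_arr[OF T]
  obtain O' where O': "zero_obj C O'" using zero_ex by blast
  have oO: "O' \<in> Ob C" using O' by (simp add: zero_obj_def)
  have "\<exists>c\<in>hom_set C O' Z. c \<cdot> zm X O' = g \<cdot> f \<and>
      Shm C 1 (Idm C X) \<cdot> zm O' (Sho C 1 X) = h \<cdot> c"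
    using o a by (intro TR3[OF TR1_id[OF o(1) O'] T]) (auto simp: id_hom arr_def)
  then show ?thesis
    using cmp_zm_right[OF o(1)] o oO by (metis arr_def)
qed

text \<open>
  TR3, applied to the given triangle and the triangle \<open>O[-1] \<rightarrow> W \<rightarrow> W \<rightarrow> O\<close> with \<open>O\<close> zero.
\<close>
lemma tri_weak_cokernel:
  assumes T: "Tri C X Y Z f g h" and a: "arr Y W a" and z: "a \<cdot> f = zm X W"
  obtains b where "arr Z W b" "b \<cdot> g = a"
proof -
  note o = tri_ob[OF T] and m = tri_arr[OF T]
  obtain O' where O': "zero_obj C O'" using zero_ex by blast
  have oO: "O' \<in> Ob C" using O' by (simp add: zero_obj_def)
  have W: "W \<in> Ob C" using a by (simp add: arr_def)
  obtain k where k: "Tri C (Sho C (- 1) O') W W k (Idm C W) (zm W O')"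
    using tri_unrotate[OF TR1_id[OF W O']] by blast
  have "\<exists>c\<in>hom_set C Z W. c \<cdot> g = Idm C W \<cdot> a \<and>
      Shm C 1 (zm X (Sho C (- 1) O')) \<cdot> h = zm W O' \<cdot> c"
    using arr_zm[OF o(1) sho_ob[OF oO]] a cmp_zm_right[OF o(1) tri_arr(1)[OF k]] z
    by (intro TR3[OF T k]) (auto simp: arr_def)
  then show thesis
    using that o W id_left[OF a] by (auto simp: arr_def)
qed

text \<open>
  TR3, applied to \<open>W \<rightarrow> O \<rightarrow> W[1]\<close> and the rotated triangle, provides a map \<open>W[1] \<rightarrow> X[1]\<close>; its shift
  by \<open>-1\<close> is the desired factorization, the signs of the two rotations cancelling each other.
\<close>
lemma tri_weak_kernel:
  assumes T: "Tri C X Y Z f g h" and a: "arr W Y a" and z: "g \<cdot> a = zm W Z"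
  obtains b where "arr W X b" "f \<cdot> b = a"
proof -
  note o = tri_ob[OF T] and m = tri_arr[OF T]
  obtain O' where O': "zero_obj C O'" using zero_ex by blast
  have oO: "O' \<in> Ob C" using O' by (simp add: zero_obj_def)
  have W: "W \<in> Ob C" using a by (simp add: arr_def)
  let ?W = "Sho C 1 W" and ?X = "Sho C 1 X" and ?Y = "Sho C 1 Y"
  note s = sho_ob[OF W, of 1] sho_ob[OF o(1), of 1] sho_ob[OF o(2), of 1]
  note kk = tri_rotate[OF TR1_id[OF W O']]
  note fT = tri_rotate[OF T]
  have "\<exists>c\<in>hom_set C ?W ?X. c \<cdot> zm O' ?W = h \<cdot> zm O' Z \<and>
      Shm C 1 a \<cdot> (\<ominus>\<^bsub>Hom C ?W ?W\<^esub> (Shm C 1 (Idm C W))) = (\<ominus>\<^bsub>Hom C ?X ?Y\<^esub> (Shm C 1 f)) \<cdot> c"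
    using a arr_zm[OF oO o(3)] z cmp_zm_left[OF arr_zm[OF W oO] o(3)]
    by (intro TR3[OF kk fT]) (auto simp: arr_def)
  then obtain c where c: "arr ?W ?X c"
    and eq: "Shm C 1 a \<cdot> (\<ominus>\<^bsub>Hom C ?W ?W\<^esub> (Shm C 1 (Idm C W))) = (\<ominus>\<^bsub>Hom C ?X ?Y\<^esub> (Shm C 1 f)) \<cdot> c"
    using s by (auto simp: arr_def)
  have a1: "arr ?W ?Y (Shm C 1 a)" and f1: "arr ?X ?Y (Shm C 1 f)"
    using arr_shm a m(1) by auto
  have "\<ominus>\<^bsub>Hom C ?W ?Y\<^esub> (Shm C 1 a) = \<ominus>\<^bsub>Hom C ?W ?Y\<^esub> (Shm C 1 f \<cdot> c)"
    using eq cmp_neg_right[OF arr_id[OF s(1)] a1] cmp_neg_left[OF c f1] id_right[OF a1] W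
    by (simp add: shm_id)
  then have eq1: "Shm C 1 a = Shm C 1 f \<cdot> c"
    using neg_neg[OF a1] neg_neg[OF arr_cmp[OF c f1]] by metis
  obtain b where b: "arr W X b" "Shm C 1 b = c" using shm_surj[OF W o(1) c] by blast
  have "Shm C (- 1) (Shm C 1 a) = Shm C (- 1) (Shm C 1 (f \<cdot> b))"
    using eq1 shm_comp[OF b(1) m(1)] b(2) by simp
  then have "f \<cdot> b = a"
    using shm_shm[OF a, of "-1" 1] shm_shm[OF arr_cmp[OF b(1) m(1)], of "-1" 1]
      shm_zero[OF a] shm_zero[OF arr_cmp[OF b(1) m(1)]] by simp
  with b(1) show thesis by (rule that)
qed

text \<open>
  The long exact sequences of \<open>Hom(W, -)\<close> and \<open>Hom(-, W)\<close> are used in the following form: if a term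
  vanishes, then the map into the preceding term is surjective and the map out of the following term
  is injective.
\<close>
lemma tri_lift:
  assumes T: "Tri C X Y Z f g h" and a: "arr W Y a" and p: "perp W Z"
  obtains b where "arr W X b" "f \<cdot> b = a"
  using tri_weak_kernel[OF T a] perpD[OF p] arr_cmp[OF a tri_arr(2)[OF T]] by blast

lemma tri_lift2:
  assumes T: "Tri C X Y Z f g h" and a: "arr W Z a" and p: "perp W (Sho C 1 X)"
  obtains b where "arr W Y b" "g \<cdot> b = a"
  using tri_lift[OF tri_rotate[OF T] a p] by blast

lemma tri_extend:
  assumes T: "Tri C X Y Z f g h" and a: "arr Y W a" and p: "perp X W"
  obtains b where "arr Z W b" "b \<cdot> g = a"
  using tri_weak_cokernel[OF T a] perpD[OF p] arr_cmp[OF tri_arr(1)[OF T] a] by blast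

lemma tri_mono2:
  assumes T: "Tri C X Y Z f g h" and p: "perp W X"
    and a: "arr W Y a" "arr W Y a'" "g \<cdot> a = g \<cdot> a'"
  shows "a = a'"
proof (rule eq_if_postcomp_kernel_zero[OF tri_arr(2)[OF T] a])
  fix c assume c: "arr W Y c" "g \<cdot> c = zm W Z"
  obtain b where b: "arr W X b" "f \<cdot> b = c" using tri_weak_kernel[OF T c] .
  then show "c = zm W Y"
    using perpD[OF p b(1)] cmp_zm_right[OF perp_ob(1)[OF p] tri_arr(1)[OF T]] by simp
qed

lemma tri_mono1:
  assumes T: "Tri C X Y Z f g h" and p: "perp W (Sho C (- 1) Z)"
    and a: "arr W X a" "arr W X a'" "f \<cdot> a = f \<cdot> a'"
  shows "a = a'"
proof -
  obtain k where "Tri C (Sho C (- 1) Z) X Y k f g" using tri_unrotate[OF T] .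
  from tri_mono2[OF this p a] show ?thesis .
qed

lemma tri_epi1:
  assumes T: "Tri C X Y Z f g h" and p: "perp Z W"
    and a: "arr Y W a" "arr Y W a'" "a \<cdot> f = a' \<cdot> f"
  shows "a = a'"
proof (rule eq_if_precomp_kernel_zero[OF tri_arr(1)[OF T] a])
  fix c assume c: "arr Y W c" "c \<cdot> f = zm X W"
  obtain b where b: "arr Z W b" "b \<cdot> g = c" using tri_weak_cokernel[OF T c] .
  then show "c = zm Y W"
    using perpD[OF p b(1)] cmp_zm_left[OF tri_arr(2)[OF T] perp_ob(2)[OF p]] by simp
qed

lemma tri_epi2:
  assumes T: "Tri C X Y Z f g h" and p: "perp (Sho C 1 X) W"
    and a: "arr Z W a" "arr Z W a'" "a \<cdot> g = a' \<cdot> g"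
  shows "a = a'"
  using tri_epi1[OF tri_rotate[OF T] p a] .

lemma perp_middle_right:
  assumes T: "Tri C X Y Z f g h" and p: "perp W X" "perp W Z"
  shows "perp W Y"
proof (rule perpI)
  fix a assume a: "arr W Y a"
  obtain b where b: "arr W X b" "f \<cdot> b = a" using tri_lift[OF T a p(2)] .
  then show "a = zm W Y"
    using perpD[OF p(1) b(1)] cmp_zm_right[OF perp_ob(1)[OF p(1)] tri_arr(1)[OF T]] by simp
qed (use p perp_ob tri_ob[OF T] in auto)

lemma perp_middle_left:
  assumes T: "Tri C X Y Z f g h" and p: "perp X W" "perp Z W"
  shows "perp Y W"
proof (rule perpI)
  fix a assume a: "arr Y W a"
  obtain b where b: "arr Z W b" "b \<cdot> g = a" using tri_extend[OF T a p(1)] .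
  then show "a = zm Y W"
    using perpD[OF p(2) b(1)] cmp_zm_left[OF tri_arr(2)[OF T] perp_ob(2)[OF p(2)]] by simp
qed (use p perp_ob tri_ob[OF T] in auto)

text \<open>
  Exactness of \<open>Hom(Y[1], W) \<rightarrow> Hom(X[1], W) \<rightarrow> Hom(Z, W) \<rightarrow> Hom(Y, W) \<rightarrow> Hom(X, W)\<close>.
\<close>
lemma perp_cone_left:
  assumes T: "Tri C X Y Z f g h" and W: "W \<in> Ob C"
    and inj: "\<And>a. \<lbrakk>arr Y W a; a \<cdot> f = zm X W\<rbrakk> \<Longrightarrow> a = zm Y W"
    and surj: "\<And>a. arr (Sho C 1 X) W a \<Longrightarrow> \<exists>b. arr (Sho C 1 Y) W b \<and> b \<cdot> Shm C 1 f = a"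
  shows "perp Z W"
proof (rule perpI)
  note m = tri_arr[OF T]
  have X1: "Sho C 1 X \<in> Ob C" "Sho C 1 Y \<in> Ob C" using tri_ob[OF T] sho_ob by auto
  fix a assume a: "arr Z W a"
  have "(a \<cdot> g) \<cdot> f = zm X W"
    using assoc[OF m(1,2) a] tri_comp_zero[OF T] cmp_zm_right[OF tri_ob(1)[OF T] a] by simp
  then have "a \<cdot> g = zm Y W" using inj[OF arr_cmp[OF m(2) a]] by simp
  then obtain b where b: "arr (Sho C 1 X) W b" "b \<cdot> h = a"
    using tri_weak_cokernel[OF tri_rotate[OF T] a] by blast
  obtain c where c: "arr (Sho C 1 Y) W c" "c \<cdot> Shm C 1 f = b" using surj[OF b(1)] by blast
  have f1: "arr (Sho C 1 X) (Sho C 1 Y) (Shm C 1 f)" by (rule arr_shm[OF m(1)])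
  have "(\<ominus>\<^bsub>Hom C (Sho C 1 X) (Sho C 1 Y)\<^esub> (Shm C 1 f)) \<cdot> h = zm Z (Sho C 1 Y)"
    using tri_comp_zero[OF tri_rotate[OF tri_rotate[OF T]]] .
  then have "\<ominus>\<^bsub>Hom C Z (Sho C 1 Y)\<^esub> (Shm C 1 f \<cdot> h) = zm Z (Sho C 1 Y)"
    using cmp_neg_left[OF m(3) f1] by simp
  moreover have "\<ominus>\<^bsub>Hom C Z (Sho C 1 Y)\<^esub> (zm Z (Sho C 1 Y)) = zm Z (Sho C 1 Y)"
  proof -
    interpret H: module R "Hom C Z (Sho C 1 Y)"
      using hom_module tri_ob[OF T] X1 by auto
    show ?thesis by simp
  qed
  ultimately have "Shm C 1 f \<cdot> h = zm Z (Sho C 1 Y)"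
    using neg_neg[OF arr_cmp[OF m(3) f1]] by metis
  then have "c \<cdot> (Shm C 1 f \<cdot> h) = zm Z W" using cmp_zm_right[OF tri_ob(3)[OF T] c(1)] by simp
  then show "a = zm Z W" using assoc[OF m(3) f1 c(1)] b(2) c(2) by simp
qed (use W tri_ob[OF T] in auto)

text \<open>
  The identity of \<open>Y\<close> lifts to a right inverse of \<open>f\<close>; it is also a left inverse because \<open>f\<close> is
  monic on maps out of \<open>X\<close>.
\<close>
lemma iso_of_perp_cone:
  assumes T: "Tri C X Y Z f g h" and p: "perp Y Z" "perp X (Sho C (- 1) Z)"
  shows "iso_map C X Y f"
proof -
  note m = tri_arr[OF T] and o = tri_ob[OF T]
  obtain s where s: "arr Y X s" "f \<cdot> s = Idm C Y" using tri_lift[OF T arr_id[OF o(2)] p(1)] .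
  have "f \<cdot> (s \<cdot> f) = f \<cdot> Idm C X"
    using assoc[OF m(1) s(1) m(1)] s(2) id_left[OF m(1)] id_right[OF m(1)] by simp
  then have "s \<cdot> f = Idm C X"
    using tri_mono1[OF T p(2) arr_cmp[OF m(1) s(1)] arr_id[OF o(1)]] by simp
  with iso_mapI[OF m(1) s(1)] s(2) show ?thesis by simp
qed

lemma iso_of_perp_cocone:
  assumes T: "Tri C X Y Z f g h" and p: "perp X Y" "perp (Sho C 1 X) Z"
  shows "iso_map C Y Z g"
proof -
  note m = tri_arr[OF T] and o = tri_ob[OF T]
  obtain s where s: "arr Z Y s" "s \<cdot> g = Idm C Y" using tri_extend[OF T arr_id[OF o(2)] p(1)] .
  have "(g \<cdot> s) \<cdot> g = Idm C Z \<cdot> g"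
    using assoc[OF m(2) s(1) m(2)] s(2) id_left[OF m(2)] id_right[OF m(2)] by simp
  then have "g \<cdot> s = Idm C Z"
    using tri_epi2[OF T p(2) arr_cmp[OF s(1) m(2)] arr_id[OF o(3)]] by simp
  with iso_mapI[OF m(2) s(1)] s(2) show ?thesis by simp
qed

text \<open>
  Both \<open>g\<close> and \<open>g'\<close> are universal among maps from \<open>M\<close> to \<open>N\<close> and \<open>N'\<close>.
\<close>
lemma reflection_unique:
  assumes T: "Tri C L M N f g h" and T': "Tri C L' M N' f' g' h'"
    and p: "perp L N'" "perp L' N" "perp (Sho C 1 L) N" "perp (Sho C 1 L') N'"
  shows "isomorphic C N N'"
proof -
  note m = tri_arr[OF T] and o = tri_ob[OF T] and m' = tri_arr[OF T'] and o' = tri_ob[OF T']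
  obtain a where a: "arr N N' a" "a \<cdot> g = g'" using tri_extend[OF T m'(2) p(1)] .
  obtain b where b: "arr N' N b" "b \<cdot> g' = g" using tri_extend[OF T' m(2) p(2)] .
  have "b \<cdot> a = Idm C N"
    using assoc[OF m(2) a(1) b(1)] a(2) b(2) id_left[OF m(2)]
    by (intro tri_epi2[OF T p(3) arr_cmp[OF a(1) b(1)] arr_id[OF o(3)]]) simp
  moreover have "a \<cdot> b = Idm C N'"
    using assoc[OF m'(2) b(1) a(1)] a(2) b(2) id_left[OF m'(2)]
    by (intro tri_epi2[OF T' p(4) arr_cmp[OF b(1) a(1)] arr_id[OF o'(3)]]) simp
  ultimately have "iso_map C N N' a" using iso_mapI[OF a(1) b(1)] by simp
  then show ?thesis using isomorphicI o(3) o'(3) by blast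
qed

text \<open>
  Shifting a triangle changes the signs of its maps; most arguments need only the vertices.
\<close>
definition tri where "tri X Y Z \<longleftrightarrow> (\<exists>f g h. Tri C X Y Z f g h)"

lemma triI: "Tri C X Y Z f g h \<Longrightarrow> tri X Y Z"
  by (auto simp: tri_def)

lemma tri_rot: "tri X Y Z \<Longrightarrow> tri Y Z (Sho C 1 X)"
  unfolding tri_def using tri_rotate by blast

lemma tri_unrot: "tri X Y Z \<Longrightarrow> tri (Sho C (- 1) Z) X Y"
  unfolding tri_def by (metis tri_unrotate)

lemma tri_objects: "tri X Y Z \<Longrightarrow> X \<in> Ob C \<and> Y \<in> Ob C \<and> Z \<in> Ob C"
  unfolding tri_def using tri_ob by blast

lemma tri_shift: "tri X Y Z \<Longrightarrow> tri (Sho C n X) (Sho C n Y) (Sho C n Z)"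
proof (induction n rule: int_induct[where k = 0])
  case base
  then show ?case using tri_objects by (simp add: sho_0)
next
  case (step1 i)
  then have "tri (Sho C 1 (Sho C i X)) (Sho C 1 (Sho C i Y)) (Sho C 1 (Sho C i Z))"
    using tri_rot by blast
  then show ?case using tri_objects[OF step1.prems] by (simp add: sho_sho add.commute)
next
  case (step2 i)
  then have "tri (Sho C (- 1) (Sho C i X)) (Sho C (- 1) (Sho C i Y)) (Sho C (- 1) (Sho C i Z))"
    using tri_unrot by blast
  then show ?case using tri_objects[OF step2.prems] by (simp add: sho_sho)
qed

lemma tri_iso_middle:
  assumes "tri X Y Z" and "isomorphic C Y Y'"
  shows "tri X Y' Z"
proof -
  obtain f g h where T: "Tri C X Y Z f g h" using assms(1) by (auto simp: tri_def)
  note o = tri_ob[OF T] and m = tri_arr[OF T]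
  have Y': "Y' \<in> Ob C" using assms(2) by (simp add: isomorphic_def)
  obtain b where b: "iso_map C Y Y' b" using assms(2) by (auto simp: isomorphic_def)
  then obtain b' where b': "arr Y Y' b" "arr Y' Y b'" "b' \<cdot> b = Idm C Y"
    using iso_mapE[OF b o(2) Y'] by metis
  have "g = (g \<cdot> b') \<cdot> b" using assoc[OF b'(1,2) m(2)] b'(3) id_right[OF m(2)] by simp
  then have "Tri C X Y' Z (b \<cdot> f) (g \<cdot> b') h"
    using arr_cmp[OF m(1) b'(1)] arr_cmp[OF b'(2) m(2)] m o Y' id_left[OF m(2)] id_left[OF m(3)] id_right[OF m(3)]
      id_right[OF arr_cmp[OF m(1) b'(1)]]
    by (intro TR1_iso[OF T o(1) Y' o(3) _ _ _ iso_map_id[OF o(1)] b iso_map_id[OF o(3)]])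
      (auto simp: arr_def shm_id)
  then show ?thesis by (rule triI)
qed

lemma tri_zero_cocone:
  assumes M: "M \<in> Ob C"
  obtains O' where "tri O' M M" and "\<And>X. X \<in> Ob C \<Longrightarrow> perp O' X"
proof -
  obtain Z where Z: "zero_obj C Z" using zero_ex by blast
  then have oZ: "Z \<in> Ob C" by (simp add: zero_obj_def)
  have "tri (Sho C (- 1) Z) M M" using tri_unrot[OF triI[OF TR1_id[OF M Z]]] .
  moreover have "perp (Sho C (- 1) Z) X" if X: "X \<in> Ob C" for X
  proof -
    have "perp Z (Sho C 1 X)" using Z oZ sho_ob[OF X] by (auto simp: zero_obj_def perp_def)
    then show ?thesis using perp_shift[of Z "Sho C 1 X" "- 1"] X by (simp add: sho_sho sho_0)
  qed
  ultimately show thesis by (rule that)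
qed

text \<open>
  The octahedral axiom for cocones: the cocone of the composite \<open>M \<rightarrow> N \<rightarrow> N'\<close> is an extension of the
  cocones of the two maps.
\<close>
lemma tri_octahedron:
  assumes "tri L M N" and "tri L' N N'"
  obtains K where "tri K M N'" and "tri L K L'"
proof -
  obtain f u h where T: "Tri C L M N f u h" using assms(1) by (auto simp: tri_def)
  obtain f' v h' where T': "Tri C L' N N' f' v h'" using assms(2) by (auto simp: tri_def)
  have vu: "arr M N' (v \<cdot> u)" by (rule arr_cmp[OF tri_arr(2)[OF T] tri_arr(2)[OF T']])
  then obtain Z m n where Z: "Tri C M N' Z (v \<cdot> u) m n"
    using TR1_cone[of M N' "v \<cdot> u"] unfolding arr_def by blast
  have "tri (Sho C 1 L) Z (Sho C 1 L')"
    using TR4[OF tri_rotate[OF T] tri_rotate[OF T'] Z] unfolding tri_def by blast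
  then have "tri L (Sho C (- 1) Z) L'"
    using tri_shift[of "Sho C 1 L" Z "Sho C 1 L'" "- 1"] tri_ob[OF T] tri_ob[OF T']
    by (simp add: sho_sho sho_0)
  moreover have "tri (Sho C (- 1) Z) M N'" by (rule tri_unrot[OF triI[OF Z]])
  ultimately show thesis using that by blast
qed

end

section \<open>Homological functors on categories with saturated opposite\<close>

lemma op_cat_simps [simp]:
  "Ob (op_cat C) = Ob C" "Hom (op_cat C) X Y = Hom C Y X" "Idm (op_cat C) = Idm C"
  "Cmp (op_cat C) g f = Cmp C f g" "Sho (op_cat C) i = Sho C (- i)"
  "Tri (op_cat C) X Y Z f g h = Tri C (Sho C (- 1) X) Z Y h g f"
  by (simp_all add: op_cat_def)

context linear_triangulated_category
begin

text \<open>
  Saturation of the opposite category in covariant terms, and for functors with values in modules of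
  an arbitrary type: finitely generated values can be encoded, and the functor is conjugated
  with the encodings.
\<close>
lemma homological_corepresentable:
  fixes F :: "'o \<Rightarrow> ('r, 'v) module"
  assumes sat: "R_saturated R (op_cat C)"
    and F: "linear_functor R (op_cat C) F \<Phi>"
    and exact: "\<And>X Y Z f g h. Tri C X Y Z f g h \<Longrightarrow>
      {y \<in> carrier (F Y). \<Phi> g y = \<zero>\<^bsub>F Z\<^esub>} = \<Phi> f ` carrier (F X)"
    and bounded: "locally_bounded (op_cat C) F"
    and fg: "\<And>X. X \<in> Ob C \<Longrightarrow> fin_gen_module R (F X)"
  shows "\<exists>D\<in>Ob C. \<exists>\<eta>.
    (\<forall>X\<in>Ob C. linear_map R (Hom C D X) (F X) (\<eta> X) \<and>
      bij_betw (\<eta> X) (hom_set C D X) (carrier (F X))) \<and>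
    (\<forall>X Y f x. arr X Y f \<longrightarrow> arr D X x \<longrightarrow> \<eta> Y (f \<cdot> x) = \<Phi> f (\<eta> X x))"
proof -
  have mod: "module R (F X)" if "X \<in> Ob C" for X
    using F that by (auto simp: linear_functor_def)
  have Flin: "linear_map R (F X) (F Y) (\<Phi> f)" if "arr X Y f" for X Y f
    using F that by (auto simp: linear_functor_def arr_def)
  have Fid: "\<Phi> (Idm C X) x = x" if "X \<in> Ob C" "x \<in> carrier (F X)" for X x
    using F that by (auto simp: linear_functor_def)
  have Fcmp: "\<Phi> (g \<cdot> f) x = \<Phi> g (\<Phi> f x)" if "arr X Y f" "arr Y Z g" "x \<in> carrier (F X)" for X Y Z f g x
    using F that unfolding linear_functor_def arr_def op_cat_simps by blast
  have Fadd: "\<Phi> (f \<oplus>\<^bsub>Hom C X Y\<^esub> g) x = \<Phi> f x \<oplus>\<^bsub>F Y\<^esub> \<Phi> g x"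
    if "arr X Y f" "arr X Y g" "x \<in> carrier (F X)" for X Y f g x
    using F that unfolding linear_functor_def arr_def op_cat_simps by blast
  have Fsmult: "\<Phi> (a \<odot>\<^bsub>Hom C X Y\<^esub> f) x = a \<odot>\<^bsub>F Y\<^esub> \<Phi> f x"
    if "a \<in> carrier R" "arr X Y f" "x \<in> carrier (F X)" for X Y f a x
    using F that unfolding linear_functor_def arr_def op_cat_simps by blast
  have Fbd: "\<exists>n. \<forall>i. \<bar>i\<bar> > n \<longrightarrow> zero_module (F (Sho C i M))" if "M \<in> Ob C" for M
    using bounded that unfolding locally_bounded_def by simp
  have "\<forall>X\<in>Ob C. \<exists>\<iota>::'v \<Rightarrow> (nat \<Rightarrow> 'r) set. inj_on \<iota> (carrier (F X))"
    using fin_gen_module_encoding[OF mod fg] by metis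
  then obtain \<iota> :: "'o \<Rightarrow> 'v \<Rightarrow> (nat \<Rightarrow> 'r) set"
    where inj: "\<And>X. X \<in> Ob C \<Longrightarrow> inj_on (\<iota> X) (carrier (F X))"
    by metis
  define \<kappa> where "\<kappa> X = inv_into (carrier (F X)) (\<iota> X)" for X
  \<comment> \<open>A triangle of the opposite category may start at a point that is not an object although its
      shift is one; the values at such points are those at the object \<open>\<nu> X\<close> with the same shift.\<close>
  define \<nu> where "\<nu> X = Sho C 1 (Sho C (- 1) X)" for X
  have \<nu>: "\<nu> X = X" if "X \<in> Ob C" for X using that by (simp add: \<nu>_def sho_sho sho_0)
  define G where "G X = transport_module (\<iota> (\<nu> X)) (F (\<nu> X))" for X
  \<comment> \<open>The action on morphisms conjugates with the encodings of source and target; both are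
      determined by the morphism since hom sets are disjoint.\<close>
  define src where "src f = (SOME X. \<exists>Y. arr X Y f)" for f
  define tgt where "tgt f = (SOME Y. \<exists>X. arr X Y f)" for f
  define \<Psi> where "\<Psi> f x = \<iota> (tgt f) (\<Phi> f (\<kappa> (src f) x))" for f x
  have disj: "X = X' \<and> Y = Y'" if "arr X Y f" "arr X' Y' f" for X Y X' Y' f
    using that hom_disjoint by (auto simp: arr_def)
  have \<Psi>: "\<Psi> f x = \<iota> Y (\<Phi> f (\<kappa> X x))" if f: "arr X Y f" for f X Y x
  proof -
    have "src f = X" "tgt f = Y"
      unfolding src_def tgt_def using f disj by (blast intro!: some_equality)+
    then show ?thesis by (simp add: \<Psi>_def)
  qed
  have lin: "linear_map R (F X) (G X) (\<iota> X)" and linv: "linear_map R (G X) (F X) (\<kappa> X)"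
    and Gmod: "module R (G X)" and Gfg: "fin_gen_module R (G X)"
    and Gc: "carrier (G X) = \<iota> X ` carrier (F X)"
    and \<kappa>\<iota>: "\<And>x. x \<in> carrier (F X) \<Longrightarrow> \<kappa> X (\<iota> X x) = x"
    if "X \<in> Ob C" for X
    using transport_module_linear[OF mod[OF that] inj[OF that]]
      transport_module_inverse_linear[OF mod[OF that] inj[OF that]]
      transport_module_module[OF mod[OF that] inj[OF that]]
      fin_gen_transport_module[OF mod[OF that] inj[OF that] fg[OF that]] inj[OF that] \<nu>[OF that]
    by (auto simp: G_def \<kappa>_def transport_module_def)
  have G0: "\<zero>\<^bsub>G X\<^esub> = \<iota> (\<nu> X) \<zero>\<^bsub>F (\<nu> X)\<^esub>" for X by (simp add: G_def transport_module_def)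
  have F0: "\<zero>\<^bsub>F X\<^esub> \<in> carrier (F X)" if "X \<in> Ob C" for X
  proof -
    interpret module R "F X" by (rule mod[OF that])
    show ?thesis by simp
  qed
  have Fcl: "\<Phi> f x \<in> carrier (F Y)" if "arr X Y f" "x \<in> carrier (F X)" for X Y f x
    using linear_map_closed[OF Flin] that by blast
  have \<kappa>cl: "\<kappa> X x \<in> carrier (F X)" if "X \<in> Ob C" "x \<in> carrier (G X)" for X x
    using linear_map_closed[OF linv] that by blast
  have "linear_functor R (op_cat C) G \<Psi>"
    unfolding linear_functor_def op_cat_simps
  proof (intro conjI ballI)
    fix Y X f assume o: "Y \<in> Ob C" "X \<in> Ob C" and "f \<in> hom_set C X Y"
    then have f: "arr X Y f" by (simp add: arr_def)
    have "\<Psi> f = (\<lambda>x. \<iota> Y (\<Phi> f (\<kappa> X x)))" using \<Psi>[OF f] by auto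
    then show "linear_map R (G X) (G Y) (\<Psi> f)"
      using linear_map_compose[OF linear_map_compose[OF linv Flin] lin] o f by simp
  next
    fix X x assume X: "X \<in> Ob C" "x \<in> carrier (G X)"
    then show "\<Psi> (Idm C X) x = x"
      by (auto simp: \<Psi>[OF arr_id] Gc \<kappa>\<iota> Fid)
  next
    fix Z Y X g f x
    assume o: "Z \<in> Ob C" "Y \<in> Ob C" "X \<in> Ob C" and "f \<in> hom_set C X Y" and "g \<in> hom_set C Y Z"
      and x: "x \<in> carrier (G X)"
    then have f: "arr X Y f" and g: "arr Y Z g" by (auto simp: arr_def)
    show "\<Psi> (g \<cdot> f) x = \<Psi> g (\<Psi> f x)"
      using \<kappa>cl[OF o(3) x] Fcl[OF f \<kappa>cl[OF o(3) x]] o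
      by (simp add: \<Psi>[OF arr_cmp[OF f g]] \<Psi>[OF f] \<Psi>[OF g] \<kappa>\<iota> Fcmp[OF f g])
  next
    fix Y X f g x
    assume o: "Y \<in> Ob C" "X \<in> Ob C" and "f \<in> hom_set C X Y" and "g \<in> hom_set C X Y"
      and x: "x \<in> carrier (G X)"
    then have f: "arr X Y f" and g: "arr X Y g" by (auto simp: arr_def)
    show "\<Psi> (f \<oplus>\<^bsub>Hom C X Y\<^esub> g) x = \<Psi> f x \<oplus>\<^bsub>G Y\<^esub> \<Psi> g x"
      using \<kappa>cl[OF o(2) x] o Fcl[OF f] Fcl[OF g]
      by (simp add: \<Psi>[OF f] \<Psi>[OF g] \<Psi>[OF arr_add[OF f g]] Fadd[OF f g] linear_map_add[OF lin])
  next
    fix Y X a f x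
    assume o: "Y \<in> Ob C" "X \<in> Ob C" and "f \<in> hom_set C X Y" and a: "a \<in> carrier R"
      and x: "x \<in> carrier (G X)"
    then have f: "arr X Y f" by (auto simp: arr_def)
    show "\<Psi> (a \<odot>\<^bsub>Hom C X Y\<^esub> f) x = a \<odot>\<^bsub>G Y\<^esub> \<Psi> f x"
      using \<kappa>cl[OF o(2) x] o a Fcl[OF f]
      by (simp add: \<Psi>[OF f] \<Psi>[OF arr_smult[OF a f]] Fsmult[OF a f] linear_map_smult[OF lin])
  qed (rule Gmod)
  moreover have "cohomological (op_cat C) G \<Psi>"
    unfolding cohomological_def op_cat_simps
  proof (intro allI impI)
    fix X Y Z f g h assume T: "Tri C (Sho C (- 1) X) Z Y h g f"
    have rT: "\<exists>h'. Tri C Z Y (\<nu> X) g f h'" using tri_rotate[OF T] by (auto simp: \<nu>_def)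
    then have f: "arr Y (\<nu> X) f" and g: "arr Z Y g" using tri_arr by blast+
    have o: "\<nu> X \<in> Ob C" "Y \<in> Ob C" "Z \<in> Ob C" using f g by (auto simp: arr_def)
    have "(\<iota> (\<nu> X) (\<Phi> f y) = \<iota> (\<nu> X) \<zero>\<^bsub>F (\<nu> X)\<^esub>) \<longleftrightarrow> \<Phi> f y = \<zero>\<^bsub>F (\<nu> X)\<^esub>" if "y \<in> carrier (F Y)" for y
      using inj[OF o(1)] Fcl[OF f that] F0[OF o(1)] by (auto simp: inj_on_def)
    then have "{y \<in> carrier (G Y). \<Psi> f y = \<zero>\<^bsub>G X\<^esub>}
        = \<iota> Y ` {y \<in> carrier (F Y). \<Phi> f y = \<zero>\<^bsub>F (\<nu> X)\<^esub>}"
      using o by (auto simp: Gc G0 \<Psi>[OF f] \<kappa>\<iota>)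
    also have "{y \<in> carrier (F Y). \<Phi> f y = \<zero>\<^bsub>F (\<nu> X)\<^esub>} = \<Phi> g ` carrier (F Z)"
      using rT exact by blast
    also have "\<iota> Y ` \<Phi> g ` carrier (F Z) = \<Psi> g ` carrier (G Z)"
      using o by (auto simp: Gc \<Psi>[OF g] \<kappa>\<iota> image_image)
    finally show "{y \<in> carrier (G Y). \<Psi> f y = \<zero>\<^bsub>G X\<^esub>} = \<Psi> g ` carrier (G Z)" .
  qed
  moreover have "locally_bounded (op_cat C) G"
  proof -
    have "zero_module (F X) \<Longrightarrow> zero_module (G X)" if "X \<in> Ob C" for X
      using that by (auto simp: zero_module_def Gc G0 \<nu>)
    then have "\<exists>n. \<forall>i. \<bar>i\<bar> > n \<longrightarrow> zero_module (G (Sho C i M))" if "M \<in> Ob C" for M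
      using Fbd[OF that] sho_ob[OF that] by meson
    then show ?thesis by (simp add: locally_bounded_def)
  qed
  ultimately have "admissible_functor R (op_cat C) G \<Psi>"
    using Gfg by (simp add: admissible_functor_def)
  then obtain D where "represented_by R (op_cat C) G \<Psi> D"
    using sat unfolding R_saturated_def by blast
  then obtain \<eta> where D: "D \<in> Ob C"
    and \<eta>: "\<And>X. X \<in> Ob C \<Longrightarrow> linear_map R (Hom C D X) (G X) (\<eta> X)"
      "\<And>X. X \<in> Ob C \<Longrightarrow> bij_betw (\<eta> X) (hom_set C D X) (carrier (G X))"
    and nat: "\<And>Y X f x. \<lbrakk>Y \<in> Ob C; X \<in> Ob C; f \<in> hom_set C X Y; x \<in> hom_set C D X\<rbrakk>
      \<Longrightarrow> \<eta> Y (f \<cdot> x) = \<Psi> f (\<eta> X x)"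
    unfolding represented_by_def op_cat_simps by blast
  show ?thesis
  proof (intro bexI[OF _ D] exI[of _ "\<lambda>X x. \<kappa> X (\<eta> X x)"] conjI ballI allI impI)
    fix X assume X: "X \<in> Ob C"
    show "linear_map R (Hom C D X) (F X) (\<lambda>x. \<kappa> X (\<eta> X x))"
      by (rule linear_map_compose[OF \<eta>(1)[OF X] linv[OF X]])
    have "bij_betw (\<kappa> X) (carrier (G X)) (carrier (F X))"
      using bij_betw_inv_into[OF transport_module_bij[OF inj[OF X]]]
      by (simp add: \<kappa>_def G_def \<nu>[OF X])
    then show "bij_betw (\<lambda>x. \<kappa> X (\<eta> X x)) (hom_set C D X) (carrier (F X))"
      using bij_betw_trans[OF \<eta>(2)[OF X]] by (simp add: comp_def)
  next
    fix X Y f x assume f: "arr X Y f" and x: "arr D X x"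
    have o: "X \<in> Ob C" "Y \<in> Ob C" using f by (auto simp: arr_def)
    have c: "\<kappa> X (\<eta> X x) \<in> carrier (F X)"
      using \<eta>(2)[OF o(1)] x \<kappa>cl o(1) by (auto simp: bij_betw_def arr_def)
    show "\<kappa> Y (\<eta> Y (f \<cdot> x)) = \<Phi> f (\<kappa> X (\<eta> X x))"
      using f x o Fcl[OF f c] nat[of Y X f x] by (simp add: \<Psi>[OF f] \<kappa>\<iota> arr_def)
  qed
qed

lemma saturated_hom_fin_gen:
  assumes "R_saturated R (op_cat C)" "X \<in> Ob C" "Y \<in> Ob C"
  shows "fin_gen_module R (Hom C X Y)"
  using assms by (simp add: R_saturated_def admissible_functor_def)

lemma saturated_hom_bounded:
  assumes "R_saturated R (op_cat C)" "X \<in> Ob C" "Y \<in> Ob C"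
  shows "\<exists>n. \<forall>i. \<bar>i\<bar> > n \<longrightarrow> perp X (Sho C i Y)"
  using assms by (simp add: R_saturated_def admissible_functor_def locally_bounded_def perp_def sho_ob)

end

section \<open>Truncation in a t-structure\<close>

context linear_triangulated_category
begin

lemma shift_class_iff:
  assumes "D \<subseteq> Ob C"
  shows "X \<in> shift_class C n D \<longleftrightarrow> X \<in> Ob C \<and> Sho C (- n) X \<in> D"
proof
  assume "X \<in> shift_class C n D"
  then obtain Y where "Y \<in> D" "X = Sho C n Y" by (auto simp: shift_class_def)
  with assms show "X \<in> Ob C \<and> Sho C (- n) X \<in> D" by (auto simp: sho_ob sho_sho sho_0 subset_iff)
next
  assume X: "X \<in> Ob C \<and> Sho C (- n) X \<in> D"
  then have "X = Sho C n (Sho C (- n) X)" by (simp add: sho_sho sho_0)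
  with X show "X \<in> shift_class C n D" by (auto simp: shift_class_def)
qed

end

locale t_triangulated = linear_triangulated_category R C
  for R :: "('r, 'q) ring_scheme" (structure) and C :: "('r, 'o, 'm, 'z) tri_cat_scheme" +
  fixes A B :: "'o set"
  assumes t: "t_structure C A B"
begin

abbreviation ge where "ge n \<equiv> shift_class C n B"

abbreviation le where "le n \<equiv> shift_class C n A"

lemma AB_ob: "A \<subseteq> Ob C" "B \<subseteq> Ob C"
  using t by (auto simp: t_structure_def)

lemmas mem_ge_iff = shift_class_iff[OF AB_ob(2)]

lemmas mem_le_iff = shift_class_iff[OF AB_ob(1)]

lemma ge_0: "ge 0 = B" and le_0: "le 0 = A"
  using AB_ob by (auto simp: mem_ge_iff mem_le_iff sho_0 subset_iff)

lemma ge_ob: "X \<in> ge n \<Longrightarrow> X \<in> Ob C" and le_ob: "X \<in> le n \<Longrightarrow> X \<in> Ob C"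
  by (simp_all add: mem_ge_iff mem_le_iff)

lemma ge_shift: "X \<in> Ob C \<Longrightarrow> Sho C k X \<in> ge n \<longleftrightarrow> X \<in> ge (n - k)"
  by (simp add: mem_ge_iff sho_ob sho_sho)

lemma le_shift: "X \<in> Ob C \<Longrightarrow> Sho C k X \<in> le n \<longleftrightarrow> X \<in> le (n - k)"
  by (simp add: mem_le_iff sho_ob sho_sho)

lemma ge_antimono: "m \<le> n \<Longrightarrow> X \<in> ge n \<Longrightarrow> X \<in> ge m"
proof (induction n rule: int_ge_induct)
  case (step i)
  have "Sho C (- (i + 1)) X \<in> B" and X: "X \<in> Ob C" using step.prems by (auto simp: mem_ge_iff)
  then have "Sho C 1 (Sho C (- (i + 1)) X) \<in> B"
    using t by (auto simp: t_structure_def shift_class_def)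
  then have "X \<in> ge i" using X by (simp add: mem_ge_iff sho_sho)
  then show ?case by (rule step.IH)
qed

lemma le_mono: "m \<le> n \<Longrightarrow> X \<in> le m \<Longrightarrow> X \<in> le n"
proof (induction n rule: int_ge_induct)
  case (step i)
  have X: "X \<in> Ob C" "Sho C (- i) X \<in> A" using step by (auto simp: mem_le_iff)
  then have "Sho C (- i) X \<in> le 1" using t by (auto simp: t_structure_def)
  then show ?case using X by (simp add: mem_le_iff sho_sho algebra_simps)
qed

lemma perp_ge_le: "\<lbrakk>X \<in> ge n; Y \<in> le m; m < n\<rbrakk> \<Longrightarrow> perp X Y"
proof -
  assume X: "X \<in> ge n" and Y: "Y \<in> le m" and mn: "m < n"
  have o: "X \<in> Ob C" "Y \<in> Ob C" using X Y ge_ob le_ob by auto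
  have "X \<in> ge (m + 1)" using ge_antimono[OF _ X] mn by simp
  then have "Sho C (- m) X \<in> ge 1" using o by (simp add: ge_shift add.commute)
  moreover have "Sho C (- m) Y \<in> A" using Y by (simp add: mem_le_iff)
  ultimately have "perp (Sho C (- m) X) (Sho C (- m) Y)"
    using t o by (auto simp: t_structure_def orth_def perp_def sho_ob)
  then show ?thesis using perp_shift_iff[OF o] by simp
qed

lemma decomposition:
  assumes M: "M \<in> Ob C"
  obtains L N f g h where "Tri C L M N f g h" "L \<in> ge n" "N \<in> le (n - 1)"
proof -
  obtain L N where LN: "t_decomp C A B (Sho C (- n) M) L N"
    using t sho_ob[OF M] unfolding t_structure_def by blast
  then have T: "tri L (Sho C (- n) M) N" and L: "L \<in> ge 0" and N: "N \<in> le (- 1)"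
    by (auto simp: t_decomp_def tri_def ge_0)
  have "tri (Sho C n L) M (Sho C n N)"
    using tri_shift[OF T, of n] M by (simp add: sho_sho sho_0)
  moreover have "Sho C n L \<in> ge n" "Sho C n N \<in> le (n - 1)"
    using L N ge_ob[OF L] le_ob[OF N] by (simp_all add: ge_shift le_shift)
  ultimately show thesis using that by (auto simp: tri_def)
qed

lemma A_iso: "X \<in> A \<Longrightarrow> isomorphic C X Y \<Longrightarrow> Y \<in> A"
  using t unfolding t_structure_def iso_closed_def by blast

lemma B_iso: "X \<in> B \<Longrightarrow> isomorphic C X Y \<Longrightarrow> Y \<in> B"
  using t unfolding t_structure_def iso_closed_def by blast

lemma ge_iso: "X \<in> ge n \<Longrightarrow> isomorphic C X Y \<Longrightarrow> Y \<in> ge n"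
  using B_iso[OF _ isomorphic_shift] by (auto simp: mem_ge_iff isomorphic_def)

lemma le_iso: "X \<in> le n \<Longrightarrow> isomorphic C X Y \<Longrightarrow> Y \<in> le n"
  using A_iso[OF _ isomorphic_shift] by (auto simp: mem_le_iff isomorphic_def)

text \<open>
  If \<open>X\<close> has no maps to \<open>\<le> n-1\<close>, then the first map of its decomposition at level \<open>n\<close> is an isomorphism.
\<close>
lemma ge_iff_perp: "X \<in> ge n \<longleftrightarrow> X \<in> Ob C \<and> (\<forall>Y\<in>le (n - 1). perp X Y)"
proof
  assume X: "X \<in> Ob C \<and> (\<forall>Y\<in>le (n - 1). perp X Y)"
  obtain L N f g h where T: "Tri C L X N f g h" and L: "L \<in> ge n" and N: "N \<in> le (n - 1)"
    using decomposition X by blast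
  have N1: "Sho C (- 1) N \<in> le (n - 1)"
    using le_mono[OF _ N] le_ob[OF N] by (simp add: le_shift)
  have "iso_map C L X f"
    using X N by (intro iso_of_perp_cone[OF T]) (auto intro: perp_ge_le[OF L N1])
  then show "X \<in> ge n" using ge_iso[OF L] isomorphicI tri_ob[OF T] by blast
qed (auto intro: perp_ge_le ge_ob)

lemma le_iff_perp: "X \<in> le n \<longleftrightarrow> X \<in> Ob C \<and> (\<forall>Y\<in>ge (n + 1). perp Y X)"
proof
  assume X: "X \<in> Ob C \<and> (\<forall>Y\<in>ge (n + 1). perp Y X)"
  obtain L N f g h where T: "Tri C L X N f g h" and L: "L \<in> ge (n + 1)" and N: "N \<in> le n"
    using decomposition[of X "n + 1"] X by (metis add_diff_cancel_right')
  have L1: "Sho C 1 L \<in> ge (n + 1)"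
    using ge_antimono[OF _ L] ge_ob[OF L] by (simp add: ge_shift)
  have "iso_map C X N g"
    using X L by (intro iso_of_perp_cocone[OF T]) (auto intro: perp_ge_le[OF L1 N])
  then show "X \<in> le n" using le_iso[OF N] isomorphicI isomorphic_sym tri_ob[OF T] by blast
qed (auto intro: perp_ge_le le_ob)

lemma ge_middle: "tri X Y Z \<Longrightarrow> X \<in> ge n \<Longrightarrow> Z \<in> ge n \<Longrightarrow> Y \<in> ge n"
  using perp_middle_left unfolding tri_def ge_iff_perp by (meson tri_ob)

lemma le_middle: "tri X Y Z \<Longrightarrow> X \<in> le n \<Longrightarrow> Z \<in> le n \<Longrightarrow> Y \<in> le n"
  using perp_middle_right unfolding tri_def le_iff_perp by (meson tri_ob)

lemma ge_cone: "tri X Y Z \<Longrightarrow> X \<in> ge (n - 1) \<Longrightarrow> Y \<in> ge n \<Longrightarrow> Z \<in> ge n"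
  using ge_middle[OF tri_rot] ge_ob by (simp add: ge_shift)

lemma le_cone: "tri X Y Z \<Longrightarrow> X \<in> le (n - 1) \<Longrightarrow> Y \<in> le n \<Longrightarrow> Z \<in> le n"
  using le_middle[OF tri_rot] le_ob by (simp add: le_shift)

lemma le_cocone: "tri X Y Z \<Longrightarrow> Z \<in> le (n + 1) \<Longrightarrow> Y \<in> le n \<Longrightarrow> X \<in> le n"
  using le_middle[OF tri_unrot] le_ob by (simp add: le_shift)

lemma truncation_unique:
  assumes T: "tri L M N" "tri L' M N'" and L: "L \<in> ge n" "L' \<in> ge n"
    and N: "N \<in> le (n - 1)" "N' \<in> le (n - 1)"
  shows "isomorphic C N N'"
proof -
  have "Sho C 1 L \<in> ge n" "Sho C 1 L' \<in> ge n"
    using ge_antimono[of "n - 1" n] L ge_ob by (auto simp: ge_shift)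
  with L N show ?thesis
    using T unfolding tri_def by (auto intro!: reflection_unique intro: perp_ge_le)
qed

text \<open>
  Exactness of \<open>X \<mapsto> Hom(P, T X)\<close> in the middle term is where the hypothesis on the heart enters, as
  explained at the beginning. The element of \<open>Hom(P, T D)\<close> that corresponds to the identity of \<open>D\<close>
  is \<open>u\<close>; by naturality the isomorphism \<open>Hom(D, X) \<rightarrow> Hom(P, T X)\<close> is \<open>x \<mapsto> T x \<cdot> u\<close>. For \<open>X\<close> in \<open>\<le> 0\<close>,
  where \<open>X \<cong> T X\<close>, this says that precomposition with \<open>u\<close> is bijective; for \<open>X\<close> in \<open>\<ge> 1\<close>, where
  \<open>T X\<close> is zero, it says that \<open>D\<close> has no maps to \<open>X\<close>.
\<close>
lemma truncated_hom_corepresentable: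
  assumes sat: "R_saturated R (op_cat C)" and P: "P \<in> Ob C"
    and ext: "\<And>N. \<lbrakk>N \<in> le 0; N \<in> ge 0\<rbrakk> \<Longrightarrow> perp P (Sho C 1 N)"
    and bounded: "\<And>M. M \<in> Ob C \<Longrightarrow> \<exists>n. \<forall>i L N. \<bar>i\<bar> > n \<longrightarrow>
      tri L (Sho C i M) N \<longrightarrow> L \<in> ge 1 \<longrightarrow> N \<in> le 0 \<longrightarrow> perp P N"
  obtains D Q K u \<rho> where "tri K D Q" "K \<in> ge 1" "Q \<in> le 0" "arr D Q \<rho>" "arr P Q u"
    and "\<And>X. X \<in> ge 1 \<Longrightarrow> perp D X"
    and "\<And>X f. \<lbrakk>X \<in> le 0; arr D X f\<rbrakk> \<Longrightarrow> \<exists>!g. arr Q X g \<and> g \<cdot> \<rho> = f"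
    and "\<And>X f. \<lbrakk>X \<in> le 0; arr P X f\<rbrakk> \<Longrightarrow> \<exists>!g. arr Q X g \<and> g \<cdot> u = f"
proof -
  have "\<forall>X\<in>Ob C. \<exists>N \<rho> L k d. Tri C L X N k \<rho> d \<and> L \<in> ge 1 \<and> N \<in> le 0"
    using decomposition[of _ 1] by (metis diff_self)
  then obtain T \<rho> L k d where tr: "\<And>X. X \<in> Ob C \<Longrightarrow> Tri C (L X) X (T X) (k X) (\<rho> X) (d X)"
    and L: "\<And>X. X \<in> Ob C \<Longrightarrow> L X \<in> ge 1" and T: "\<And>X. X \<in> Ob C \<Longrightarrow> T X \<in> le 0"
    by metis
  have To: "T X \<in> Ob C" and \<rho>: "arr X (T X) (\<rho> X)" if "X \<in> Ob C" for X
    using tri_ob[OF tr[OF that]] tri_arr[OF tr[OF that]] by auto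
  have factor: "\<exists>b. arr (T X) W b \<and> b \<cdot> \<rho> X = a" if "arr X W a" "W \<in> le 0" for X W a
    using tri_extend[OF tr[OF arr_ob(1)[OF that(1)]] that(1)]
      perp_ge_le[OF L[OF arr_ob(1)[OF that(1)]] that(2)] by (metis zero_less_one)
  have uniq: "b = b'" if X: "X \<in> Ob C" and W: "W \<in> le 0" and b: "arr (T X) W b" "arr (T X) W b'"
    "b \<cdot> \<rho> X = b' \<cdot> \<rho> X" for X W b b'
  proof -
    have "Sho C 1 (L X) \<in> ge 1"
      using ge_antimono[OF _ L[OF X], of 0] ge_ob[OF L[OF X]] by (simp add: ge_shift)
    then show ?thesis using tri_epi2[OF tr[OF X] _ b] perp_ge_le[OF _ W] by simp
  qed
  have disj: "X = X' \<and> Y = Y'" if "arr X Y f" "arr X' Y' f" for X Y X' Y' f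
    using that hom_disjoint by (auto simp: arr_def)
  define Tm where "Tm f = (SOME b. \<exists>X Y. arr X Y f \<and> arr (T X) (T Y) b \<and> b \<cdot> \<rho> X = \<rho> Y \<cdot> f)" for f
  have Tm: "arr (T X) (T Y) (Tm f)" "Tm f \<cdot> \<rho> X = \<rho> Y \<cdot> f" if f: "arr X Y f" for X Y f
  proof -
    have Y: "Y \<in> Ob C" by (rule arr_ob(2)[OF f])
    have "\<exists>b. \<exists>X Y. arr X Y f \<and> arr (T X) (T Y) b \<and> b \<cdot> \<rho> X = \<rho> Y \<cdot> f"
      using factor[OF arr_cmp[OF f \<rho>[OF Y]] T[OF Y]] f by blast
    then have "\<exists>X Y. arr X Y f \<and> arr (T X) (T Y) (Tm f) \<and> Tm f \<cdot> \<rho> X = \<rho> Y \<cdot> f"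
      unfolding Tm_def by (rule someI_ex)
    then show "arr (T X) (T Y) (Tm f)" "Tm f \<cdot> \<rho> X = \<rho> Y \<cdot> f" using disj[OF f] by blast+
  qed
  have Tm_eq: "Tm f = b" if f: "arr X Y f" and b: "arr (T X) (T Y) b" "b \<cdot> \<rho> X = \<rho> Y \<cdot> f" for X Y f b
    using uniq[OF arr_ob(1)[OF f] T[OF arr_ob(2)[OF f]] Tm(1)[OF f] b(1)] Tm(2)[OF f] b(2) by simp
  have Tm_id: "Tm (Idm C X) = Idm C (T X)" if "X \<in> Ob C" for X
    using \<rho>[OF that] by (intro Tm_eq[OF arr_id[OF that] arr_id[OF To[OF that]]]) (simp add: id_left id_right)
  have Tm_cmp: "Tm (g \<cdot> f) = Tm g \<cdot> Tm f" if f: "arr X Y f" and g: "arr Y Z g" for X Y Z f g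
  proof (rule Tm_eq[OF arr_cmp[OF f g] arr_cmp[OF Tm(1)[OF f] Tm(1)[OF g]]])
    note r = \<rho>[OF arr_ob(1)[OF f]] \<rho>[OF arr_ob(2)[OF f]] \<rho>[OF arr_ob(2)[OF g]]
    have "(Tm g \<cdot> Tm f) \<cdot> \<rho> X = Tm g \<cdot> (Tm f \<cdot> \<rho> X)"
      using assoc[OF r(1) Tm(1)[OF f] Tm(1)[OF g]] by simp
    also have "\<dots> = (Tm g \<cdot> \<rho> Y) \<cdot> f"
      using assoc[OF f r(2) Tm(1)[OF g]] by (simp add: Tm(2)[OF f])
    also have "\<dots> = \<rho> Z \<cdot> (g \<cdot> f)"
      using assoc[OF f g r(3)] by (simp add: Tm(2)[OF g])
    finally show "(Tm g \<cdot> Tm f) \<cdot> \<rho> X = \<rho> Z \<cdot> (g \<cdot> f)" .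
  qed
  have Tm_add: "Tm (f \<oplus>\<^bsub>Hom C X Y\<^esub> g) = Tm f \<oplus>\<^bsub>Hom C (T X) (T Y)\<^esub> Tm g"
    if f: "arr X Y f" and g: "arr X Y g" for X Y f g
    using \<rho>[OF arr_ob(1)[OF f]] \<rho>[OF arr_ob(2)[OF f]] Tm[OF f] Tm[OF g] f g
    by (intro Tm_eq[OF arr_add[OF f g]]) (simp_all add: arr_add cmp_add_left cmp_add_right)
  have Tm_smult: "Tm (a \<odot>\<^bsub>Hom C X Y\<^esub> f) = a \<odot>\<^bsub>Hom C (T X) (T Y)\<^esub> Tm f"
    if a: "a \<in> carrier R" and f: "arr X Y f" for X Y f a
    using \<rho>[OF arr_ob(1)[OF f]] \<rho>[OF arr_ob(2)[OF f]] Tm[OF f] f a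
    by (intro Tm_eq[OF arr_smult[OF a f]]) (simp_all add: arr_smult cmp_smult_left cmp_smult_right)
  let ?F = "\<lambda>X. Hom C P (T X)" and ?\<Phi> = "\<lambda>f x. Tm f \<cdot> x"
  have pa: "x \<in> hom_set C P (T X) \<Longrightarrow> X \<in> Ob C \<Longrightarrow> arr P (T X) x" for x X
    using P To by (simp add: arr_def)
  have lf: "linear_functor R (op_cat C) ?F ?\<Phi>"
    unfolding linear_functor_def op_cat_simps
  proof (intro conjI ballI)
    fix X assume "X \<in> Ob C"
    then show "module R (Hom C P (T X))" using hom_module P To by simp
  next
    fix Y X f assume o: "Y \<in> Ob C" "X \<in> Ob C" and "f \<in> hom_set C X Y"
    then have f: "arr X Y f" by (simp add: arr_def)
    show "linear_map R (Hom C P (T X)) (Hom C P (T Y)) (\<lambda>x. Tm f \<cdot> x)"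
      using cmp_linear_right[OF P To[OF o(2)] To[OF o(1)]] Tm(1)[OF f] by (simp add: arr_def)
  next
    fix X x assume "X \<in> Ob C" "x \<in> hom_set C P (T X)"
    then show "Tm (Idm C X) \<cdot> x = x" using id_left[OF pa] Tm_id by simp
  next
    fix Z Y X g f x
    assume o: "Z \<in> Ob C" "Y \<in> Ob C" "X \<in> Ob C" and "f \<in> hom_set C X Y" and "g \<in> hom_set C Y Z"
      and x: "x \<in> hom_set C P (T X)"
    then have f: "arr X Y f" and g: "arr Y Z g" by (auto simp: arr_def)
    show "Tm (g \<cdot> f) \<cdot> x = Tm g \<cdot> (Tm f \<cdot> x)"
      using assoc[OF pa[OF x o(3)] Tm(1)[OF f] Tm(1)[OF g]] Tm_cmp[OF f g] by simp
  next
    fix Y X f g x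
    assume o: "Y \<in> Ob C" "X \<in> Ob C" and "f \<in> hom_set C X Y" and "g \<in> hom_set C X Y"
      and x: "x \<in> hom_set C P (T X)"
    then have f: "arr X Y f" and g: "arr X Y g" by (auto simp: arr_def)
    show "Tm (f \<oplus>\<^bsub>Hom C X Y\<^esub> g) \<cdot> x = Tm f \<cdot> x \<oplus>\<^bsub>Hom C P (T Y)\<^esub> Tm g \<cdot> x"
      using cmp_add_left[OF pa[OF x o(2)] Tm(1)[OF f] Tm(1)[OF g]] Tm_add[OF f g] by simp
  next
    fix Y X a f x
    assume o: "Y \<in> Ob C" "X \<in> Ob C" and "f \<in> hom_set C X Y" and a: "a \<in> carrier R"
      and x: "x \<in> hom_set C P (T X)"
    then have f: "arr X Y f" by (auto simp: arr_def)
    show "Tm (a \<odot>\<^bsub>Hom C X Y\<^esub> f) \<cdot> x = a \<odot>\<^bsub>Hom C P (T Y)\<^esub> (Tm f \<cdot> x)"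
      using cmp_smult_left[OF pa[OF x o(2)] Tm(1)[OF f] a] Tm_smult[OF a f] by simp
  qed
  have exact: "{y \<in> hom_set C P (T Y). Tm b \<cdot> y = zm P (T Z)} = (\<lambda>x. Tm a \<cdot> x) ` hom_set C P (T X)"
    if XYZ: "Tri C X Y Z a b c" for X Y Z a b c
  proof -
    note o = tri_ob[OF XYZ] and m = tri_arr[OF XYZ]
    note r = \<rho>[OF o(1)] \<rho>[OF o(2)] \<rho>[OF o(3)] and Ta = Tm[OF m(1)] and Tb = Tm[OF m(2)]
    have "Tm b \<cdot> (Tm a \<cdot> x) = zm P (T Z)" if x: "arr P (T X) x" for x
    proof -
      have "zm (T X) (T Z) \<cdot> \<rho> X = \<rho> Z \<cdot> zm X Z"
        using cmp_zm_left[OF r(1) To[OF o(3)]] cmp_zm_right[OF o(1) r(3)] by simp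
      then have "Tm (zm X Z) = zm (T X) (T Z)"
        by (intro Tm_eq[OF arr_zm[OF o(1,3)] arr_zm[OF To[OF o(1)] To[OF o(3)]]])
      then have "Tm b \<cdot> Tm a = zm (T X) (T Z)"
        using Tm_cmp[OF m(1,2)] tri_comp_zero[OF XYZ] by simp
      then show ?thesis
        using assoc[OF x Ta(1) Tb(1)] cmp_zm_left[OF x To[OF o(3)]] by simp
    qed
    moreover have "\<exists>x. arr P (T X) x \<and> Tm a \<cdot> x = y"
      if y: "arr P (T Y) y" and zero: "Tm b \<cdot> y = zm P (T Z)" for y
    proof -
      obtain W g h where TW: "Tri C (T X) (T Y) W (Tm a) g h"
        using TR1_cone[of "T X" "T Y" "Tm a"] Ta(1) by (auto simp: arr_def)
      note oW = tri_ob[OF TW] and mW = tri_arr[OF TW]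
      have "\<exists>e\<in>hom_set C Z W. e \<cdot> b = g \<cdot> \<rho> Y \<and> Shm C 1 (\<rho> X) \<cdot> c = h \<cdot> e"
        using r Ta(2) by (intro TR3[OF XYZ TW]) (auto simp: arr_def)
      then obtain e where e: "arr Z W e" "e \<cdot> b = g \<cdot> \<rho> Y" using o oW by (auto simp: arr_def)
      \<comment> \<open>The truncation of the cone \<open>W\<close> only removes the shift by one of an object of the heart,
          which is invisible to \<open>P\<close>.\<close>
      have W1: "W \<in> le 1"
        using le_cone[OF triI[OF TW], of 1] T[OF o(1)] le_mono[OF _ T[OF o(2)], of 1] by simp
      have LW: "L W \<in> le 1"
        using le_cocone[OF triI[OF tr[OF oW(3)]] le_mono[OF _ T[OF oW(3)]] W1] by simp
      have oL: "L W \<in> Ob C" by (rule le_ob[OF LW])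
      have "Sho C 1 (Sho C (- 1) (L W)) = L W" using oL by (simp add: sho_sho sho_0)
      moreover have "perp P (Sho C 1 (Sho C (- 1) (L W)))"
        using LW L[OF oW(3)] oL by (intro ext) (simp_all add: le_shift ge_shift)
      ultimately have PL: "perp P (L W)" by simp
      note rW = \<rho>[OF oW(3)]
      obtain s where s: "arr (T Z) (T W) s" "s \<cdot> \<rho> Z = \<rho> W \<cdot> e"
        using Tm[OF e(1)] by blast
      have "(s \<cdot> Tm b) \<cdot> \<rho> Y = s \<cdot> (\<rho> Z \<cdot> b)"
        using assoc[OF r(2) Tb(1) s(1)] Tb(2) by simp
      also have "\<dots> = (\<rho> W \<cdot> e) \<cdot> b" using assoc[OF m(2) r(3) s(1)] s(2) by simp
      also have "\<dots> = \<rho> W \<cdot> (g \<cdot> \<rho> Y)" using assoc[OF m(2) e(1) rW] e(2) by simp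
      also have "\<dots> = (\<rho> W \<cdot> g) \<cdot> \<rho> Y" by (rule assoc[OF r(2) mW(2) rW])
      finally have "s \<cdot> Tm b = \<rho> W \<cdot> g"
        by (rule uniq[OF o(2) T[OF oW(3)] arr_cmp[OF Tb(1) s(1)] arr_cmp[OF mW(2) rW]])
      then have "\<rho> W \<cdot> (g \<cdot> y) = s \<cdot> (Tm b \<cdot> y)"
        using assoc[OF y mW(2) rW] assoc[OF y Tb(1) s(1)] by simp
      also have "\<dots> = \<rho> W \<cdot> zm P W"
        using zero cmp_zm_right[OF P s(1)] cmp_zm_right[OF P rW] by simp
      finally have "g \<cdot> y = zm P W"
        by (rule tri_mono2[OF tr[OF oW(3)] PL arr_cmp[OF y mW(2)] arr_zm[OF P oW(3)]])
      then show ?thesis using tri_weak_kernel[OF TW y] by blast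
    qed
    ultimately show ?thesis
      using P To[OF o(1)] To[OF o(2)] arr_cmp[OF _ Ta(1)] by (fastforce simp: arr_def)
  qed
  have lb: "locally_bounded (op_cat C) ?F"
    unfolding locally_bounded_def
  proof
    fix M assume "M \<in> Ob (op_cat C)"
    then have M: "M \<in> Ob C" by simp
    obtain n where n: "\<forall>i L N. \<bar>i\<bar> > n \<longrightarrow>
      tri L (Sho C i M) N \<longrightarrow> L \<in> ge 1 \<longrightarrow> N \<in> le 0 \<longrightarrow> perp P N" using bounded[OF M] by blast
    have "zero_module (Hom C P (T (Sho C i M)))" if "\<bar>i\<bar> > n" for i
      using n that triI[OF tr[OF sho_ob[OF M]]] L[OF sho_ob[OF M]] T[OF sho_ob[OF M]]
      unfolding perp_def by blast
    then show "\<exists>n. \<forall>i. n < \<bar>i\<bar> \<longrightarrow> zero_module (Hom C P (T (Sho (op_cat C) (- i) M)))"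
      by auto
  qed
  have fg: "fin_gen_module R (Hom C P (T X))" if "X \<in> Ob C" for X
    using saturated_hom_fin_gen[OF sat P To[OF that]] .
  have "\<exists>D\<in>Ob C. \<exists>\<eta>.
    (\<forall>X\<in>Ob C. linear_map R (Hom C D X) (?F X) (\<eta> X) \<and>
      bij_betw (\<eta> X) (hom_set C D X) (carrier (?F X))) \<and>
    (\<forall>X Y f x. arr X Y f \<longrightarrow> arr D X x \<longrightarrow> \<eta> Y (f \<cdot> x) = ?\<Phi> f (\<eta> X x))"
    by (rule homological_corepresentable[OF sat lf exact lb fg])
  then obtain D \<eta> where D: "D \<in> Ob C"
    and \<eta>: "\<And>X. X \<in> Ob C \<Longrightarrow> bij_betw (\<eta> X) (hom_set C D X) (hom_set C P (T X))"
    and nat: "\<And>X Y f x. arr X Y f \<Longrightarrow> arr D X x \<Longrightarrow> \<eta> Y (f \<cdot> x) = Tm f \<cdot> \<eta> X x"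
    by blast
  have \<eta>_inj: "x = y" if "arr D X x" "arr D X y" "\<eta> X x = \<eta> X y" for X x y
  proof -
    have "X \<in> Ob C" and x: "x \<in> hom_set C D X" "y \<in> hom_set C D X" using that by (auto simp: arr_def)
    then show ?thesis using inj_onD[OF bij_betw_imp_inj_on[OF \<eta>] that(3)] by blast
  qed
  have \<eta>_surj: "\<exists>x. arr D X x \<and> \<eta> X x = y" if "arr P (T X) y" "X \<in> Ob C" for X y
  proof -
    have "y \<in> \<eta> X ` hom_set C D X"
      using bij_betw_imp_surj_on[OF \<eta>[OF that(2)]] that(1) by (simp add: arr_def)
    then show ?thesis using D that(2) by (auto simp: arr_def)
  qed
  have \<eta>_arr: "arr P (T X) (\<eta> X x)" if "arr D X x" for X x
    using bij_betw_apply[OF \<eta>[OF arr_ob(2)[OF that]]] that P To by (auto simp: arr_def)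
  define u where "u = \<eta> D (Idm C D)"
  have u: "arr P (T D) u"
    unfolding u_def by (rule \<eta>_arr[OF arr_id[OF D]])
  have \<eta>_u: "\<eta> X x = Tm x \<cdot> u" if "arr D X x" for X x
    using nat[OF that arr_id[OF D]] id_right[OF that] by (simp add: u_def)
  note rD = \<rho>[OF D]
  show thesis
  proof (rule that[OF triI[OF tr[OF D]] L[OF D] T[OF D] rD u])
    fix X assume X: "X \<in> ge 1"
    have oX: "X \<in> Ob C" by (rule ge_ob[OF X])
    note rX = \<rho>[OF oX] and oT = To[OF oX]
    have "\<rho> X = zm X (T X)" using perpD[OF perp_ge_le[OF X T[OF oX]] rX] by simp
    then have "Idm C (T X) \<cdot> \<rho> X = zm (T X) (T X) \<cdot> \<rho> X"
      using id_left[OF rX] cmp_zm_left[OF rX oT] by simp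
    then have "Idm C (T X) = zm (T X) (T X)"
      by (rule uniq[OF oX T[OF oX] arr_id[OF oT] arr_zm[OF oT oT]])
    then have "y = zm P (T X)" if "arr P (T X) y" for y
      using id_left[OF that] cmp_zm_left[OF that oT] by simp
    then have "\<eta> X x = \<eta> X (zm D X)" if "arr D X x" for x
      using \<eta>_arr[OF that] \<eta>_arr[OF arr_zm[OF D oX]] by metis
    then show "perp D X"
      using \<eta>_inj[OF _ arr_zm[OF D oX]] by (intro perpI[OF D oX]) blast
  next
    fix X f assume X: "X \<in> le 0" and f: "arr D X f"
    show "\<exists>!g. arr (T D) X g \<and> g \<cdot> \<rho> D = f"
      using factor[OF f X] uniq[OF D X] by metis
  next
    fix X f assume X: "X \<in> le 0" and f: "arr P X f"
    have oX: "X \<in> Ob C" by (rule le_ob[OF X])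
    note rX = \<rho>[OF oX]
    have lift: "\<exists>x. arr D X x \<and> x = g \<cdot> \<rho> D \<and> \<eta> X x = \<rho> X \<cdot> (g \<cdot> u)" if g: "arr (T D) X g" for g
    proof -
      have x: "arr D X (g \<cdot> \<rho> D)" by (rule arr_cmp[OF rD g])
      have "Tm (g \<cdot> \<rho> D) = \<rho> X \<cdot> g"
        by (rule Tm_eq[OF x arr_cmp[OF g rX]]) (simp add: assoc[OF rD g rX])
      then have "\<eta> X (g \<cdot> \<rho> D) = \<rho> X \<cdot> (g \<cdot> u)" using \<eta>_u[OF x] assoc[OF u g rX] by simp
      with x show ?thesis by blast
    qed
    have mono: "a = b" if "arr P X a" "arr P X b" "\<rho> X \<cdot> a = \<rho> X \<cdot> b" for a b
    proof -
      obtain s where s: "arr (T X) X s" "s \<cdot> \<rho> X = Idm C X" using factor[OF arr_id[OF oX] X] by blast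
      show ?thesis
        using assoc[OF that(1) rX s(1)] assoc[OF that(2) rX s(1)] that(3) s(2)
          id_left[OF that(1)] id_left[OF that(2)] by metis
    qed
    obtain x where x: "arr D X x" "\<eta> X x = \<rho> X \<cdot> f" using \<eta>_surj[OF arr_cmp[OF f rX] oX] by blast
    obtain g where g: "arr (T D) X g" "g \<cdot> \<rho> D = x" using factor[OF x(1) X] by blast
    have gu: "g \<cdot> u = f" using lift[OF g(1)] x(2) g(2) mono[OF arr_cmp[OF u g(1)] f] by simp
    moreover have "g' = g" if g': "arr (T D) X g'" "g' \<cdot> u = f" for g'
      using lift[OF g'(1)] lift[OF g(1)] g'(2) gu \<eta>_inj uniq[OF D X g'(1) g(1)] by metis
    ultimately show "\<exists>!g. arr (T D) X g \<and> g \<cdot> u = f" using g(1) by metis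
  qed
qed

end

section \<open>The heart and lifts of its projective objects\<close>

lemma t_heart_simps [simp]:
  "Ob (t_heart C A B) = A \<inter> B" "Hom (t_heart C A B) = Hom C"
  "Idm (t_heart C A B) = Idm C" "Cmp (t_heart C A B) = Cmp C"
  by (simp_all add: t_heart_def full_subcat_def)

context t_triangulated
begin

lemma heart_iff: "X \<in> Ob (t_heart C A B) \<longleftrightarrow> X \<in> le 0 \<and> X \<in> ge 0"
  by (simp add: ge_0 le_0)

lemma isomorphic_heart:
  assumes "isomorphic C X Y" and "X \<in> le 0" "X \<in> ge 0"
  shows "isomorphic (t_heart C A B) X Y"
  using assms le_iso[OF assms(2,1)] ge_iso[OF assms(3,1)]
  by (simp add: isomorphic_def iso_map_def ge_0 le_0)

lemma perp_heart_zero: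
  assumes H: "zero_obj (t_heart C A B) H" and W: "W \<in> Ob C"
  shows "perp H W"
proof -
  have oH: "H \<in> Ob C" and "hom_set C H H = {zm H H}"
    using H AB_ob by (auto simp: zero_obj_def zero_module_def)
  then have id0: "Idm C H = zm H H" using id_hom[OF oH] by simp
  show ?thesis
  proof (rule perpI[OF oH W])
    fix f assume f: "arr H W f"
    then show "f = zm H W" using id_right[OF f] cmp_zm_right[OF oH f] id0 by simp
  qed
qed

lemma epi_map_heart_iff:
  "epi_map (t_heart C A B) X Y e \<longleftrightarrow> X \<in> le 0 \<and> X \<in> ge 0 \<and> Y \<in> le 0 \<and> Y \<in> ge 0 \<and> arr X Y e \<and>
    (\<forall>Z g h. Z \<in> le 0 \<longrightarrow> Z \<in> ge 0 \<longrightarrow> arr Y Z g \<longrightarrow> arr Y Z h \<longrightarrow> g \<cdot> e = h \<cdot> e \<longrightarrow> g = h)"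
  unfolding epi_map_def using AB_ob by (auto simp: arr_def ge_0 le_0 subset_iff)

lemma epi_map_heart_comp:
  assumes f: "epi_map (t_heart C A B) X Y f" and g: "epi_map (t_heart C A B) Y Z g"
  shows "epi_map (t_heart C A B) X Z (g \<cdot> f)"
  unfolding epi_map_heart_iff
proof (intro conjI allI impI)
  have af: "arr X Y f" and ag: "arr Y Z g" using f g by (auto simp: epi_map_heart_iff)
  then show "arr X Z (g \<cdot> f)" by (rule arr_cmp)
  fix W a b assume W: "W \<in> le 0" "W \<in> ge 0" and a: "arr Z W a" "arr Z W b" "a \<cdot> (g \<cdot> f) = b \<cdot> (g \<cdot> f)"
  have "(a \<cdot> g) \<cdot> f = (b \<cdot> g) \<cdot> f" using assoc[OF af ag a(1)] assoc[OF af ag a(2)] a(3) by simp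
  then have "a \<cdot> g = b \<cdot> g"
    using f W arr_cmp[OF ag a(1)] arr_cmp[OF ag a(2)] unfolding epi_map_heart_iff by blast
  then show "a = b" using g W a unfolding epi_map_heart_iff by blast
qed (use f g in \<open>auto simp: epi_map_heart_iff\<close>)

lemma t_chosen:
  assumes "M \<in> Ob C"
  shows "tri (t_L C A B M) M (t_R C A B M)" "t_L C A B M \<in> ge 0" "t_R C A B M \<in> le (- 1)"
proof -
  have "\<exists>p. t_decomp C A B M (fst p) (snd p)"
    using t assms unfolding t_structure_def by auto
  then have "t_decomp C A B M (t_L C A B M) (t_R C A B M)"
    unfolding t_L_def t_R_def t_chosen_def by (rule someI_ex)
  then show "tri (t_L C A B M) M (t_R C A B M)" "t_L C A B M \<in> ge 0" "t_R C A B M \<in> le (- 1)"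
    by (auto simp: t_decomp_def tri_def ge_0)
qed

text \<open>
  The two truncation triangles from which \<open>t_H0\<close> is built.
\<close>
lemma H0_triangles:
  assumes M: "M \<in> Ob C"
  obtains L N K where "tri L M N" "L \<in> ge 0" "N \<in> le (- 1)"
    and "tri K L (t_H0 C A B M)" "K \<in> ge 1" "t_H0 C A B M \<in> le 0" "t_H0 C A B M \<in> ge 0"
proof -
  let ?L = "t_L C A B M"
  note L = t_chosen[OF M]
  have oL: "?L \<in> Ob C" by (rule ge_ob[OF L(2)])
  let ?M = "Sho C (- 1) ?L"
  note K = t_chosen[OF sho_ob[OF oL], of "- 1"]
  have H: "t_H0 C A B M = Sho C 1 (t_R C A B ?M)"
    by (simp add: t_H0_def t_le0_def t_ge0_def)
  have T: "tri (Sho C 1 (t_L C A B ?M)) ?L (t_H0 C A B M)"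
    using tri_shift[OF K(1), of 1] oL by (simp add: H sho_sho sho_0)
  have K1: "Sho C 1 (t_L C A B ?M) \<in> ge 1" using K(2) ge_ob[OF K(2)] by (simp add: ge_shift)
  have "t_H0 C A B M \<in> le 0" using K(3) le_ob[OF K(3)] by (simp add: H le_shift)
  moreover have "t_H0 C A B M \<in> ge 0"
    using ge_cone[OF T, of 0] ge_antimono[OF _ K1] L(2) by simp
  ultimately show thesis using that L T K1 by blast
qed

text \<open>
  The first truncation does not change an object of \<open>\<ge> 0\<close>.
\<close>
lemma H0_of_ge:
  assumes M: "M \<in> ge 0"
  obtains K where "tri K M (t_H0 C A B M)" "K \<in> ge 1"
proof -
  obtain L N K where LN: "tri L M N" "L \<in> ge 0" "N \<in> le (- 1)"
    and K: "tri K L (t_H0 C A B M)" "K \<in> ge 1"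
    using H0_triangles[OF ge_ob[OF M]] by metis
  obtain f g h where T: "Tri C L M N f g h" using LN(1) by (auto simp: tri_def)
  have "Sho C (- 1) N \<in> le (- 1)" using le_mono[OF _ LN(3), of 0] le_ob[OF LN(3)] by (simp add: le_shift)
  then have "iso_map C L M f"
    using perp_ge_le[OF M LN(3)] perp_ge_le[OF LN(2)] by (intro iso_of_perp_cone[OF T]) auto
  then have "isomorphic C L M" using isomorphicI tri_ob[OF T] by blast
  then show thesis using that tri_iso_middle[OF K(1)] K(2) by blast
qed

lemma H0_unique:
  assumes "M \<in> ge 0" "tri L M N" "L \<in> ge 1" "N \<in> le 0"
  shows "isomorphic C N (t_H0 C A B M)"
proof -
  obtain K where K: "tri K M (t_H0 C A B M)" "K \<in> ge 1" using H0_of_ge[OF assms(1)] .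
  have "t_H0 C A B M \<in> le 0" using H0_triangles[OF ge_ob[OF assms(1)]] by metis
  then show ?thesis using truncation_unique[OF assms(2) K(1) assms(3) K(2)] assms(4) by simp
qed

text \<open>
  A vanishing \<open>H_i\<close> leaves a gap: the truncation of \<open>M\<close> to \<open>\<ge> i\<close> already lies in \<open>\<ge> i+1\<close>.
\<close>
lemma H_zero_decomposition:
  assumes M: "M \<in> Ob C" and H: "zero_obj (t_heart C A B) (t_H C A B i M)"
  obtains L N where "tri L M N" "L \<in> ge (i + 1)" "N \<in> le (i - 1)"
proof -
  let ?M = "Sho C (- i) M"
  obtain L N K where LN: "tri L ?M N" "L \<in> ge 0" "N \<in> le (- 1)"
    and K: "tri K L (t_H0 C A B ?M)" "K \<in> ge 1"
    using H0_triangles[OF sho_ob[OF M]] by metis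
  have "perp L Y" if "Y \<in> le 0" for Y
    using K(1) perp_ge_le[OF K(2) that] perp_heart_zero[OF H le_ob[OF that]]
    unfolding tri_def by (auto simp: t_H_def intro: perp_middle_left)
  then have L1: "L \<in> ge 1" using ge_ob[OF LN(2)] by (simp add: ge_iff_perp)
  have "tri (Sho C i L) M (Sho C i N)"
    using tri_shift[OF LN(1), of i] M by (simp add: sho_sho sho_0)
  moreover have "Sho C i L \<in> ge (i + 1)" "Sho C i N \<in> le (i - 1)"
    using L1 LN(3) ge_ob[OF L1] le_ob[OF LN(3)] by (auto simp: ge_shift le_shift)
  ultimately show thesis by (rule that)
qed

text \<open>
  The cocone \<open>E\<close> of a map \<open>f : P \<rightarrow> N[1]\<close> is an extension of \<open>P\<close> by \<open>N\<close>, hence in the heart, and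
  \<open>E \<rightarrow> P\<close> is an epimorphism there because \<open>N[1]\<close> has no maps to the heart. It splits by
  projectivity, and \<open>f\<close> vanishes on \<open>E\<close>.
\<close>
lemma projective_perp:
  assumes P: "projective_obj (t_heart C A B) P" and N: "N \<in> le 0" "N \<in> ge 0"
  shows "perp P (Sho C 1 N)"
proof -
  let ?N = "Sho C 1 N"
  have P0: "P \<in> le 0" "P \<in> ge 0" using P by (auto simp: projective_obj_def ge_0 le_0)
  have oN: "N \<in> Ob C" "?N \<in> Ob C" and oP: "P \<in> Ob C" using N(1) P0(1) le_ob sho_ob by auto
  show ?thesis
  proof (rule perpI[OF oP oN(2)])
    fix f assume f: "arr P ?N f"
    obtain Z g h where "Tri C P ?N Z f g h" using TR1_cone[of P ?N f] f unfolding arr_def by blast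
    then obtain p where T: "Tri C (Sho C (- 1) Z) P ?N p f g" using tri_unrotate by blast
    let ?E = "Sho C (- 1) Z"
    note o = tri_ob[OF T] and m = tri_arr[OF T]
    have "tri N ?E P" using tri_unrot[OF triI[OF T]] oN by (simp add: sho_sho sho_0)
    then have E: "?E \<in> le 0" "?E \<in> ge 0" using le_middle ge_middle N P0 by blast+
    have "epi_map (t_heart C A B) ?E P p"
      unfolding epi_map_def
    proof (intro conjI ballI impI)
      fix W a b assume W: "W \<in> Ob (t_heart C A B)" and "a \<in> hom_set (t_heart C A B) P W"
        "b \<in> hom_set (t_heart C A B) P W"
        and "Cmp (t_heart C A B) a p = Cmp (t_heart C A B) b p"
      then have ab: "arr P W a" "arr P W b" "a \<cdot> p = b \<cdot> p"
        using AB_ob oP by (auto simp: arr_def)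
      have "W \<in> le 0" using W by (simp add: le_0)
      moreover have "?N \<in> ge 1" using N(2) oN by (simp add: ge_shift)
      ultimately show "a = b" using tri_epi1[OF T _ ab] perp_ge_le by simp
    qed (use E P0 m in \<open>auto simp: ge_0 le_0 arr_def\<close>)
    then obtain s where s: "arr P ?E s" "p \<cdot> s = Idm C P"
      using P id_hom[OF oP] oP o(1) unfolding projective_obj_def t_heart_simps arr_def by blast
    have "f = (f \<cdot> p) \<cdot> s" using assoc[OF s(1) m(1) f] s(2) id_right[OF f] by simp
    then show "f = zm P ?N" using tri_comp_zero[OF T] cmp_zm_left[OF s(1) oN(2)] by simp
  qed
qed

lemma t_P_iff:
  "D \<in> t_P C A B \<longleftrightarrow> D \<in> Ob C \<and> (\<forall>Y\<in>le (- 1). perp D Y) \<and> (\<forall>Y\<in>ge 1. perp D Y)"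
  using ge_ob le_ob by (auto simp: t_P_def left_orth_def orth_def perp_def)

text \<open>
  Local boundedness holds since \<open>T (M[i])\<close> lies in \<open>\<le> -1\<close> as soon as \<open>H_{-i}(M)\<close> is zero. The object \<open>Q\<close>
  below is \<open>T D\<close>: it lies in the heart and represents the same functor there as \<open>P\<close>, so it is
  isomorphic to \<open>P\<close>, and as \<open>D\<close> lies in \<open>\<ge> 0\<close> it is also isomorphic to \<open>H_0(D)\<close>.
\<close>
theorem projectives_lift:
  assumes sat: "R_saturated R (op_cat C)" and bounded: "t_ess_bounded C A B"
    and P: "projective_obj (t_heart C A B) P"
  shows "\<exists>D\<in>t_P C A B. isomorphic (t_heart C A B) (t_H0 C A B D) P"
proof -
  have P0: "P \<in> le 0" "P \<in> ge 0" using P by (auto simp: projective_obj_def ge_0 le_0)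
  have oP: "P \<in> Ob C" by (rule le_ob[OF P0(1)])
  have bd: "\<exists>n. \<forall>i L N. \<bar>i\<bar> > n \<longrightarrow>
      tri L (Sho C i M) N \<longrightarrow> L \<in> ge 1 \<longrightarrow> N \<in> le 0 \<longrightarrow> perp P N" if M: "M \<in> Ob C" for M
  proof -
    obtain n where n: "\<And>i. \<bar>i\<bar> > n \<Longrightarrow> zero_obj (t_heart C A B) (t_H C A B i M)"
      using bounded M by (auto simp: t_ess_bounded_def)
    have "perp P N" if i: "\<bar>i\<bar> > n" and T: "tri L (Sho C i M) N" "L \<in> ge 1" "N \<in> le 0" for i L N
    proof -
      have "zero_obj (t_heart C A B) (t_H C A B (- i) M)" using n[of "- i"] i by simp
      then obtain L' N' where T': "tri L' M N'" "L' \<in> ge (- i + 1)" "N' \<in> le (- i - 1)"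
        using H_zero_decomposition[OF M] by blast
      have L': "Sho C i L' \<in> ge 1" and N': "Sho C i N' \<in> le (- 1)"
        using T'(2,3) ge_ob[OF T'(2)] le_ob[OF T'(3)] by (simp_all add: ge_shift le_shift minus_diff_commute)
      have "isomorphic C (Sho C i N') N"
        using truncation_unique[OF tri_shift[OF T'(1)] T(1) L' T(2)] le_mono[OF _ N', of 0] T(3) by simp
      then show "perp P N" using perp_iso_right perp_ge_le[OF P0(2) N'] by simp
    qed
    then show ?thesis by blast
  qed
  obtain D Q K u \<rho> where T: "tri K D Q" "K \<in> ge 1" "Q \<in> le 0" and \<rho>: "arr D Q \<rho>" and u: "arr P Q u"
    and D1: "\<And>X. X \<in> ge 1 \<Longrightarrow> perp D X"
    and D2: "\<And>X f. \<lbrakk>X \<in> le 0; arr D X f\<rbrakk> \<Longrightarrow> \<exists>!g. arr Q X g \<and> g \<cdot> \<rho> = f"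
    and D3: "\<And>X f. \<lbrakk>X \<in> le 0; arr P X f\<rbrakk> \<Longrightarrow> \<exists>!g. arr Q X g \<and> g \<cdot> u = f"
    by (rule truncated_hom_corepresentable[OF sat oP projective_perp[OF P] bd])
      (assumption | rule that | blast)+
  have oD: "D \<in> Ob C" and oQ: "Q \<in> Ob C" using \<rho> by (auto simp: arr_def)
  have perpD_le: "perp D Y" if Y: "Y \<in> le (- 1)" for Y
  proof (rule perpI[OF oD le_ob[OF Y]])
    have Y0: "Y \<in> le 0" by (rule le_mono[OF _ Y]) simp
    have oY: "Y \<in> Ob C" by (rule le_ob[OF Y])
    fix f assume f: "arr D Y f"
    then obtain g where g: "arr Q Y g" "g \<cdot> \<rho> = f" using D2[OF Y0] by blast
    have "g \<cdot> u = zm P Y" using perpD[OF perp_ge_le[OF P0(2) Y]] arr_cmp[OF u g(1)] by simp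
    moreover have "zm Q Y \<cdot> u = zm P Y" by (rule cmp_zm_left[OF u oY])
    ultimately have "g = zm Q Y"
      using D3[OF Y0 arr_zm[OF oP oY]] g(1) arr_zm[OF oQ oY] by blast
    then show "f = zm D Y" using g(2) cmp_zm_left[OF \<rho> oY] by simp
  qed
  have DP: "D \<in> t_P C A B" using oD perpD_le D1 by (simp add: t_P_iff)
  have D0: "D \<in> ge 0" using oD perpD_le by (simp add: ge_iff_perp)
  have Q0: "Q \<in> ge 0" using ge_cone[OF T(1), of 0] ge_antimono[OF _ T(2)] D0 by simp
  obtain g where g: "arr Q P g" "g \<cdot> u = Idm C P" using D3[OF P0(1) arr_id[OF oP]] by blast
  have "(u \<cdot> g) \<cdot> u = u" using assoc[OF u g(1) u] g(2) id_right[OF u] by simp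
  then have "u \<cdot> g = Idm C Q"
    using D3[OF T(3) u] arr_cmp[OF g(1) u] arr_id[OF oQ] id_left[OF u] by blast
  then have "isomorphic C Q P" using iso_mapI[OF g(1) u] g(2) isomorphicI oQ oP by blast
  moreover have "isomorphic C Q (t_H0 C A B D)" by (rule H0_unique[OF D0 T(1,2,3)])
  ultimately have "isomorphic C (t_H0 C A B D) P" using isomorphic_sym isomorphic_trans by blast
  moreover have "t_H0 C A B D \<in> le 0" "t_H0 C A B D \<in> ge 0" using H0_triangles[OF oD] by metis+
  ultimately show ?thesis using DP isomorphic_heart by blast
qed

end

section \<open>Weight decompositions of objects bounded below\<close>

context t_triangulated
begin

text \<open>
  Let \<open>X\<close> be the truncation of \<open>M\<close> to the heart. An epimorphism \<open>H_0(D) \<rightarrow> X\<close> gives a map \<open>D \<rightarrow> X\<close>,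
  which lifts to \<open>g : D \<rightarrow> M\<close> since \<open>D\<close> has no maps to \<open>\<ge> 1\<close>. A map \<open>s\<close> from the cone of \<open>g\<close> to
  \<open>\<le> 0\<close> restricts to a map \<open>M \<rightarrow> X \<rightarrow> Z\<close> that vanishes on \<open>H_0(D)\<close>; so it is zero, and so is \<open>s\<close>,
  because \<open>D[1]\<close> has no maps to \<open>\<le> 0\<close> either.
\<close>
lemma cone_of_projective_cover:
  assumes M: "M \<in> ge 0"
    and cover: "\<And>X. \<lbrakk>X \<in> le 0; X \<in> ge 0\<rbrakk> \<Longrightarrow>
      \<exists>D\<in>t_P C A B. \<exists>e. epi_map (t_heart C A B) (t_H0 C A B D) X e"
  obtains D N where "D \<in> t_P C A B" "tri D M N" "N \<in> ge 1"
proof -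
  obtain K X k \<pi> d where TM: "Tri C K M X k \<pi> d" and K: "K \<in> ge 1" and X: "X \<in> le 0"
    using decomposition[OF ge_ob[OF M], of 1] by (metis diff_self)
  note mM = tri_arr[OF TM] and oM = tri_ob[OF TM]
  have X0: "X \<in> ge 0" using ge_cone[OF triI[OF TM], of 0] ge_antimono[OF _ K] M by simp
  obtain D e where D: "D \<in> t_P C A B" and e: "epi_map (t_heart C A B) (t_H0 C A B D) X e"
    using cover[OF X X0] by blast
  let ?H = "t_H0 C A B D"
  have H: "?H \<in> le 0" "?H \<in> ge 0" and ea: "arr ?H X e" using e by (auto simp: epi_map_heart_iff)
  have D0: "D \<in> ge 0" using D by (simp add: t_P_iff ge_iff_perp)
  have oD: "D \<in> Ob C" and oH: "?H \<in> Ob C" using ge_ob D0 H by auto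
  obtain K' where "tri K' D ?H" and K': "K' \<in> ge 1" using H0_of_ge[OF D0] .
  then obtain k' p d' where TD: "Tri C K' D ?H k' p d'" by (auto simp: tri_def)
  note mD = tri_arr[OF TD]
  have ep: "arr D X (e \<cdot> p)" by (rule arr_cmp[OF mD(2) ea])
  have "Sho C 1 K \<in> ge 1" using ge_antimono[OF _ K, of 0] oM by (simp add: ge_shift)
  then have "perp D (Sho C 1 K)" using D by (simp add: t_P_iff)
  then obtain g where g: "arr D M g" "\<pi> \<cdot> g = e \<cdot> p" using tri_lift2[OF TM ep] by blast
  obtain N n c where TN: "Tri C D M N g n c" using TR1_cone[of D M g] g(1) unfolding arr_def by blast
  note mN = tri_arr[OF TN] and oN = tri_ob[OF TN]
  have "perp N Z" if Z: "Z \<in> le 0" for Z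
  proof (rule perpI[OF oN(3) le_ob[OF Z]])
    have oZ: "Z \<in> Ob C" by (rule le_ob[OF Z])
    have ge1: "Sho C 1 K' \<in> ge 1" "Sho C 1 D \<in> ge 1"
      using ge_antimono[OF _ K', of 0] ge_ob[OF K'] D0 oD by (simp_all add: ge_shift)
    fix s assume s: "arr N Z s"
    have sn: "arr M Z (s \<cdot> n)" by (rule arr_cmp[OF mN(2) s])
    obtain z where z: "arr X Z z" "z \<cdot> \<pi> = s \<cdot> n"
      using tri_extend[OF TM sn] perp_ge_le[OF K Z] by auto
    have "(z \<cdot> e) \<cdot> p = (z \<cdot> \<pi>) \<cdot> g"
      using assoc[OF mD(2) ea z(1)] assoc[OF g(1) mM(2) z(1)] g(2) by simp
    also have "\<dots> = s \<cdot> (n \<cdot> g)" using assoc[OF g(1) mN(2) s] z(2) by simp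
    also have "\<dots> = zm D Z" using tri_comp_zero[OF TN] cmp_zm_right[OF oD s] by simp
    also have "\<dots> = zm ?H Z \<cdot> p" using cmp_zm_left[OF mD(2) oZ] by simp
    finally have ze: "z \<cdot> e = zm ?H Z"
      using perp_ge_le[OF ge1(1) Z]
      by (intro tri_epi2[OF TD _ arr_cmp[OF ea z(1)] arr_zm[OF oH oZ]]) auto
    \<comment> \<open>The epimorphism \<open>e\<close> only cancels against maps to the heart, where \<open>Z\<close> need not lie. Its
        truncation \<open>L\<close> does, and maps from \<open>\<ge> 0\<close> to \<open>Z\<close> are the same as maps to \<open>L\<close>.\<close>
    obtain L W l w b where TZ: "Tri C L Z W l w b" and L: "L \<in> ge 0" and W: "W \<in> le (- 1)"
      using decomposition[OF oZ, of 0] by (metis diff_0)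
    note mZ = tri_arr[OF TZ] and oZs = tri_ob[OF TZ]
    have L0: "L \<in> le 0" using le_cocone[OF triI[OF TZ], of 0] le_mono[OF _ W] Z by simp
    obtain z' where z': "arr X L z'" "l \<cdot> z' = z"
      using tri_lift[OF TZ z(1)] perp_ge_le[OF X0 W] by auto
    have W1: "Sho C (- 1) W \<in> le (- 1)" using le_mono[OF _ W, of 0] oZs by (simp add: le_shift)
    have "l \<cdot> (z' \<cdot> e) = l \<cdot> zm ?H L"
      using assoc[OF ea z'(1) mZ(1)] z'(2) ze cmp_zm_right[OF oH mZ(1)] by simp
    then have "z' \<cdot> e = zm ?H L"
      using perp_ge_le[OF H(2) W1]
      by (intro tri_mono1[OF TZ _ arr_cmp[OF ea z'(1)] arr_zm[OF oH oZs(1)]]) auto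
    then have "z' \<cdot> e = zm X L \<cdot> e" using cmp_zm_left[OF ea oZs(1)] by simp
    then have "z' = zm X L"
      using e L L0 z'(1) arr_zm[OF oM(3) oZs(1)] unfolding epi_map_heart_iff by blast
    then have "z = zm X Z" using z'(2) cmp_zm_right[OF oM(3) mZ(1)] by simp
    then have "s \<cdot> n = zm N Z \<cdot> n"
      using z(2) cmp_zm_left[OF mM(2) oZ] cmp_zm_left[OF mN(2) oZ] by simp
    then show "s = zm N Z"
      using perp_ge_le[OF ge1(2) Z] by (intro tri_epi2[OF TN _ s arr_zm[OF oN(3) oZ]]) auto
  qed
  then have "N \<in> ge 1" using oN(3) by (simp add: ge_iff_perp)
  with D triI[OF TN] show thesis by (rule that)
qed

definition w_le where "w_le = {X \<in> Ob C. \<forall>Y\<in>ge 1. perp X Y}"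

lemma w_leD: "X \<in> w_le \<Longrightarrow> Y \<in> ge 1 \<Longrightarrow> perp X Y"
  by (simp add: w_le_def)

lemma w_le_middle: "tri X Y Z \<Longrightarrow> X \<in> w_le \<Longrightarrow> Z \<in> w_le \<Longrightarrow> Y \<in> w_le"
  unfolding tri_def w_le_def by (auto intro: perp_middle_left dest: tri_ob)

text \<open>
  Each passage to the cone of a projective cover raises the lower bound of \<open>M\<close> by one, until it is
  \<open>1\<close>. The objects \<open>D[-k]\<close> with \<open>D\<close> in \<open>P_t\<close> and \<open>k \<ge> 0\<close> that split off belong to \<open>w_le\<close>, and the
  octahedral axiom assembles them.
\<close>
lemma weight_decomposition_of_ge:
  assumes cover: "\<And>X. \<lbrakk>X \<in> le 0; X \<in> ge 0\<rbrakk> \<Longrightarrow>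
      \<exists>D\<in>t_P C A B. \<exists>e. epi_map (t_heart C A B) (t_H0 C A B D) X e"
    and M: "M \<in> ge n"
  shows "\<exists>L N. tri L M N \<and> L \<in> w_le \<and> N \<in> ge 1"
proof -
  have "M \<in> ge (1 - int k) \<Longrightarrow> \<exists>L N. tri L M N \<and> L \<in> w_le \<and> N \<in> ge 1" for k
  proof (induction k arbitrary: M)
    case 0
    then have M: "M \<in> ge 1" by simp
    obtain O' where O': "tri O' M M" "\<And>X. X \<in> Ob C \<Longrightarrow> perp O' X"
      using tri_zero_cocone[OF ge_ob[OF M]] by blast
    then have "O' \<in> w_le" using tri_objects ge_ob by (auto simp: w_le_def)
    with O'(1) M show ?case by blast
  next
    case (Suc k)
    let ?k = "int k"
    have oM: "M \<in> Ob C" by (rule ge_ob[OF Suc.prems])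
    have "Sho C ?k M \<in> ge 0" using Suc.prems oM by (simp add: ge_shift)
    then obtain D N where D: "D \<in> t_P C A B" and T: "tri D (Sho C ?k M) N" and N: "N \<in> ge 1"
      using cone_of_projective_cover[OF _ cover] by metis
    have oD: "D \<in> Ob C" and oN: "N \<in> Ob C" using tri_objects[OF T] by auto
    let ?D = "Sho C (- ?k) D" and ?N = "Sho C (- ?k) N"
    have T': "tri ?D M ?N" using tri_shift[OF T, of "- ?k"] oM by (simp add: sho_sho sho_0)
    have "?N \<in> ge (1 - int k)" using ge_antimono[OF _ N, of 1] oN by (simp add: ge_shift)
    then obtain L' N' where L': "tri L' ?N N'" "L' \<in> w_le" "N' \<in> ge 1" using Suc.IH by blast
    have "?D \<in> w_le"
    proof -
      have "perp ?D Y" if Y: "Y \<in> ge 1" for Y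
      proof -
        have "Sho C ?k Y \<in> ge 1" using ge_antimono[OF _ Y, of "1 - ?k"] ge_ob[OF Y] by (simp add: ge_shift)
        then show ?thesis
          using D perp_shift_left_iff[OF oD ge_ob[OF Y], of "- ?k"] by (simp add: t_P_iff)
      qed
      then show ?thesis using sho_ob[OF oD] by (simp add: w_le_def)
    qed
    moreover obtain L where "tri L M N'" "tri ?D L L'" using tri_octahedron[OF T' L'(1)] .
    ultimately show ?case using w_le_middle L'(2,3) by blast
  qed
  moreover have "M \<in> ge (1 - int (nat (1 - n)))" by (rule ge_antimono[OF _ M]) simp
  ultimately show ?thesis by blast
qed

end

section \<open>The adjacent weight structure\<close>

context t_triangulated
begin

definition t_minus_inf where "t_minus_inf = {X. \<forall>n. X \<in> le n}"

definition t_plus where "t_plus = {X. \<exists>n. X \<in> ge n}"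

text \<open>
  Decompose \<open>M\<close> at a level \<open>n\<close> below which its homology vanishes. Each vanishing \<open>H_i\<close> with \<open>i < n\<close>
  pushes the upper bound of the truncation \<open>N\<close> down by one, so that \<open>N\<close> lies in every \<open>\<le> m\<close>.
\<close>
lemma stable_t_structure:
  assumes below: "t_ess_bounded_below C A B"
  shows "t_structure C t_minus_inf t_plus"
proof -
  have ob: "t_minus_inf \<subseteq> Ob C" "t_plus \<subseteq> Ob C"
    using le_ob ge_ob by (auto simp: t_minus_inf_def t_plus_def)
  have "\<exists>L N. t_decomp C t_minus_inf t_plus M L N" if M: "M \<in> Ob C" for M
  proof -
    obtain n where n: "\<And>i. i < n \<Longrightarrow> zero_obj (t_heart C A B) (t_H C A B i M)"
      using below M by (auto simp: t_ess_bounded_below_def)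
    obtain L N where T: "tri L M N" and L: "L \<in> ge n" and N: "N \<in> le (n - 1)"
      using decomposition[OF M] unfolding tri_def by metis
    have oN: "N \<in> Ob C" by (rule le_ob[OF N])
    have Nk: "N \<in> le (n - 1 - int k)" for k
    proof (induction k)
      case (Suc k)
      obtain L' N' where T': "tri L' M N'" and L': "L' \<in> ge (n - 1 - int k + 1)"
        and N': "N' \<in> le (n - 1 - int k - 1)"
        using H_zero_decomposition[OF M n[of "n - 1 - int k"]] by auto
      have "isomorphic C N' N"
        using ge_antimono[OF _ L, of "n - int k"] le_mono[OF _ N', of "n - 1 - int k"] L' Suc.IH
        by (intro truncation_unique[OF T' T, of "n - int k"]) (auto simp: algebra_simps)
      then show ?case using le_iso[OF N'] by (simp add: algebra_simps)
    qed (use N in simp)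
    have "N \<in> le m" for m
      by (rule le_mono[OF _ Nk[of "nat (n - 1 - m)"]]) simp
    then have "N \<in> shift_class C (- 1) t_minus_inf"
      unfolding shift_class_iff[OF ob(1)] using oN by (simp add: t_minus_inf_def le_shift)
    then show ?thesis using T L unfolding t_decomp_def tri_def t_plus_def by blast
  qed
  moreover have "t_minus_inf \<subseteq> shift_class C 1 t_minus_inf"
    unfolding shift_class_iff[OF ob(1)] subset_iff
    by (auto simp: t_minus_inf_def le_shift le_ob)
  moreover have "shift_class C 1 t_plus \<subseteq> t_plus"
  proof
    fix X assume "X \<in> shift_class C 1 t_plus"
    then obtain Y where Y: "X = Sho C 1 Y" "Y \<in> t_plus" by (auto simp: shift_class_def)
    from Y(2) obtain n where "Y \<in> ge n" unfolding t_plus_def by blast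
    with Y(1) have "X \<in> ge (n + 1)" by (simp add: ge_shift ge_ob)
    then show "X \<in> t_plus" by (auto simp: t_plus_def)
  qed
  moreover have "orth C (shift_class C 1 t_plus) t_minus_inf"
    unfolding orth_def
  proof (intro ballI)
    fix X Y assume "X \<in> shift_class C 1 t_plus" and Y: "Y \<in> t_minus_inf"
    then have "X \<in> t_plus" using \<open>shift_class C 1 t_plus \<subseteq> t_plus\<close> by blast
    then obtain n where X: "X \<in> ge n" unfolding t_plus_def by blast
    have "Y \<in> le (n - 1)" using Y unfolding t_minus_inf_def by blast
    then show "zero_module (Hom C X Y)" using perp_ge_le[OF X] by (simp add: perp_def)
  qed
  moreover have "iso_closed C t_minus_inf" "iso_closed C t_plus"
    using le_iso ge_iso unfolding iso_closed_def t_minus_inf_def t_plus_def by blast+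
  ultimately show ?thesis using ob unfolding t_structure_def by blast
qed

text \<open>
  In the shift-stable \<open>t\<close>-structure let \<open>D\<close> be the object with \<open>Hom(D, X) \<cong> Hom(M, T X)\<close>. It comes with
  maps \<open>D \<rightarrow> Q\<close> and \<open>u : M \<rightarrow> Q\<close> which are both universal among maps to \<open>t_minus_inf\<close>. The cone of \<open>u\<close>
  lies in \<open>t_plus\<close>, to which \<open>D\<close> is orthogonal, so that the former map lifts to \<open>d : D \<rightarrow> M\<close>.
  Every map from \<open>D\<close> to \<open>t_minus_inf\<close> then extends uniquely along \<open>d\<close>, and the cone of \<open>d\<close> lies in
  \<open>t_plus\<close> for the same reason as that of \<open>u\<close>.
\<close>
lemma left_complement_of_t_plus:
  assumes sat: "R_saturated R (op_cat C)" and below: "t_ess_bounded_below C A B"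
    and M: "M \<in> Ob C"
  obtains D Y n where "tri D M Y" "Y \<in> ge n" "\<And>m X. X \<in> ge m \<Longrightarrow> perp D X"
proof -
  interpret t': t_triangulated R C t_minus_inf t_plus
    by unfold_locales (rule stable_t_structure[OF below])
  have ge': "shift_class C n t_plus = t_plus" for n
  proof (rule Set.set_eqI)
    fix X
    have "X \<in> shift_class C n t_plus \<longleftrightarrow> X \<in> Ob C \<and> (\<exists>m. X \<in> ge (m + n))"
      unfolding t'.mem_ge_iff by (auto simp: t_plus_def ge_shift)
    also have "\<dots> \<longleftrightarrow> X \<in> t_plus"
      unfolding t_plus_def using ge_ob by (auto intro: exI[of _ "m - n" for m])
    finally show "X \<in> shift_class C n t_plus \<longleftrightarrow> X \<in> t_plus" .
  qed
  have le': "shift_class C n t_minus_inf = t_minus_inf" for n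
  proof (rule Set.set_eqI)
    fix X
    have "X \<in> shift_class C n t_minus_inf \<longleftrightarrow> X \<in> Ob C \<and> (\<forall>m. X \<in> le (m + n))"
      unfolding t'.mem_le_iff by (auto simp: t_minus_inf_def le_shift)
    also have "\<dots> \<longleftrightarrow> X \<in> t_minus_inf"
      unfolding t_minus_inf_def using le_ob by (auto dest: spec[of _ "m - n" for m])
    finally show "X \<in> shift_class C n t_minus_inf \<longleftrightarrow> X \<in> t_minus_inf" .
  qed
  have ob_inf: "X \<in> Ob C" if "X \<in> t_minus_inf" for X
    using that le_ob by (auto simp: t_minus_inf_def)
  have sho_inf: "Sho C n X \<in> t_minus_inf" if "X \<in> t_minus_inf" for n X
    using that ob_inf[OF that] by (simp add: t_minus_inf_def le_shift)
  have "perp M (Sho C 1 N)" if "N \<in> t_minus_inf" "N \<in> t_plus" for N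
  proof -
    have "perp N N" using t'.perp_ge_le[of N 1 N 0] that by (simp add: ge' le')
    then show ?thesis using perp_self_imp_perp[OF perp_shift M] by blast
  qed
  then have ext: "\<And>N. \<lbrakk>N \<in> shift_class C 0 t_minus_inf; N \<in> shift_class C 0 t_plus\<rbrakk>
      \<Longrightarrow> perp M (Sho C 1 N)"
    by (simp add: ge' le')
  have bd: "\<exists>n. \<forall>i L N. \<bar>i\<bar> > n \<longrightarrow> tri L (Sho C i X) N \<longrightarrow> L \<in> shift_class C 1 t_plus \<longrightarrow>
      N \<in> shift_class C 0 t_minus_inf \<longrightarrow> perp M N" if X: "X \<in> Ob C" for X
  proof -
    obtain L0 N0 where T0: "tri L0 X N0" "L0 \<in> t_plus" "N0 \<in> t_minus_inf"
      using t'.decomposition[OF X, of 0] unfolding tri_def ge' le' by metis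
    obtain n where n: "\<And>i. \<bar>i\<bar> > n \<Longrightarrow> perp M (Sho C i N0)"
      using saturated_hom_bounded[OF sat M] tri_objects[OF T0(1)] by blast
    have "perp M N" if i: "\<bar>i\<bar> > n" and T: "tri L (Sho C i X) N" "L \<in> t_plus" "N \<in> t_minus_inf"
      for i L N
    proof -
      have "Sho C i L0 \<in> t_plus" using T0(2) ge'[of i] by (auto simp: shift_class_def)
      then have "isomorphic C (Sho C i N0) N"
        using t'.truncation_unique[OF tri_shift[OF T0(1)] T(1), of 0] T(2,3) sho_inf[OF T0(3)]
        by (simp add: ge' le')
      then show ?thesis using perp_iso_right n[OF i] by blast
    qed
    then show ?thesis by (auto simp: ge' le')
  qed
  obtain K D Q u \<rho> where "tri K D Q" "K \<in> shift_class C 1 t_plus" "Q \<in> shift_class C 0 t_minus_inf"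
    and \<rho>: "arr D Q \<rho>" and u: "arr M Q u"
    and "\<And>X. X \<in> shift_class C 1 t_plus \<Longrightarrow> perp D X"
    and "\<And>X f. \<lbrakk>X \<in> shift_class C 0 t_minus_inf; arr D X f\<rbrakk> \<Longrightarrow> \<exists>!g. arr Q X g \<and> g \<cdot> \<rho> = f"
    and "\<And>X f. \<lbrakk>X \<in> shift_class C 0 t_minus_inf; arr M X f\<rbrakk> \<Longrightarrow> \<exists>!g. arr Q X g \<and> g \<cdot> u = f"
    by (rule t'.truncated_hom_corepresentable[OF sat M ext bd]) (assumption | rule that | blast)+
  then have D: "\<And>X. X \<in> t_plus \<Longrightarrow> perp D X"
    and D\<rho>: "\<And>X f. \<lbrakk>X \<in> t_minus_inf; arr D X f\<rbrakk> \<Longrightarrow> \<exists>!g. arr Q X g \<and> g \<cdot> \<rho> = f"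
    and Mu: "\<And>X f. \<lbrakk>X \<in> t_minus_inf; arr M X f\<rbrakk> \<Longrightarrow> \<exists>!g. arr Q X g \<and> g \<cdot> u = f"
    by (simp_all add: ge' le')
  have oD: "D \<in> Ob C" and oQ: "Q \<in> Ob C" using \<rho> arr_ob by auto
  \<comment> \<open>As \<open>t_minus_inf\<close> is stable under shifts, a map \<open>v\<close> that is universal for it induces bijections
      on \<open>Hom(-, W)\<close> and on \<open>Hom(-[1], W)\<close>, so that nothing is left for its cone.\<close>
  have cone: "Z \<in> t_plus"
    if T: "Tri C X Y Z v g h"
      and v: "\<And>W f. \<lbrakk>W \<in> t_minus_inf; arr X W f\<rbrakk> \<Longrightarrow> \<exists>!b. arr Y W b \<and> b \<cdot> v = f" for X Y Z v g h
  proof -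
    note o = tri_ob[OF T] and m = tri_arr[OF T]
    have "perp Z W" if W: "W \<in> t_minus_inf" for W
    proof (rule perp_cone_left[OF T ob_inf[OF W]])
      fix a assume "arr Y W a" "a \<cdot> v = zm X W"
      then show "a = zm Y W"
        using v[OF W arr_zm[OF o(1) ob_inf[OF W]]] arr_zm[OF o(2) ob_inf[OF W]]
          cmp_zm_left[OF m(1) ob_inf[OF W]] by blast
    next
      fix a assume a: "arr (Sho C 1 X) W a"
      let ?W = "Sho C (- 1) W"
      have W1: "?W \<in> t_minus_inf" by (rule sho_inf[OF W])
      have WW: "Sho C 1 ?W = W" using ob_inf[OF W] by (simp add: sho_sho sho_0)
      obtain f where f: "arr X ?W f" "Shm C 1 f = a"
        using shm_surj[OF o(1) ob_inf[OF W1], of 1 a] a WW by auto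
      obtain b where b: "arr Y ?W b" "b \<cdot> v = f" using v[OF W1 f(1)] by blast
      show "\<exists>b. arr (Sho C 1 Y) W b \<and> b \<cdot> Shm C 1 v = a"
        using arr_shm[OF b(1), of 1] shm_comp[OF m(1) b(1), of 1] b(2) f(2) WW by auto
    qed
    then have "Z \<in> shift_class C 0 t_plus"
      unfolding t'.ge_iff_perp using o(3) by (simp add: le')
    then show ?thesis by (simp add: ge')
  qed
  obtain Z g h where TZ: "Tri C M Q Z u g h" using TR1_cone[OF M oQ] u unfolding arr_def by blast
  obtain d where d: "arr D M d" "u \<cdot> d = \<rho>" using tri_lift[OF TZ \<rho> D[OF cone[OF TZ Mu]]] by blast
  obtain Y n c where TY: "Tri C D M Y d n c" using TR1_cone[OF oD M] d unfolding arr_def by blast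
  have "Y \<in> t_plus"
  proof (rule cone[OF TY])
    fix W f assume W: "W \<in> t_minus_inf" and f: "arr D W f"
    obtain g where g: "arr Q W g" "g \<cdot> \<rho> = f" using D\<rho>[OF W f] by blast
    have comp: "(k \<cdot> u) \<cdot> d = k \<cdot> \<rho>" if "arr Q W k" for k
      using assoc[OF d(1) u that] d(2) by simp
    show "\<exists>!b. arr M W b \<and> b \<cdot> d = f"
    proof (rule ex1I[of _ "g \<cdot> u"])
      show "arr M W (g \<cdot> u) \<and> (g \<cdot> u) \<cdot> d = f" using arr_cmp[OF u g(1)] comp[OF g(1)] g(2) by simp
      fix b assume b: "arr M W b \<and> b \<cdot> d = f"
      then obtain k where k: "arr Q W k" "k \<cdot> u = b" using Mu[OF W] by blast
      then have "k \<cdot> \<rho> = f" using comp[OF k(1)] b by simp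
      then have "k = g" using D\<rho>[OF W f] k(1) g by blast
      then show "b = g \<cdot> u" using k(2) by simp
    qed
  qed
  then obtain n where "Y \<in> ge n" by (auto simp: t_plus_def)
  moreover have "perp D X" if "X \<in> ge m" for m X using D that by (auto simp: t_plus_def)
  ultimately show thesis using that triI[OF TY] by blast
qed

text \<open>
  For a weight decomposition of \<open>M\<close>, take the triangle \<open>D \<rightarrow> M \<rightarrow> Y\<close> with \<open>D\<close> orthogonal to all \<open>\<ge> n\<close> and
  \<open>Y\<close> bounded below, then a weight decomposition of \<open>Y\<close>; the new left term is an extension of the
  one for \<open>Y\<close> by \<open>D\<close>.
\<close>
theorem adjacent_weight_structure:
  assumes sat: "R_saturated R (op_cat C)" and below: "t_ess_bounded_below C A B"
    and cover: "\<And>X. \<lbrakk>X \<in> le 0; X \<in> ge 0\<rbrakk> \<Longrightarrow>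
      \<exists>D\<in>t_P C A B. \<exists>e. epi_map (t_heart C A B) (t_H0 C A B D) X e"
  shows "weight_structure C w_le B" and "w_ess_bounded_below C w_le B"
proof -
  have ob: "w_le \<subseteq> Ob C" by (auto simp: w_le_def)
  have w_shift: "X \<in> shift_class C n w_le" if D: "\<And>m Y. Y \<in> ge m \<Longrightarrow> perp X Y" and X: "X \<in> Ob C" for X n
    unfolding shift_class_iff[OF ob]
  proof
    have "perp (Sho C (- n) X) Y" if Y: "Y \<in> ge 1" for Y
    proof -
      have "Sho C n Y \<in> ge (1 + n)" using Y ge_ob[OF Y] by (simp add: ge_shift)
      from D[OF this] show ?thesis using perp_shift_left_iff[OF X ge_ob[OF Y], of "- n"] by simp
    qed
    then show "Sho C (- n) X \<in> w_le" using sho_ob[OF X] by (simp add: w_le_def)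
  qed (rule X)
  have "retract_closed C w_le"
    unfolding retract_closed_def w_le_def using perp_retract by (auto simp: arr_def)
  moreover have "retract_closed C B"
    unfolding retract_closed_def
  proof (intro ballI impI)
    fix X Y assume X: "X \<in> B" and Y: "Y \<in> Ob C"
      and "\<exists>i\<in>hom_set C Y X. \<exists>p\<in>hom_set C X Y. p \<cdot> i = Idm C Y"
    then obtain i p where ip: "arr Y X i" "arr X Y p" "p \<cdot> i = Idm C Y"
      using AB_ob(2) by (auto simp: arr_def)
    have "X \<in> ge 0" using X by (simp only: ge_0)
    then have "Y \<in> ge 0" using Y perp_retract[OF _ ip] unfolding ge_iff_perp by blast
    then show "Y \<in> B" by (simp only: ge_0)
  qed
  moreover have "w_le \<subseteq> shift_class C 1 w_le"
  proof
    fix X assume X: "X \<in> w_le"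
    then have oX: "X \<in> Ob C" using ob by blast
    have "perp (Sho C (- 1) X) Y" if Y: "Y \<in> ge 1" for Y
    proof -
      have "Sho C 1 Y \<in> ge 1" using ge_antimono[OF _ Y, of 0] ge_ob[OF Y] by (simp add: ge_shift)
      then show ?thesis
        using w_leD[OF X] perp_shift_left_iff[OF oX ge_ob[OF Y], of "- 1"] by simp
    qed
    then show "X \<in> shift_class C 1 w_le"
      unfolding shift_class_iff[OF ob] using oX sho_ob by (simp add: w_le_def)
  qed
  moreover have "shift_class C 1 B \<subseteq> B" using t by (simp add: t_structure_def)
  moreover have "orth C w_le (shift_class C 1 B)" by (auto simp: orth_def w_le_def perp_def)
  moreover have "\<exists>L N f g h. Tri C L M N f g h \<and> L \<in> w_le \<and> N \<in> shift_class C 1 B"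
    if M: "M \<in> Ob C" for M
  proof -
    obtain D Y n where D: "tri D M Y" and Y: "Y \<in> ge n" and perp_D: "\<And>m X. X \<in> ge m \<Longrightarrow> perp D X"
      using left_complement_of_t_plus[OF sat below M] by blast
    have "D \<in> w_le" using perp_D tri_objects[OF D] by (simp add: w_le_def)
    moreover obtain L N where L: "tri L Y N" "L \<in> w_le" "N \<in> ge 1"
      using weight_decomposition_of_ge[OF cover Y] by blast
    moreover obtain L' where "tri L' M N" "tri D L' L" using tri_octahedron[OF D L(1)] .
    ultimately show ?thesis using w_le_middle unfolding tri_def by blast
  qed
  ultimately show "weight_structure C w_le B"
    using ob AB_ob(2) by (simp add: weight_structure_def)
  show "w_ess_bounded_below C w_le B"
    unfolding w_ess_bounded_below_def
  proof
    fix M assume M: "M \<in> Ob C"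
    obtain S where S: "direct_sum C M (Sho C 1 M) S" using sum_ex[OF M sho_ob[OF M]] by blast
    then have oS: "S \<in> Ob C" by (simp add: direct_sum_def)
    obtain D Y n where D: "tri D S Y" and Y: "Y \<in> ge n" and perp_D: "\<And>m X. X \<in> ge m \<Longrightarrow> perp D X"
      using left_complement_of_t_plus[OF sat below oS] by blast
    have oD: "D \<in> Ob C" and oY: "Y \<in> Ob C" using tri_objects[OF D] by auto
    have "direct_sum C (Sho C (- n) M) (Sho C 1 (Sho C (- n) M)) (Sho C (- n) S)"
      using direct_sum_shift[OF S, of "- n"] M by (simp add: sho_sho)
    moreover have "tri (Sho C (- n) D) (Sho C (- n) S) (Sho C (- n) Y)" by (rule tri_shift[OF D])
    moreover have "Sho C (- n) Y \<in> B" using Y by (simp add: mem_ge_iff)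
    moreover have "Sho C (- n) D \<in> shift_class C i w_le" for i
    proof (rule w_shift[OF _ sho_ob[OF oD]])
      fix m X assume X: "X \<in> ge m"
      have "Sho C n X \<in> ge (m + n)" using X ge_ob[OF X] by (simp add: ge_shift)
      from perp_D[OF this] show "perp (Sho C (- n) D) X"
        using perp_shift_left_iff[OF oD ge_ob[OF X], of "- n"] by simp
    qed
    ultimately show "\<exists>n S D Y f g h.
        direct_sum C (Sho C (- n) M) (Sho C 1 (Sho C (- n) M)) S \<and>
        Tri C D S Y f g h \<and> Y \<in> B \<and> D \<in> (\<Inter>i. shift_class C i w_le)"
      unfolding tri_def by blast
  qed
qed

end

theorem theorem5p3p3:
  fixes R :: "('r, 'q) ring_scheme"
    and C :: "('r, 'o, 'm) tri_cat"
    and A B :: "'o set"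
  assumes "cring R" and "noetherian_ring R"
    and "linear_triangulated_category R C"
    and "R_saturated R (op_cat C)"
    and "t_structure C A B"
    and "t_ess_bounded_below C A B"
    and "enough_projectives (t_heart C A B)"
  shows "(t_ess_bounded C A B \<longrightarrow>
      (\<forall>P. projective_obj (t_heart C A B) P \<longrightarrow>
        (\<exists>P'\<in>t_P C A B. isomorphic (t_heart C A B) (t_H0 C A B P') P))) \<and>
    ((\<forall>P. projective_obj (t_heart C A B) P \<longrightarrow>
        (\<exists>P'\<in>t_P C A B. \<exists>e. epi_map (t_heart C A B) (t_H0 C A B P') P e)) \<longrightarrow>
      (\<exists>U V. weight_structure C U V \<and> w_ess_bounded_below C U V \<and>
        left_adjacent (U, V) (A, B)))"
proof (intro conjI impI allI)
  interpret linear_triangulated_category R C by fact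
  interpret t_triangulated R C A B by unfold_locales fact
  show "\<exists>P'\<in>t_P C A B. isomorphic (t_heart C A B) (t_H0 C A B P') P"
    if "t_ess_bounded C A B" "projective_obj (t_heart C A B) P" for P
    using projectives_lift[OF assms(4) that] .
  assume lift: "\<forall>P. projective_obj (t_heart C A B) P \<longrightarrow>
    (\<exists>P'\<in>t_P C A B. \<exists>e. epi_map (t_heart C A B) (t_H0 C A B P') P e)"
  have cover: "\<exists>D\<in>t_P C A B. \<exists>e. epi_map (t_heart C A B) (t_H0 C A B D) X e"
    if "X \<in> le 0" "X \<in> ge 0" for X
  proof -
    have "X \<in> Ob (t_heart C A B)" using that by (simp only: heart_iff simp_thms)
    then obtain P e where "projective_obj (t_heart C A B) P" and e: "epi_map (t_heart C A B) P X e"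
      using assms(7) unfolding enough_projectives_def by meson
    then obtain D e' where "D \<in> t_P C A B" "epi_map (t_heart C A B) (t_H0 C A B D) P e'"
      using lift by blast
    then show ?thesis using epi_map_heart_comp[OF _ e] by blast
  qed
  note w = adjacent_weight_structure[OF assms(4,6) cover]
  show "\<exists>U V. weight_structure C U V \<and> w_ess_bounded_below C U V \<and> left_adjacent (U, V) (A, B)"
    by (rule exI[of _ w_le], rule exI[of _ B]) (simp add: left_adjacent_def w)
qed

end
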